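(* An NC rational function $\mathfrak{r}(\mathfrak{z})\in\mathbb{H}^2_d$ is outer if and only if $\det\mathfrak{r}(Z)\neq0$ for all $Z$ in the row ball $\mathbb{B}^d_{\mathbb{N}}$.
   Context: Fock space. Fix an integer $d\ge1$. $\mathbb{F}^d$ is the free monoid of words in the letters $1,\dots,d$; for $\alpha=i_1\cdots i_n$ put $\mathfrak{z}^\alpha=\mathfrak{z}_{i_1}\cdots\mathfrak{z}_{i_n}$, $X^\alpha=X_{i_1}\cdots X_{i_n}$. $\mathbb{H}^2_d$ is the Hilbert space of formal power series $f=\sum_\alpha\hat f_\alpha\mathfrak{z}^\alpha$ in noncommuting variables $\mathfrak{z}_1,\dots,\mathfrak{z}_d$ with $\sum_\alpha|\hat f_\alpha|^2<\infty$. $R_k$ is the isometry of right multiplication by $\mathfrak{z}_k$ on $\mathbb{H}^2_d$. An element $f\in\mathbb{H}^2_d$ is outer if it is cyclic for $R_1,\dots,R_d$, i.e. the closed linear span of $\{R^\alpha f:\alpha\in\mathbb{F}^d\}$ is $\mathbb{H}^2_d$. For a row $d$-tuple $X$ of $n\times n$ matrices, $\|X\|=\|\sum_jX_jX_j^*\|^{1/2}$; $\mathbb{B}^d_n=\{X\in(\mathbb{C}^{n\times n})^d:\|X\|<1\}$, $\mathbb{B}^d_{\mathbb{N}}=\bigsqcup_{n\ge1}\mathbb{B}^d_n$. Each $f\in\mathbb{H}^2_d$ defines a function on $\mathbb{B}^d_{\mathbb{N}}$ by $f(Z)=\sum_{k\ge0}\sum_{|\alpha|=k}\hat f_\alpha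 Z^\alpha$. NC rational functions. An NC rational expression is a syntactically valid combination of $\mathfrak{z}_1,\dots,\mathfrak{z}_d$, complex scalars, $+,\cdot,{}^{-1}$ and parentheses; its domain is the set of $d$-tuples of matrices (of any common size $n\times n$) where it can be evaluated. An NC rational function is an equivalence class of expressions with nonempty domain, where two expressions are equivalent if their domains intersect and they agree on the intersection; $\mathrm{Dom}(\mathfrak{r})$ is the union of the domains of representatives. An NC rational function regular at $0$ (i.e. $0\in\mathrm{Dom}(\mathfrak{r})$) belongs to $\mathbb{H}^2_d$ if its power series at $0$ does. *)

theory Defs
  imports
    "Jordan_Normal_Form.Schur_Decomposition"
    "Jordan_Normal_Form.Gauss_Jordan_Elimination"
    "Jordan_Normal_Form.Determinant"
    "HOL-Library.Function_Algebras"
    "HOL-Analysis.L2_Norm"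
    "HOL-Analysis.Infinite_Sum"
begin

text \<open>
  The letters are the elements of a finite type \<open>'d\<close> (so \<open>d = CARD('d) \<ge> 1\<close>), words are lists
  over \<open>'d\<close>, and a formal power series in the noncommuting variables is its coefficient family
  \<open>'d list \<Rightarrow> complex\<close>, with the pointwise vector space structure.
\<close>

type_synonym 'd nc_series = "'d list \<Rightarrow> complex"

type_synonym 'd mat_tuple = "'d \<Rightarrow> complex mat"


section \<open>The Fock space\<close>

definition fock_space :: "'d nc_series set" where
  "fock_space = {f. (\<lambda>\<alpha>. (cmod (f \<alpha>))\<^sup>2) summable_on UNIV}"

definition fock_norm :: "'d nc_series \<Rightarrow> real" where
  "fock_norm f = sqrt (\<Sum>\<^sub>\<infinity>\<alpha>. (cmod (f \<alpha>))\<^sup>2)"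

text \<open>Right multiplication by the variable \<open>k\<close> moves the coefficient at \<open>\<alpha>\<close> to \<open>\<alpha> @ [k]\<close>.\<close>

definition right_shift :: "'d \<Rightarrow> 'd nc_series \<Rightarrow> 'd nc_series" where
  "right_shift k f = (\<lambda>\<beta>. if \<beta> \<noteq> [] \<and> last \<beta> = k then f (butlast \<beta>) else 0)"

text \<open>For \<open>\<alpha> = [i\<^sub>1, \<dots>, i\<^sub>n]\<close> this is the composition of \<open>right_shift i\<^sub>1, \<dots>, right_shift i\<^sub>n\<close>,
  the last one applied first.\<close>

definition right_shift_word :: "'d list \<Rightarrow> 'd nc_series \<Rightarrow> 'd nc_series" where
  "right_shift_word \<alpha> = foldr right_shift \<alpha>"

definition series_scale :: "complex \<Rightarrow> 'd nc_series \<Rightarrow> 'd nc_series" where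
  "series_scale c f = (\<lambda>\<alpha>. c * f \<alpha>)"

lemma vector_space_series_scale: "vector_space (series_scale :: complex \<Rightarrow> 'd nc_series \<Rightarrow> 'd nc_series)"
  by unfold_locales (auto simp: series_scale_def fun_eq_iff algebra_simps)

text \<open>The qualifier distinguishes this from the locale \<open>module\<close> of \<open>HOL-Algebra\<close>.\<close>

abbreviation series_span :: "'d nc_series set \<Rightarrow> 'd nc_series set" where
  "series_span \<equiv> Modules.module.span series_scale"

definition fock_closure :: "'d nc_series set \<Rightarrow> 'd nc_series set" where
  "fock_closure S = {g \<in> fock_space. \<forall>\<epsilon>>0. \<exists>h\<in>S. fock_norm (g - h) < \<epsilon>}"

definition outer :: "'d nc_series \<Rightarrow> bool" where
  "outer f \<longleftrightarrow> f \<in> fock_space \<and>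
     fock_closure (series_span {right_shift_word \<alpha> f | \<alpha>. True}) = fock_space"


section \<open>The row ball and evaluation of power series\<close>

definition mat_tuples :: "nat \<Rightarrow> 'd mat_tuple set" where
  "mat_tuples n = {X. \<forall>j. X j \<in> carrier_mat n n}"

definition euclid_norm :: "complex vec \<Rightarrow> real" where
  "euclid_norm v = L2_set (\<lambda>i. cmod (v $ i)) {..<dim_vec v}"

definition op_norm :: "complex mat \<Rightarrow> real" where
  "op_norm A = (SUP v\<in>{v \<in> carrier_vec (dim_col A). euclid_norm v \<le> 1}. euclid_norm (A *\<^sub>v v))"

text \<open>The sum of the \<open>X j * mat_adjoint (X j)\<close> is written entrywise, because type \<open>mat\<close> has no
  zero of unspecified dimension and hence no \<open>sum\<close>.\<close>

definition row_norm :: "nat \<Rightarrow> ('d::finite) mat_tuple \<Rightarrow> real" where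
  "row_norm n X =
     sqrt (op_norm (mat n n (\<lambda>ij. \<Sum>j\<in>UNIV. (X j * mat_adjoint (X j)) $$ ij)))"

definition row_ball :: "nat \<Rightarrow> ('d::finite) mat_tuple set" where
  "row_ball n = {X \<in> mat_tuples n. row_norm n X < 1}"

definition word_eval :: "nat \<Rightarrow> 'd mat_tuple \<Rightarrow> 'd list \<Rightarrow> complex mat" where
  "word_eval n X \<alpha> = foldr (\<lambda>i A. X i * A) \<alpha> (1\<^sub>m n)"

text \<open>The \<open>(i, j)\<close> entry of the \<open>k\<close>-th homogeneous part of the series at \<open>X\<close>.\<close>

definition homog_entry ::
    "('d::finite) nc_series \<Rightarrow> nat \<Rightarrow> 'd mat_tuple \<Rightarrow> nat \<times> nat \<Rightarrow> nat \<Rightarrow> complex" where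
  "homog_entry f n X ij k = (\<Sum>\<alpha> | length \<alpha> = k. f \<alpha> * word_eval n X \<alpha> $$ ij)"

definition series_eval :: "('d::finite) nc_series \<Rightarrow> nat \<Rightarrow> 'd mat_tuple \<Rightarrow> complex mat" where
  "series_eval f n X = mat n n (\<lambda>ij. \<Sum>k. homog_entry f n X ij k)"


section \<open>Noncommutative rational functions\<close>

datatype 'd nc_expr =
    Var 'd
  | Const complex
  | Add "'d nc_expr" "'d nc_expr"
  | Mul "'d nc_expr" "'d nc_expr"
  | Inv "'d nc_expr"

text \<open>\<open>None\<close> means that the expression cannot be evaluated; \<open>mat_inverse\<close> is \<open>None\<close> exactly on
  singular matrices (see \<open>mat_inverse_eq_Some_iff\<close> below).\<close>

fun nc_eval :: "nat \<Rightarrow> 'd mat_tuple \<Rightarrow> 'd nc_expr \<Rightarrow> complex mat option" where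
  "nc_eval n X (Var j) = Some (X j)"
| "nc_eval n X (Const c) = Some (c \<cdot>\<^sub>m 1\<^sub>m n)"
| "nc_eval n X (Add a b) =
     Option.bind (nc_eval n X a) (\<lambda>A. Option.bind (nc_eval n X b) (\<lambda>B. Some (A + B)))"
| "nc_eval n X (Mul a b) =
     Option.bind (nc_eval n X a) (\<lambda>A. Option.bind (nc_eval n X b) (\<lambda>B. Some (A * B)))"
| "nc_eval n X (Inv a) = Option.bind (nc_eval n X a) mat_inverse"

lemma mat_inverse_eq_Some_iff:
  fixes A :: "'a::field mat"
  assumes "A \<in> carrier_mat n n"
  shows "mat_inverse A = Some B \<longleftrightarrow> B \<in> carrier_mat n n \<and> A * B = 1\<^sub>m n \<and> B * A = 1\<^sub>m n"
proof
  assume "mat_inverse A = Some B"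
  with mat_inverse(2)[OF assms] show "B \<in> carrier_mat n n \<and> A * B = 1\<^sub>m n \<and> B * A = 1\<^sub>m n"
    by blast
next
  assume B: "B \<in> carrier_mat n n \<and> A * B = 1\<^sub>m n \<and> B * A = 1\<^sub>m n"
  then have "A \<in> Units (ring_mat TYPE('a) n ())"
    using assms by (auto simp: Units_def ring_mat_def)
  with mat_inverse(1)[OF assms, where b = "()"] obtain C where C: "mat_inverse A = Some C"
    by (cases "mat_inverse A") auto
  from mat_inverse(2)[OF assms C] have C': "A * C = 1\<^sub>m n" "C \<in> carrier_mat n n"
    by auto
  have "B = B * (A * C)"
    using B C' by (metis right_mult_one_mat)
  also have "\<dots> = C"
    using B C' assms by (subst assoc_mult_mat[symmetric, of _ n n _ n _ n]) auto
  finally show "mat_inverse A = Some B"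
    using C by simp
qed

text \<open>Matrix sizes must be positive: at size 0 every expression could be evaluated.\<close>

definition nc_dom :: "'d nc_expr \<Rightarrow> (nat \<times> 'd mat_tuple) set" where
  "nc_dom e = {(n, X). n \<ge> 1 \<and> X \<in> mat_tuples n \<and> nc_eval n X e \<noteq> None}"

definition valid_exprs :: "'d nc_expr set" where
  "valid_exprs = {e. nc_dom e \<noteq> {}}"

definition nc_equiv :: "('d nc_expr \<times> 'd nc_expr) set" where
  "nc_equiv = {(a, b). a \<in> valid_exprs \<and> b \<in> valid_exprs \<and> nc_dom a \<inter> nc_dom b \<noteq> {} \<and>
     (\<forall>(n, X) \<in> nc_dom a \<inter> nc_dom b. nc_eval n X a = nc_eval n X b)}"

definition nc_rational_functions :: "'d nc_expr set set" where
  "nc_rational_functions = valid_exprs // nc_equiv"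

definition rat_Dom :: "'d nc_expr set \<Rightarrow> (nat \<times> 'd mat_tuple) set" where
  "rat_Dom r = (\<Union>e\<in>r. nc_dom e)"

definition rat_eval :: "'d nc_expr set \<Rightarrow> nat \<Rightarrow> 'd mat_tuple \<Rightarrow> complex mat" where
  "rat_eval r n X = (THE A. \<exists>e\<in>r. (n, X) \<in> nc_dom e \<and> nc_eval n X e = Some A)"

text \<open>The point 0 is the zero tuple of \<open>1 \<times> 1\<close> matrices. At the zero tuple of size \<open>n\<close> an expression
  takes its value at this point times the identity, so all sizes give the same condition.\<close>

definition regular_at_0 :: "'d nc_expr set \<Rightarrow> bool" where
  "regular_at_0 r \<longleftrightarrow> (1, \<lambda>_. 0\<^sub>m 1 1) \<in> rat_Dom r"

definition power_series_at_0 :: "('d::finite) nc_expr set \<Rightarrow> 'd nc_series \<Rightarrow> bool" where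
  "power_series_at_0 r f \<longleftrightarrow>
     (\<forall>n\<ge>1. \<exists>\<delta>>0. \<forall>X\<in>mat_tuples n. row_norm n X < \<delta> \<longrightarrow>
        (n, X) \<in> rat_Dom r \<and>
        (\<forall>i<n. \<forall>j<n. homog_entry f n X (i, j) sums (rat_eval r n X $$ (i, j))))"

end

theory Submission
  imports Defs
begin

text \<open>
  Write \<open>M\<close> for the closed span of the shifts \<open>f z\<^sup>\<alpha>\<close> of \<open>f\<close>.

  If \<open>f\<close> is outer and \<open>y f(Z) = 0\<close> for a row vector \<open>y\<close> and a point \<open>Z\<close> of the row ball, then
  \<open>y h(Z) = 0\<close> for every \<open>h\<close> in \<open>M\<close>, since evaluation at \<open>Z\<close> is continuous on the Fock space and
  multiplicative against polynomials on the right. As \<open>1\<close> lies in \<open>M\<close>, \<open>y = 0\<close>. This is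
  \<open>outer_imp_det_nonzero\<close>.

  Conversely, suppose that \<open>M\<close> is not everything. The orthogonal complement \<open>N\<close> of \<open>M\<close> is invariant
  under the adjoint shifts, and a nonzero finite-dimensional invariant subspace of \<open>N\<close> would give a
  singular point: restricting the adjoint shifts to it yields a tuple of matrices \<open>Z\<close> whose words are
  square summable, so that \<open>Z\<close> is similar to a point of the row ball, and orthogonality to \<open>f\<close>
  says that the functional of evaluation at the empty word is in the left kernel of \<open>f(Z)\<close>. This is
  \<open>annihilator_singular_point\<close>.

  Rationality provides the finite-dimensional subspace. A rational function that is regular at \<open>0\<close> has
  a recognizable power series: its orbit under the adjoint shifts spans a finite-dimensional space
  (\<open>power_series_recognizable\<close>). Let \<open>g\<close> be the orthogonal projection of \<open>1\<close> to \<open>M\<close>; up to a scalar it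
  is the inner factor of \<open>f\<close>. Then \<open>f = g h\<close>, where the coefficients of \<open>h\<close> are the correlations
  of \<open>f\<close> with the shifts of \<open>g\<close>, up to a scalar. Taking correlations with the shifts of \<open>g\<close>
  commutes with the adjoint shifts, so \<open>h\<close> is recognizable along with \<open>f\<close>, hence so is the quotient \<open>g\<close>, and \<open>1 - g\<close> is a
  recognizable element of \<open>N\<close> (\<open>not_outer_recognizable_annihilator\<close>). It is nonzero, as
  otherwise \<open>1\<close> would lie in \<open>M\<close>. The factorization needs \<open>f(0) \<noteq> 0\<close>; if \<open>f(0) = 0\<close>, then \<open>1\<close>
  itself spans a one-dimensional invariant subspace of \<open>N\<close>.
\<close>

section \<open>The inner product of the Fock space\<close>

interpretation ser: vector_space "series_scale :: complex \<Rightarrow> 'd nc_series \<Rightarrow> 'd nc_series"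
  by (rule vector_space_series_scale)

lemma series_scale_apply [simp]: "series_scale c f \<alpha> = c * f \<alpha>"
  by (simp add: series_scale_def)

definition fip :: "'d nc_series \<Rightarrow> 'd nc_series \<Rightarrow> complex" where
  "fip f g = (\<Sum>\<^sub>\<infinity>\<alpha>. f \<alpha> * cnj (g \<alpha>))"

lemma mem_fock_iff: "f \<in> fock_space \<longleftrightarrow> (\<lambda>\<alpha>. (cmod (f \<alpha>))\<^sup>2) summable_on UNIV"
  by (simp add: fock_space_def)

lemma fock_abs_summable:
  assumes "f \<in> fock_space" "g \<in> fock_space"
  shows "(\<lambda>\<alpha>. cmod (f \<alpha>) * cmod (g \<alpha>)) summable_on UNIV"
proof (rule summable_on_comparison_test)
  show "(\<lambda>\<alpha>. (cmod (f \<alpha>))\<^sup>2 + (cmod (g \<alpha>))\<^sup>2) summable_on UNIV"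
    using assms by (auto simp: mem_fock_iff intro: summable_on_add)
  fix \<alpha>
  have "0 \<le> (cmod (f \<alpha>) - cmod (g \<alpha>))\<^sup>2" by simp
  also have "\<dots> = (cmod (f \<alpha>))\<^sup>2 + (cmod (g \<alpha>))\<^sup>2 - 2 * (cmod (f \<alpha>) * cmod (g \<alpha>))"
    by (simp add: power2_diff)
  finally show "cmod (f \<alpha>) * cmod (g \<alpha>) \<le> (cmod (f \<alpha>))\<^sup>2 + (cmod (g \<alpha>))\<^sup>2"
    using mult_nonneg_nonneg[OF norm_ge_zero[of "f \<alpha>"] norm_ge_zero[of "g \<alpha>"]] by linarith
qed auto

lemma fip_summable:
  assumes "f \<in> fock_space" "g \<in> fock_space"
  shows "(\<lambda>\<alpha>. f \<alpha> * cnj (g \<alpha>)) summable_on UNIV"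
  by (rule abs_summable_summable) (use fock_abs_summable[OF assms] in \<open>simp add: norm_mult\<close>)

lemma fock_0: "0 \<in> fock_space"
  by (simp add: mem_fock_iff)

lemma fock_scale: "f \<in> fock_space \<Longrightarrow> series_scale c f \<in> fock_space"
  by (auto simp: mem_fock_iff norm_mult power_mult_distrib
      intro: summable_on_cmult_right)

lemma fock_add:
  assumes "f \<in> fock_space" "g \<in> fock_space"
  shows "f + g \<in> fock_space"
  unfolding mem_fock_iff
proof (rule summable_on_comparison_test)
  show "(\<lambda>\<alpha>. 2 * (cmod (f \<alpha>))\<^sup>2 + 2 * (cmod (g \<alpha>))\<^sup>2) summable_on UNIV"
    using assms by (auto simp: mem_fock_iff intro!: summable_on_add summable_on_cmult_right)
  fix \<alpha>
  have "(cmod ((f + g) \<alpha>))\<^sup>2 \<le> (cmod (f \<alpha>) + cmod (g \<alpha>))\<^sup>2"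
    by (intro power_mono) (auto simp: norm_triangle_ineq)
  also have "\<dots> \<le> 2 * (cmod (f \<alpha>))\<^sup>2 + 2 * (cmod (g \<alpha>))\<^sup>2"
    using sum_squares_bound[of "cmod (f \<alpha>)" "cmod (g \<alpha>)"] by (simp add: power2_sum)
  finally show "(cmod ((f + g) \<alpha>))\<^sup>2 \<le> 2 * (cmod (f \<alpha>))\<^sup>2 + 2 * (cmod (g \<alpha>))\<^sup>2" .
qed auto

lemma subspace_fock: "ser.subspace (fock_space :: 'd nc_series set)"
  by (auto simp: ser.subspace_def fock_0 fock_add fock_scale)

lemma fock_diff: "f \<in> fock_space \<Longrightarrow> g \<in> fock_space \<Longrightarrow> f - g \<in> fock_space"
  by (rule ser.subspace_diff[OF subspace_fock])

lemma fip_add_left: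
  assumes "f \<in> fock_space" "g \<in> fock_space" "h \<in> fock_space"
  shows "fip (f + g) h = fip f h + fip g h"
  unfolding fip_def
  by (subst infsum_add[symmetric]) (auto simp: algebra_simps intro!: fip_summable assms)

lemma fip_scale_left: "fip (series_scale c f) h = c * fip f h"
  by (simp add: fip_def mult.assoc infsum_cmult_right')

lemma fip_cnj: "cnj (fip f g) = fip g f"
  unfolding fip_def by (subst infsum_cnj[symmetric]) (simp add: mult.commute)

lemma fip_diff_left:
  assumes "f \<in> fock_space" "g \<in> fock_space" "h \<in> fock_space"
  shows "fip (f - g) h = fip f h - fip g h"
proof -
  have "fip ((f - g) + g) h = fip (f - g) h + fip g h"
    by (intro fip_add_left fock_diff assms)
  then show ?thesis by simp
qed

lemma fip_add_right:
  assumes "f \<in> fock_space" "g \<in> fock_space" "h \<in> fock_space"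
  shows "fip h (f + g) = fip h f + fip h g"
  using fip_add_left[OF assms] by (metis fip_cnj complex_cnj_add)

lemma fip_diff_right:
  assumes "f \<in> fock_space" "g \<in> fock_space" "h \<in> fock_space"
  shows "fip h (f - g) = fip h f - fip h g"
  using fip_diff_left[OF assms] by (metis fip_cnj complex_cnj_diff)

lemma fip_scale_right: "fip h (series_scale c f) = cnj c * fip h f"
  using fip_scale_left[of c f h] by (metis fip_cnj complex_cnj_mult)

lemma fock_norm_nonneg: "fock_norm f \<ge> 0"
  by (simp add: fock_norm_def infsum_nonneg)

lemma fock_norm_sq: "(fock_norm f)\<^sup>2 = (\<Sum>\<^sub>\<infinity>\<alpha>. (cmod (f \<alpha>))\<^sup>2)"
  by (simp add: fock_norm_def infsum_nonneg)

lemma fip_self: "fip f f = complex_of_real ((fock_norm f)\<^sup>2)"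
proof -
  have "fip f f = (\<Sum>\<^sub>\<infinity>\<alpha>. complex_of_real ((cmod (f \<alpha>))\<^sup>2))"
    by (simp add: fip_def complex_norm_square[symmetric])
  also have "\<dots> = complex_of_real (\<Sum>\<^sub>\<infinity>\<alpha>. (cmod (f \<alpha>))\<^sup>2)"
  proof (rule infsum_bounded_linear_strong[OF _ bounded_linear_of_real])
    show "(\<lambda>\<alpha>. complex_of_real ((cmod (f \<alpha>))\<^sup>2)) summable_on UNIV
        \<longleftrightarrow> (\<lambda>\<alpha>. (cmod (f \<alpha>))\<^sup>2) summable_on UNIV"
      using summable_on_Re[of "\<lambda>\<alpha>. complex_of_real ((cmod (f \<alpha>))\<^sup>2)" UNIV]
        summable_on_of_real[of "\<lambda>\<alpha>. (cmod (f \<alpha>))\<^sup>2" UNIV, where 'a = complex]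
      unfolding Re_complex_of_real by blast
  qed
  finally show ?thesis by (simp only: fock_norm_sq)
qed

lemma sum_le_fock_norm:
  assumes "f \<in> fock_space" "finite F"
  shows "(\<Sum>\<alpha>\<in>F. (cmod (f \<alpha>))\<^sup>2) \<le> (fock_norm f)\<^sup>2"
  unfolding fock_norm_sq
  by (rule finite_sum_le_infsum) (use assms in \<open>auto simp: mem_fock_iff\<close>)

lemma coeff_le_fock_norm: "f \<in> fock_space \<Longrightarrow> cmod (f \<alpha>) \<le> fock_norm f"
  by (rule power2_le_imp_le) (use sum_le_fock_norm[of f "{\<alpha>}"] fock_norm_nonneg[of f] in simp_all)

lemma fock_norm_le_finite:
  assumes "C \<ge> 0" "\<And>F. finite F \<Longrightarrow> (\<Sum>\<alpha>\<in>F. (cmod (f \<alpha>))\<^sup>2) \<le> C\<^sup>2"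
  shows "f \<in> fock_space" "fock_norm f \<le> C"
proof -
  show *: "f \<in> fock_space"
    unfolding mem_fock_iff
    by (rule nonneg_bounded_partial_sums_imp_summable_on[where C = "C\<^sup>2"])
       (use assms(2) in \<open>auto intro: eventually_finite_subsets_at_top_weakI\<close>)
  have "(fock_norm f)\<^sup>2 \<le> C\<^sup>2"
    unfolding fock_norm_sq
    by (rule infsum_le_finite_sums) (use assms * in \<open>auto simp: mem_fock_iff\<close>)
  then show "fock_norm f \<le> C" using assms(1) power2_le_imp_le by blast
qed

lemma fock_Cauchy_Schwarz:
  assumes "f \<in> fock_space" "g \<in> fock_space"
  shows "cmod (fip f g) \<le> fock_norm f * fock_norm g"
proof -
  have "cmod (fip f g) \<le> (\<Sum>\<^sub>\<infinity>\<alpha>. cmod (f \<alpha> * cnj (g \<alpha>)))"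
    unfolding fip_def by (rule norm_infsum_bound)
      (use fock_abs_summable[OF assms] in \<open>simp add: norm_mult\<close>)
  also have "\<dots> = (\<Sum>\<^sub>\<infinity>\<alpha>. cmod (f \<alpha>) * cmod (g \<alpha>))" by (simp add: norm_mult)
  also have "\<dots> \<le> fock_norm f * fock_norm g"
  proof (rule infsum_le_finite_sums[OF fock_abs_summable[OF assms]])
    fix F :: "'a list set" assume F: "finite F" "F \<subseteq> UNIV"
    have *: "L2_set (\<lambda>\<alpha>. cmod (h \<alpha>)) F \<le> fock_norm h" if "h \<in> fock_space" for h
      unfolding L2_set_def using sum_le_fock_norm[OF that F(1)] fock_norm_nonneg[of h]
      by (simp add: real_le_lsqrt)
    have "(\<Sum>\<alpha>\<in>F. cmod (f \<alpha>) * cmod (g \<alpha>)) \<le> L2_set (\<lambda>\<alpha>. cmod (f \<alpha>)) F * L2_set (\<lambda>\<alpha>. cmod (g \<alpha>)) F"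
      using L2_set_mult_ineq[of "\<lambda>\<alpha>. cmod (f \<alpha>)" "\<lambda>\<alpha>. cmod (g \<alpha>)" F] by simp
    also have "\<dots> \<le> fock_norm f * fock_norm g"
      by (intro mult_mono * assms) (auto simp: L2_set_nonneg fock_norm_nonneg)
    finally show "(\<Sum>\<alpha>\<in>F. cmod (f \<alpha>) * cmod (g \<alpha>)) \<le> fock_norm f * fock_norm g" .
  qed
  finally show ?thesis .
qed

lemma fock_norm_sq_add:
  assumes "f \<in> fock_space" "g \<in> fock_space"
  shows "(fock_norm (f + g))\<^sup>2 = (fock_norm f)\<^sup>2 + 2 * Re (fip f g) + (fock_norm g)\<^sup>2"
proof -
  have "fip (f + g) (f + g) = fip f f + fip f g + cnj (fip f g) + fip g g"
    by (simp add: fip_add_left fip_add_right assms fock_add fip_cnj)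
  then have "Re (fip (f + g) (f + g)) = Re (fip f f) + 2 * Re (fip f g) + Re (fip g g)" by simp
  then show ?thesis by (simp add: fip_self)
qed

lemma fock_norm_triangle:
  assumes "f \<in> fock_space" "g \<in> fock_space"
  shows "fock_norm (f + g) \<le> fock_norm f + fock_norm g"
proof -
  have "Re (fip f g) \<le> fock_norm f * fock_norm g"
    using complex_Re_le_cmod fock_Cauchy_Schwarz[OF assms] order_trans by blast
  then have "(fock_norm (f + g))\<^sup>2 \<le> (fock_norm f + fock_norm g)\<^sup>2"
    unfolding fock_norm_sq_add[OF assms] by (simp add: power2_sum)
  then show ?thesis by (rule power2_le_imp_le) (simp add: fock_norm_nonneg)
qed

lemma fock_norm_scale: "fock_norm (series_scale c f) = cmod c * fock_norm f"
proof -
  have "(fock_norm (series_scale c f))\<^sup>2 = (cmod c * fock_norm f)\<^sup>2"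
    by (simp add: fock_norm_sq power_mult_distrib norm_mult infsum_cmult_right')
  then show ?thesis by (simp add: fock_norm_nonneg)
qed

lemma fock_norm_minus_commute: "fock_norm (f - g) = fock_norm (g - f)"
  by (simp add: fock_norm_def norm_minus_commute)

lemma fock_norm_zero_iff:
  assumes "f \<in> fock_space"
  shows "fock_norm f = 0 \<longleftrightarrow> f = 0"
proof
  assume "fock_norm f = 0"
  then have "f \<alpha> = 0" for \<alpha> using coeff_le_fock_norm[OF assms, of \<alpha>] by simp
  then show "f = 0" by auto
qed (simp add: fock_norm_def)

lemma parallelogram:
  assumes "f \<in> fock_space" "g \<in> fock_space"
  shows "(fock_norm (f - g))\<^sup>2 + (fock_norm (f + g))\<^sup>2 = 2 * (fock_norm f)\<^sup>2 + 2 * (fock_norm g)\<^sup>2"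
proof -
  have m: "f - g = f + series_scale (-1) g" by (rule ext) (simp)
  have "(fock_norm (f - g))\<^sup>2 = (fock_norm f)\<^sup>2 - 2 * Re (fip f g) + (fock_norm g)\<^sup>2"
    unfolding m by (subst fock_norm_sq_add)
      (use assms fock_scale[of g "-1"] fip_scale_right[of f "-1" g] fock_norm_scale[of "-1" g] in auto)
  then show ?thesis using fock_norm_sq_add[OF assms] by simp
qed

lemma fock_norm_sq_diff:
  assumes "f \<in> fock_space" "g \<in> fock_space"
  shows "(fock_norm (f - g))\<^sup>2 = (fock_norm f)\<^sup>2 - 2 * Re (fip f g) + (fock_norm g)\<^sup>2"
  using parallelogram[OF assms] fock_norm_sq_add[OF assms] by simp

text \<open>The candidate limit is the limit of the coefficients. The distance to it is controlled on finite
  sets of words, where the limit may be taken termwise.\<close>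

lemma fock_complete:
  fixes X :: "nat \<Rightarrow> 'd nc_series"
  assumes X: "\<And>i. X i \<in> fock_space"
    and Cauchy: "\<And>\<epsilon>. \<epsilon> > 0 \<Longrightarrow> \<exists>N. \<forall>i\<ge>N. \<forall>j\<ge>N. fock_norm (X i - X j) < \<epsilon>"
  shows "\<exists>g\<in>fock_space. \<forall>\<epsilon>>0. \<exists>N. \<forall>i\<ge>N. fock_norm (X i - g) \<le> \<epsilon>"
proof -
  have "Cauchy (\<lambda>i. X i \<alpha>)" for \<alpha>
  proof (rule metric_CauchyI)
    fix \<epsilon> :: real assume "\<epsilon> > 0"
    then obtain N where N: "\<forall>i\<ge>N. \<forall>j\<ge>N. fock_norm (X i - X j) < \<epsilon>" using Cauchy by blast
    have "dist (X i \<alpha>) (X j \<alpha>) < \<epsilon>" if "i \<ge> N" "j \<ge> N" for i j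
    proof -
      have "cmod (X i \<alpha> - X j \<alpha>) \<le> fock_norm (X i - X j)"
        using coeff_le_fock_norm[OF fock_diff[OF X X], of i j \<alpha>] by simp
      then show ?thesis using N that by (simp add: dist_norm) (meson le_less_trans)
    qed
    then show "\<exists>N. \<forall>i\<ge>N. \<forall>j\<ge>N. dist (X i \<alpha>) (X j \<alpha>) < \<epsilon>" by blast
  qed
  then have "\<exists>l. (\<lambda>i. X i \<alpha>) \<longlonglongrightarrow> l" for \<alpha>
    by (simp add: Cauchy_convergent_iff convergent_def)
  then obtain g where g: "\<And>\<alpha>. (\<lambda>i. X i \<alpha>) \<longlonglongrightarrow> g \<alpha>" by metis
  have close: "\<exists>N. \<forall>i\<ge>N. X i - g \<in> fock_space \<and> fock_norm (X i - g) \<le> \<epsilon>" if "\<epsilon> > 0" for \<epsilon>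
  proof -
    obtain N where N: "\<forall>i\<ge>N. \<forall>j\<ge>N. fock_norm (X i - X j) < \<epsilon>" using Cauchy \<open>\<epsilon> > 0\<close> by blast
    have "(\<Sum>\<alpha>\<in>F. (cmod ((X i - g) \<alpha>))\<^sup>2) \<le> \<epsilon>\<^sup>2" if "i \<ge> N" "finite F" for i F
    proof (rule tendsto_upperbound)
      show "(\<lambda>j. \<Sum>\<alpha>\<in>F. (cmod ((X i - X j) \<alpha>))\<^sup>2) \<longlonglongrightarrow> (\<Sum>\<alpha>\<in>F. (cmod ((X i - g) \<alpha>))\<^sup>2)"
        by (auto intro!: tendsto_intros g)
      show "\<forall>\<^sub>F j in sequentially. (\<Sum>\<alpha>\<in>F. (cmod ((X i - X j) \<alpha>))\<^sup>2) \<le> \<epsilon>\<^sup>2"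
      proof (rule eventually_sequentiallyI)
        fix j assume "j \<ge> N"
        then have "(fock_norm (X i - X j))\<^sup>2 \<le> \<epsilon>\<^sup>2"
          using N that by (intro power_mono) (auto simp: fock_norm_nonneg less_imp_le)
        then show "(\<Sum>\<alpha>\<in>F. (cmod ((X i - X j) \<alpha>))\<^sup>2) \<le> \<epsilon>\<^sup>2"
          using sum_le_fock_norm[OF fock_diff[OF X X] that(2), of i j] by linarith
      qed
    qed auto
    then have "X i - g \<in> fock_space \<and> fock_norm (X i - g) \<le> \<epsilon>" if "i \<ge> N" for i
      using fock_norm_le_finite[of \<epsilon> "X i - g"] \<open>\<epsilon> > 0\<close> that by auto
    then show ?thesis by blast
  qed
  obtain N where "X N - g \<in> fock_space" using close[of 1] by auto
  then have "X N - (X N - g) \<in> fock_space" using X fock_diff by blast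
  then have "g \<in> fock_space" by simp
  then show ?thesis using close by blast
qed

section \<open>Closures of subspaces\<close>

lemma fock_closureI_subset: "S \<subseteq> fock_space \<Longrightarrow> S \<subseteq> fock_closure S"
proof
  fix s assume s: "S \<subseteq> fock_space" "s \<in> S"
  have "fock_norm (s - s) = 0" by (simp add: fock_norm_def)
  then have "\<exists>h\<in>S. fock_norm (s - h) < \<epsilon>" if "\<epsilon> > 0" for \<epsilon>
    using that s(2) by (intro bexI[of _ s]) auto
  with s show "s \<in> fock_closure S" unfolding fock_closure_def by blast
qed

lemma fock_closure_subset: "fock_closure S \<subseteq> fock_space"
  by (auto simp: fock_closure_def)

text \<open>Through this lemma, invariance of the algebraic span of the shifts of a series under the right shifts and
  under the deflations below passes to its closure.\<close>

lemma fock_closure_map: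
  assumes S: "S \<subseteq> fock_space" and TS: "\<And>s. s \<in> S \<Longrightarrow> T s \<in> S"
    and T: "\<And>h. h \<in> fock_space \<Longrightarrow> T h \<in> fock_space"
    and lin: "\<And>h h'. T (h - h') = T h - T h'"
    and bd: "\<And>h. h \<in> fock_space \<Longrightarrow> fock_norm (T h) \<le> C * fock_norm h"
    and m: "m \<in> fock_closure S"
  shows "T m \<in> fock_closure S"
proof -
  have mf: "m \<in> fock_space" using m by (simp add: fock_closure_def)
  have "\<exists>h\<in>S. fock_norm (T m - h) < \<epsilon>" if "\<epsilon> > 0" for \<epsilon>
  proof -
    have "\<epsilon> / (\<bar>C\<bar> + 1) > 0" using that by simp
    then obtain h where h: "h \<in> S" "fock_norm (m - h) < \<epsilon> / (\<bar>C\<bar> + 1)"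
      using m by (auto simp: fock_closure_def)
    have "fock_norm (T m - T h) \<le> C * fock_norm (m - h)"
      using bd[OF fock_diff, of m h] mf h S lin by auto
    also have "\<dots> \<le> (\<bar>C\<bar> + 1) * fock_norm (m - h)"
      by (intro mult_right_mono) (auto simp: fock_norm_nonneg)
    also have "\<dots> < \<epsilon>" using h(2) by (simp add: pos_less_divide_eq mult.commute)
    finally show ?thesis using TS h(1) by blast
  qed
  then show ?thesis using T mf by (auto simp: fock_closure_def)
qed

lemma fock_closure_add:
  assumes S: "ser.subspace S" "S \<subseteq> fock_space" and "m \<in> fock_closure S" "m' \<in> fock_closure S"
  shows "m + m' \<in> fock_closure S"
proof -
  have mf: "m \<in> fock_space" "m' \<in> fock_space" using assms by (auto simp: fock_closure_def)
  have "\<exists>h\<in>S. fock_norm (m + m' - h) < \<epsilon>" if "\<epsilon> > 0" for \<epsilon>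
  proof -
    have "\<epsilon> / 2 > 0" using that by simp
    obtain h where h1: "h \<in> S" "fock_norm (m - h) < \<epsilon> / 2"
      using assms(3) \<open>\<epsilon> / 2 > 0\<close> unfolding fock_closure_def by blast
    obtain h' where h2: "h' \<in> S" "fock_norm (m' - h') < \<epsilon> / 2"
      using assms(4) \<open>\<epsilon> / 2 > 0\<close> unfolding fock_closure_def by blast
    note h = h1 h2
    have "fock_norm ((m - h) + (m' - h')) \<le> fock_norm (m - h) + fock_norm (m' - h')"
      by (rule fock_norm_triangle) (use mf h S in \<open>auto intro!: fock_diff\<close>)
    then have "fock_norm (m + m' - (h + h')) < \<epsilon>"
      using h(2,4) by (simp add: algebra_simps)
    then show ?thesis using h ser.subspace_add[OF S(1)] by blast
  qed
  then show ?thesis using mf fock_add by (auto simp: fock_closure_def)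
qed

lemma fock_closure_scale:
  assumes S: "ser.subspace S" "S \<subseteq> fock_space" and "m \<in> fock_closure S"
  shows "series_scale c m \<in> fock_closure S"
  by (rule fock_closure_map[where T = "series_scale c" and C = "cmod c"])
     (use assms in \<open>auto simp: fock_scale fock_norm_scale ser.scale_right_diff_distrib simp del: series_scale_apply intro: ser.subspace_scale\<close>)

lemma subspace_fock_closure:
  assumes S: "ser.subspace S" "S \<subseteq> fock_space"
  shows "ser.subspace (fock_closure S)"
  unfolding ser.subspace_def
  using fock_closureI_subset[OF S(2)] ser.subspace_0[OF S(1)] fock_closure_add[OF S]
    fock_closure_scale[OF S] by blast

lemma fock_closure_orthogonal:
  assumes S: "S \<subseteq> fock_space" and v: "v \<in> fock_space" and orth: "\<And>s. s \<in> S \<Longrightarrow> fip s v = 0"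
    and m: "m \<in> fock_closure S"
  shows "fip m v = 0"
proof -
  have mf: "m \<in> fock_space" using m by (simp add: fock_closure_def)
  have "cmod (fip m v) \<le> \<epsilon>" if "\<epsilon> > 0" for \<epsilon>
  proof -
    have "\<epsilon> / (fock_norm v + 1) > 0" using that fock_norm_nonneg[of v] by (simp add: add_nonneg_pos)
    then obtain h where h: "h \<in> S" "fock_norm (m - h) < \<epsilon> / (fock_norm v + 1)"
      using m by (auto simp: fock_closure_def)
    have hf: "h \<in> fock_space" using h S by blast
    have "fip m v = fip (m - h) v" using orth[OF h(1)] by (simp add: fip_diff_left mf hf v)
    also have "cmod \<dots> \<le> fock_norm (m - h) * fock_norm v"
      by (intro fock_Cauchy_Schwarz fock_diff mf hf v)
    also have "\<dots> \<le> fock_norm (m - h) * (fock_norm v + 1)"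
      by (intro mult_left_mono) (auto simp: fock_norm_nonneg)
    also have "\<dots> \<le> \<epsilon>"
      using h(2) fock_norm_nonneg[of v] by (simp add: pos_less_divide_eq add_nonneg_pos less_imp_le)
    finally show ?thesis .
  qed
  then have "cmod (fip m v) \<le> 0" by (rule field_le_epsilon) simp
  then show ?thesis by simp
qed

text \<open>A minimizing sequence for the distance from \<open>x\<close> is Cauchy by the parallelogram law; its limit is
  the projection.\<close>

lemma fock_projection:
  fixes S :: "'d nc_series set"
  assumes S: "ser.subspace S" "S \<subseteq> fock_space" and x: "x \<in> fock_space"
  shows "\<exists>g\<in>fock_closure S. \<forall>s\<in>S. fip s (x - g) = 0"
proof -
  define \<delta> where "\<delta> = Inf ((\<lambda>s. (fock_norm (x - s))\<^sup>2) ` S)"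
  have Sne: "S \<noteq> {}" using ser.subspace_0[OF S(1)] by blast
  have bdd: "bdd_below ((\<lambda>s. (fock_norm (x - s))\<^sup>2) ` S)" by (rule bdd_belowI2[where m = 0]) simp
  have \<delta>_le: "\<delta> \<le> (fock_norm (x - s))\<^sup>2" if "s \<in> S" for s
    unfolding \<delta>_def using bdd that by (intro cInf_lower) auto
  have "\<exists>s\<in>S. (fock_norm (x - s))\<^sup>2 < \<delta> + \<epsilon>" if "\<epsilon> > 0" for \<epsilon>
    using cInf_lessD[of "(\<lambda>s. (fock_norm (x - s))\<^sup>2) ` S" "\<delta> + \<epsilon>"] Sne that
    by (auto simp: \<delta>_def)
  then have "\<exists>s\<in>S. (fock_norm (x - s))\<^sup>2 < \<delta> + inverse (real (Suc i))" for i by simp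
  then obtain X where X: "\<And>i. X i \<in> S" "\<And>i. (fock_norm (x - X i))\<^sup>2 < \<delta> + inverse (real (Suc i))"
    by metis
  have Xf: "X i \<in> fock_space" for i using X S by blast
  have dist: "(fock_norm (X i - X j))\<^sup>2 \<le> 2 * inverse (real (Suc i)) + 2 * inverse (real (Suc j))" for i j
  proof -
    let ?h = "series_scale (1/2) (X i + X j)"
    have hS: "?h \<in> S" using X S(1) by (simp add: ser.subspace_add ser.subspace_scale)
    have e: "(x - X j) - (x - X i) = X i - X j"
      "(x - X j) + (x - X i) = series_scale 2 (x - ?h)"
      by (auto simp: algebra_simps fun_eq_iff)
    have "(fock_norm (X i - X j))\<^sup>2 + (fock_norm (series_scale 2 (x - ?h)))\<^sup>2
        = 2 * (fock_norm (x - X j))\<^sup>2 + 2 * (fock_norm (x - X i))\<^sup>2"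
      using parallelogram[of "x - X j" "x - X i"] x Xf by (simp only: e fock_diff)
    moreover have "(fock_norm (series_scale 2 (x - ?h)))\<^sup>2 \<ge> 4 * \<delta>"
      using \<delta>_le[OF hS] by (simp add: fock_norm_scale power_mult_distrib)
    ultimately show ?thesis using X(2)[of i] X(2)[of j] by linarith
  qed
  have "\<exists>g\<in>fock_space. \<forall>\<epsilon>>0. \<exists>N. \<forall>i\<ge>N. fock_norm (X i - g) \<le> \<epsilon>"
  proof (rule fock_complete[OF Xf])
    fix \<epsilon> :: real assume "\<epsilon> > 0"
    then have "\<epsilon>\<^sup>2 / 4 > 0" by simp
    then obtain N where N: "inverse (real (Suc N)) < \<epsilon>\<^sup>2 / 4"
      using reals_Archimedean by blast
    have "fock_norm (X i - X j) < \<epsilon>" if "i \<ge> N" "j \<ge> N" for i j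
    proof -
      have "inverse (real (Suc i)) \<le> inverse (real (Suc N))" "inverse (real (Suc j)) \<le> inverse (real (Suc N))"
        using that by (simp_all add: le_imp_inverse_le)
      then have "(fock_norm (X i - X j))\<^sup>2 < \<epsilon>\<^sup>2" using dist[of i j] N by linarith
      then show ?thesis by (rule power2_less_imp_less) (use \<open>\<epsilon> > 0\<close> in simp)
    qed
    then show "\<exists>N. \<forall>i\<ge>N. \<forall>j\<ge>N. fock_norm (X i - X j) < \<epsilon>" by blast
  qed
  then obtain g where g: "g \<in> fock_space" "\<And>\<epsilon>. \<epsilon> > 0 \<Longrightarrow> \<exists>N. \<forall>i\<ge>N. fock_norm (X i - g) \<le> \<epsilon>" by blast
  have gcl: "g \<in> fock_closure S"
  proof -
    have "\<exists>h\<in>S. fock_norm (g - h) < \<epsilon>" if "\<epsilon> > 0" for \<epsilon>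
    proof -
      obtain N where N: "\<forall>i\<ge>N. fock_norm (X i - g) \<le> \<epsilon> / 2"
        using g(2)[OF half_gt_zero[OF \<open>\<epsilon> > 0\<close>]] by blast
      then have "fock_norm (X N - g) \<le> \<epsilon> / 2" by simp
      then have "fock_norm (g - X N) < \<epsilon>" using that fock_norm_minus_commute[of g "X N"] by linarith
      then show ?thesis using X by blast
    qed
    then show ?thesis using g by (auto simp: fock_closure_def)
  qed
  have gmin: "(fock_norm (x - g))\<^sup>2 \<le> \<delta>"
  proof -
    have lim: "(\<lambda>i. fock_norm (x - X i)) \<longlonglongrightarrow> fock_norm (x - g)"
    proof (rule metric_LIMSEQ_I)
      fix \<epsilon> :: real assume "\<epsilon> > 0"
      then obtain N where N: "\<forall>i\<ge>N. fock_norm (X i - g) \<le> \<epsilon> / 2"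
        using g(2)[OF half_gt_zero[OF \<open>\<epsilon> > 0\<close>]] by blast
      have "dist (fock_norm (x - X i)) (fock_norm (x - g)) \<le> fock_norm (X i - g)" for i
      proof -
        have "fock_norm ((x - g) + (g - X i)) \<le> fock_norm (x - g) + fock_norm (g - X i)"
          "fock_norm ((x - X i) + (X i - g)) \<le> fock_norm (x - X i) + fock_norm (X i - g)"
          by (intro fock_norm_triangle fock_diff x g Xf)+
        then show ?thesis by (simp add: dist_real_def fock_norm_minus_commute[of g] abs_le_iff)
      qed
      then have "\<forall>i\<ge>N. dist (fock_norm (x - X i)) (fock_norm (x - g)) \<le> \<epsilon> / 2"
        using N order_trans by blast
      then have "\<forall>i\<ge>N. dist (fock_norm (x - X i)) (fock_norm (x - g)) < \<epsilon>"
        using \<open>\<epsilon> > 0\<close> by fastforce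
      then show "\<exists>N. \<forall>i\<ge>N. dist (fock_norm (x - X i)) (fock_norm (x - g)) < \<epsilon>" by blast
    qed
    have "(\<lambda>i. \<delta> + inverse (real (Suc i))) \<longlonglongrightarrow> \<delta> + 0"
      by (intro tendsto_intros LIMSEQ_inverse_real_of_nat)
    from LIMSEQ_le[OF tendsto_power[OF lim, of 2] this] show ?thesis
      using X(2) by (auto intro: less_imp_le)
  qed
  have "fip s (x - g) = 0" if s: "s \<in> S" for s
  proof (rule ccontr)
    assume ne: "fip s (x - g) \<noteq> 0"
    let ?y = "x - g"
    have ne': "fip ?y s \<noteq> 0" using ne fip_cnj[of s ?y] by (metis complex_cnj_zero_iff)
    have sf: "s \<in> fock_space" "?y \<in> fock_space" using s S x g by (auto intro: fock_diff)
    have "s \<noteq> 0" using ne by (auto simp: fip_def)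
    then have n0: "fock_norm s > 0"
      using sf fock_norm_zero_iff fock_norm_nonneg[of s] by fastforce
    define c where "c = fip ?y s / complex_of_real ((fock_norm s)\<^sup>2)"
    \<comment> \<open>moving from \<open>g\<close> in the direction \<open>s\<close> by the Fourier coefficient \<open>c\<close> gets strictly closer to \<open>x\<close>\<close>
    let ?z = "?y - series_scale c s"
    have cc: "cnj c * fip ?y s = complex_of_real ((cmod (fip ?y s))\<^sup>2 / (fock_norm s)\<^sup>2)"
      unfolding c_def of_real_divide complex_norm_square by simp
    have c2: "(cmod c * fock_norm s)\<^sup>2 = (cmod (fip ?y s))\<^sup>2 / (fock_norm s)\<^sup>2"
    proof -
      have "cmod c * fock_norm s = cmod (fip ?y s) / fock_norm s"
        using n0 by (simp add: c_def norm_divide norm_mult power2_eq_square)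
      then show ?thesis by (simp add: power_divide)
    qed
    have "(fock_norm ?z)\<^sup>2 = (fock_norm ?y)\<^sup>2 - 2 * Re (cnj c * fip ?y s) + (cmod c * fock_norm s)\<^sup>2"
      by (subst fock_norm_sq_diff) (use sf in \<open>auto simp: fock_scale fip_scale_right fock_norm_scale\<close>)
    also have "\<dots> = (fock_norm ?y)\<^sup>2 - (cmod (fip ?y s))\<^sup>2 / (fock_norm s)\<^sup>2"
      unfolding cc c2 by simp
    also have "\<dots> < (fock_norm ?y)\<^sup>2"
      using ne' n0 by simp
    also have "\<dots> \<le> \<delta>" by (rule gmin)
    finally have lt: "(fock_norm ?z)\<^sup>2 < \<delta>" .
    have "\<delta> \<le> (fock_norm ?z)\<^sup>2"
    proof (rule field_le_epsilon)
      fix e :: real assume "e > 0"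
      have gz: "g + series_scale c s \<in> fock_closure S"
        using gcl s fock_closureI_subset[OF S(2)] fock_closure_add[OF S] fock_closure_scale[OF S] by blast
      have z: "?z = x - (g + series_scale c s)" by (rule ext) (simp)
      have zf: "?z \<in> fock_space" using sf by (auto intro: fock_diff fock_scale)
      define n where "n = fock_norm ?z"
      define \<eta> where "\<eta> = min 1 (e / (2 * n + 1))"
      have n: "n \<ge> 0" by (simp add: n_def fock_norm_nonneg)
      have \<eta>: "\<eta> > 0" "\<eta> \<le> 1" "\<eta> * (2 * n + 1) \<le> e"
        using \<open>e > 0\<close> n by (auto simp: \<eta>_def min_def pos_le_divide_eq mult.commute)
      obtain h where h: "h \<in> S" "fock_norm ((g + series_scale c s) - h) < \<eta>"
        using gz \<eta>(1) by (auto simp: fock_closure_def)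
      have "fock_norm (x - h) \<le> n + \<eta>"
      proof -
        have e: "x - h = ?z + ((g + series_scale c s) - h)" by (rule ext) simp
        have "fock_norm (?z + ((g + series_scale c s) - h)) \<le> fock_norm ?z + fock_norm ((g + series_scale c s) - h)"
          using gz fock_closure_subset h S by (intro fock_norm_triangle zf fock_diff) blast+
        then show ?thesis using h(2) unfolding n_def e by linarith
      qed
      then have "(fock_norm (x - h))\<^sup>2 \<le> (n + \<eta>)\<^sup>2"
        by (intro power_mono) (auto simp: fock_norm_nonneg)
      also have "\<dots> = n\<^sup>2 + \<eta> * (2 * n + \<eta>)" by (simp add: power2_eq_square algebra_simps)
      also have "\<dots> \<le> n\<^sup>2 + \<eta> * (2 * n + 1)" using \<eta> n by (intro add_left_mono mult_left_mono) auto
      also have "\<dots> \<le> n\<^sup>2 + e" using \<eta> by simp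
      finally show "\<delta> \<le> (fock_norm ?z)\<^sup>2 + e" using \<delta>_le[OF h(1)] by (simp add: n_def)
    qed
    with lt show False by simp
  qed
  then show ?thesis using gcl by blast
qed

section \<open>Shifts and their adjoints\<close>

text \<open>The adjoint of right multiplication by the word \<open>\<alpha>\<close>, see \<open>fip_mult_word\<close>.\<close>

definition back_shift :: "'d list \<Rightarrow> 'd nc_series \<Rightarrow> 'd nc_series" where
  "back_shift \<alpha> f = (\<lambda>\<beta>. f (\<beta> @ \<alpha>))"

text \<open>Folding from the left appends \<open>\<alpha>\<close> in reading order, so this is \<open>f\<close> times the word \<open>\<alpha>\<close>, whereas
  \<open>right_shift_word\<close> appends the reversed word.\<close>

abbreviation mult_word :: "'d nc_series \<Rightarrow> 'd list \<Rightarrow> 'd nc_series" where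
  "mult_word f \<alpha> \<equiv> fold right_shift \<alpha> f"

lemma back_shift_Nil [simp]: "back_shift [] f = f"
  by (simp add: back_shift_def)

lemma back_shift_append: "back_shift (\<alpha> @ \<beta>) f = back_shift \<alpha> (back_shift \<beta> f)"
  by (simp add: back_shift_def)

lemma back_shift_add: "back_shift \<alpha> (f + g) = back_shift \<alpha> f + back_shift \<alpha> g"
  and back_shift_scale: "back_shift \<alpha> (series_scale c f) = series_scale c (back_shift \<alpha> f)"
  and back_shift_0: "back_shift \<alpha> 0 = 0"
  by (auto simp: back_shift_def fun_eq_iff)

lemma right_shift_add: "right_shift k (f + g) = right_shift k f + right_shift k g"
  and right_shift_diff: "right_shift k (f - g) = right_shift k f - right_shift k g"
  and right_shift_scale: "right_shift k (series_scale c f) = series_scale c (right_shift k f)"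
  by (auto simp: right_shift_def fun_eq_iff)

lemma back_right_shift: "back_shift [k] (right_shift l f) = (if k = l then f else 0)"
  by (auto simp: back_shift_def right_shift_def)

lemma right_shift_Nil [simp]: "right_shift k f [] = 0"
  by (simp add: right_shift_def)

lemma fock_back_shift:
  assumes "f \<in> fock_space"
  shows "back_shift \<alpha> f \<in> fock_space" "fock_norm (back_shift \<alpha> f) \<le> fock_norm f"
proof -
  have "(\<Sum>\<beta>\<in>F. (cmod (back_shift \<alpha> f \<beta>))\<^sup>2) \<le> (fock_norm f)\<^sup>2" if "finite F" for F
  proof -
    have "(\<Sum>\<beta>\<in>F. (cmod (back_shift \<alpha> f \<beta>))\<^sup>2) = (\<Sum>\<beta>\<in>(\<lambda>\<beta>. \<beta> @ \<alpha>) ` F. (cmod (f \<beta>))\<^sup>2)"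
      by (subst sum.reindex) (auto simp: back_shift_def inj_on_def)
    also have "\<dots> \<le> (fock_norm f)\<^sup>2" by (rule sum_le_fock_norm) (use assms that in auto)
    finally show ?thesis .
  qed
  then show "back_shift \<alpha> f \<in> fock_space" "fock_norm (back_shift \<alpha> f) \<le> fock_norm f"
    using fock_norm_le_finite[OF fock_norm_nonneg] by blast+
qed

lemma fock_right_shift:
  assumes "f \<in> fock_space"
  shows "right_shift k f \<in> fock_space" "fock_norm (right_shift k f) \<le> fock_norm f"
proof -
  have "(\<Sum>\<beta>\<in>F. (cmod (right_shift k f \<beta>))\<^sup>2) \<le> (fock_norm f)\<^sup>2" if "finite F" for F
  proof -
    define G where "G = {\<beta> \<in> F. \<beta> \<noteq> [] \<and> last \<beta> = k}"
    have "(\<Sum>\<beta>\<in>F. (cmod (right_shift k f \<beta>))\<^sup>2) = (\<Sum>\<beta>\<in>G. (cmod (f (butlast \<beta>)))\<^sup>2)"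
      using that by (intro sum.mono_neutral_cong_right) (auto simp: G_def right_shift_def)
    also have "\<dots> = (\<Sum>\<beta>\<in>butlast ` G. (cmod (f \<beta>))\<^sup>2)"
      by (subst sum.reindex) (auto simp: G_def inj_on_def, metis append_butlast_last_id)
    also have "\<dots> \<le> (fock_norm f)\<^sup>2"
      by (rule sum_le_fock_norm) (use assms that in \<open>auto simp: G_def\<close>)
    finally show ?thesis .
  qed
  then show "right_shift k f \<in> fock_space" "fock_norm (right_shift k f) \<le> fock_norm f"
    using fock_norm_le_finite[OF fock_norm_nonneg] by blast+
qed

lemma fock_mult_word: "f \<in> fock_space \<Longrightarrow> mult_word f \<alpha> \<in> fock_space"
  by (induction \<alpha> arbitrary: f) (auto simp: fock_right_shift)

lemma fip_right_shift: "fip h (right_shift k g) = fip (back_shift [k] h) g"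
proof -
  have "fip h (right_shift k g) = (\<Sum>\<^sub>\<infinity>\<alpha>\<in>range (\<lambda>\<beta>. \<beta> @ [k]). h \<alpha> * cnj (right_shift k g \<alpha>))"
    unfolding fip_def
  proof (rule infsum_cong_neutral)
    fix \<alpha> assume "\<alpha> \<in> UNIV - range (\<lambda>\<beta>. \<beta> @ [k])"
    then have "\<alpha> = [] \<or> last \<alpha> \<noteq> k" by (metis DiffE append_butlast_last_id rangeI)
    then show "h \<alpha> * cnj (right_shift k g \<alpha>) = 0" by (auto simp: right_shift_def)
  qed auto
  also have "\<dots> = (\<Sum>\<^sub>\<infinity>\<beta>. h (\<beta> @ [k]) * cnj (g \<beta>))"
    by (subst infsum_reindex) (auto simp: inj_on_def o_def right_shift_def)
  finally show ?thesis by (simp add: fip_def back_shift_def)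
qed

lemma fip_mult_word: "fip h (mult_word g \<alpha>) = fip (back_shift \<alpha> h) g"
  by (induction \<alpha> arbitrary: h rule: rev_induct) (simp_all add: fip_right_shift back_shift_append)

definition unit_series :: "'d list \<Rightarrow> 'd nc_series" where
  "unit_series \<alpha> = (\<lambda>\<beta>. if \<beta> = \<alpha> then 1 else 0)"

lemma fip_unit: "fip h (unit_series \<alpha>) = h \<alpha>"
proof -
  have "fip h (unit_series \<alpha>) = (\<Sum>\<^sub>\<infinity>\<beta>\<in>{\<alpha>}. h \<beta>)"
    unfolding fip_def by (rule infsum_cong_neutral) (auto simp: unit_series_def)
  then show ?thesis by simp
qed

lemma fock_finite_support: "finite {\<beta>. f \<beta> \<noteq> 0} \<Longrightarrow> f \<in> fock_space"
  unfolding mem_fock_iff by (rule finite_nonzero_values_imp_summable_on) simp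

lemma fock_unit: "unit_series \<alpha> \<in> fock_space"
  by (rule fock_finite_support) (simp add: unit_series_def)

lemma mult_word_unit: "mult_word (unit_series []) \<alpha> = unit_series \<alpha>"
proof (induction \<alpha> rule: rev_induct)
  case (snoc k \<alpha>)
  have "right_shift k (unit_series \<alpha>) = unit_series (\<alpha> @ [k])"
    by (auto simp: right_shift_def unit_series_def fun_eq_iff)
  with snoc show ?case by simp
qed simp

lemma back_shift_unit_Nil: "\<alpha> \<noteq> [] \<Longrightarrow> back_shift \<alpha> (unit_series []) = 0"
  by (auto simp: back_shift_def unit_series_def)

lemma span_map:
  assumes add: "\<And>h h'. T (h + h') = T h + T h'"
    and scale: "\<And>c h. T (series_scale c h) = series_scale c (T h)"
    and gen: "\<And>b. b \<in> B \<Longrightarrow> T b \<in> S" and S: "ser.subspace S" and s: "s \<in> series_span B"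
  shows "T s \<in> S"
proof -
  have T0: "T 0 = 0" using scale[of 0 0] by simp
  have sub: "ser.subspace {h. T h \<in> S}"
    using S by (auto simp: ser.subspace_def add scale T0)
  have "series_span B \<subseteq> {h. T h \<in> S}"
    by (rule ser.span_minimal[OF _ sub]) (use gen in auto)
  then show ?thesis using s by blast
qed

section \<open>The right invariant subspace generated by a series\<close>

definition right_span :: "'d nc_series \<Rightarrow> 'd nc_series set" where
  "right_span f = series_span (range (mult_word f))"

lemma right_span_eq: "series_span {right_shift_word \<alpha> f | \<alpha>. True} = right_span f"
proof -
  have "{right_shift_word \<alpha> f | \<alpha>. True} = range (\<lambda>\<alpha>. right_shift_word (rev \<alpha>) f)"
    by (auto intro: rev_rev_ident[symmetric]) (metis rangeI rev_rev_ident)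
  then show ?thesis by (simp add: right_span_def right_shift_word_def foldr_conv_fold)
qed

abbreviation right_closure :: "'d nc_series \<Rightarrow> 'd nc_series set" where
  "right_closure f \<equiv> fock_closure (right_span f)"

lemma outer_iff: "outer f \<longleftrightarrow> f \<in> fock_space \<and> right_closure f = fock_space"
  unfolding outer_def right_span_eq ..

lemma subspace_right_span: "ser.subspace (right_span f)"
  by (simp add: right_span_def)

lemma right_span_generator: "mult_word f \<alpha> \<in> right_span f"
  by (auto simp: right_span_def intro: ser.span_base)

lemma right_span_subset_fock: "f \<in> fock_space \<Longrightarrow> right_span f \<subseteq> fock_space"
  unfolding right_span_def
  by (rule ser.span_minimal[OF _ subspace_fock]) (auto simp: fock_mult_word)

lemma right_closure_right_shift:
  assumes f: "f \<in> fock_space" and m: "m \<in> right_closure f"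
  shows "right_shift k m \<in> right_closure f"
proof (rule fock_closure_map[where T = "right_shift k" and C = 1])
  fix s assume s: "s \<in> right_span f"
  show "right_shift k s \<in> right_span f"
  proof (rule span_map[where T = "right_shift k", OF _ _ _ subspace_right_span s[unfolded right_span_def]])
    fix b assume "b \<in> range (mult_word f)"
    then obtain \<alpha> where "b = mult_word f \<alpha>" by blast
    then show "right_shift k b \<in> right_span f"
      using right_span_generator[of "\<alpha> @ [k]" f] by simp
  qed (auto simp: right_shift_add right_shift_scale)
qed (use assms right_span_subset_fock in \<open>auto simp: fock_right_shift right_shift_diff\<close>)

lemma right_closure_mult_word:
  assumes "f \<in> fock_space" "m \<in> right_closure f"
  shows "mult_word m \<alpha> \<in> right_closure f"
  by (induction \<alpha> rule: rev_induct) (use assms right_closure_right_shift in auto)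

lemma right_closure_generator: "f \<in> fock_space \<Longrightarrow> mult_word f \<alpha> \<in> right_closure f"
  using right_span_generator fock_closureI_subset right_span_subset_fock by blast

text \<open>Once \<open>1\<close> is in the closed right invariant subspace, all words are, and polynomials are dense.\<close>

lemma right_closure_eq_fock:
  fixes f :: "('d::finite) nc_series"
  assumes f: "f \<in> fock_space" and one: "unit_series [] \<in> right_closure f"
  shows "right_closure f = fock_space"
proof
  show "fock_space \<subseteq> right_closure f"
  proof
    fix h :: "'d nc_series" assume h: "h \<in> fock_space"
    have sub: "ser.subspace (right_closure f)"
      by (intro subspace_fock_closure subspace_right_span right_span_subset_fock f)
    have units: "unit_series \<alpha> \<in> right_closure f" for \<alpha>
      using right_closure_mult_word[OF f one, of \<alpha>] by (simp add: mult_word_unit)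
    have "\<exists>s\<in>right_span f. fock_norm (h - s) < \<epsilon>" if "\<epsilon> > 0" for \<epsilon>
    proof -
      have "(\<epsilon>/2)\<^sup>2 > 0" using that by simp
      have sm: "(\<lambda>\<alpha>. (cmod (h \<alpha>))\<^sup>2) summable_on UNIV" using h by (simp add: mem_fock_iff)
      have "(((\<lambda>\<alpha>. (cmod (h \<alpha>))\<^sup>2)) has_sum (fock_norm h)\<^sup>2) UNIV"
        using sm by (simp add: fock_norm_sq)
      from has_sum_finite_approximation[OF this \<open>(\<epsilon>/2)\<^sup>2 > 0\<close>]
      obtain F where F: "finite F" "dist (\<Sum>\<alpha>\<in>F. (cmod (h \<alpha>))\<^sup>2) ((fock_norm h)\<^sup>2) \<le> (\<epsilon>/2)\<^sup>2" by blast
      have "\<epsilon>/2 > 0" using that by simp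
      define p where "p = (\<lambda>\<alpha>. if \<alpha> \<in> F then h \<alpha> else 0)"
      have "p = (\<Sum>\<alpha>\<in>F. series_scale (h \<alpha>) (unit_series \<alpha>))"
      proof
        fix \<beta>
        have "(\<Sum>\<alpha>\<in>F. series_scale (h \<alpha>) (unit_series \<alpha>)) \<beta> = (\<Sum>\<alpha>\<in>F. h \<alpha> * unit_series \<alpha> \<beta>)"
          by (induction F rule: infinite_finite_induct) (auto simp:)
        also have "\<dots> = (\<Sum>\<alpha>\<in>F. if \<alpha> = \<beta> then h \<alpha> else 0)"
          by (intro sum.cong) (auto simp: unit_series_def)
        finally show "p \<beta> = (\<Sum>\<alpha>\<in>F. series_scale (h \<alpha>) (unit_series \<alpha>)) \<beta>"
          using F(1) by (simp add: p_def)
      qed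
      then have p: "p \<in> right_closure f"
        using units sub by (auto intro!: ser.subspace_sum ser.subspace_scale)
      then obtain s where s: "s \<in> right_span f" "fock_norm (p - s) < \<epsilon>/2"
        using \<open>\<epsilon>/2 > 0\<close> unfolding fock_closure_def by blast
      have "fock_norm (h - p) \<le> \<epsilon>/2"
      proof (rule fock_norm_le_finite(2))
        fix G :: "'d list set" assume G: "finite G"
        have "(\<Sum>\<alpha>\<in>G. (cmod ((h - p) \<alpha>))\<^sup>2) = (\<Sum>\<alpha>\<in>G - F. (cmod (h \<alpha>))\<^sup>2)"
          using G by (intro sum.mono_neutral_cong_right) (auto simp: p_def)
        also have "\<dots> = (\<Sum>\<alpha>\<in>(G - F) \<union> F. (cmod (h \<alpha>))\<^sup>2) - (\<Sum>\<alpha>\<in>F. (cmod (h \<alpha>))\<^sup>2)"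
          using F(1) G by (subst sum.union_disjoint) auto
        also have "\<dots> \<le> (fock_norm h)\<^sup>2 - (\<Sum>\<alpha>\<in>F. (cmod (h \<alpha>))\<^sup>2)"
          using sum_le_fock_norm[OF h, of "(G - F) \<union> F"] F(1) G by simp
        also have "\<dots> \<le> (\<epsilon>/2)\<^sup>2" using F(2) by (simp add: dist_real_def)
        finally show "(\<Sum>\<alpha>\<in>G. (cmod ((h - p) \<alpha>))\<^sup>2) \<le> (\<epsilon>/2)\<^sup>2" .
      qed (use \<open>\<epsilon>/2 > 0\<close> in simp)
      moreover have "fock_norm ((h - p) + (p - s)) \<le> fock_norm (h - p) + fock_norm (p - s)"
        using p s h right_span_subset_fock[OF f]
        by (intro fock_norm_triangle fock_diff) (auto simp: fock_closure_def)
      ultimately show ?thesis using s by (intro bexI[of _ s]) auto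
    qed
    then show "h \<in> right_closure f" using h by (auto simp: fock_closure_def)
  qed
qed (rule fock_closure_subset)

(* as a simplification rule it would also expand the scaling inside series_span *)
declare series_scale_apply [simp del]

section \<open>Cauchy products and recognizable series\<close>

definition ser_mult :: "'d nc_series \<Rightarrow> 'd nc_series \<Rightarrow> 'd nc_series" where
  "ser_mult g h \<beta> = (\<Sum>i\<le>length \<beta>. g (take i \<beta>) * h (drop i \<beta>))"

lemma ser_mult_Nil: "ser_mult g h [] = g [] * h []"
  by (simp add: ser_mult_def)

lemma back_shift_ser_mult:
  "back_shift [k] (ser_mult g h) = ser_mult g (back_shift [k] h) + series_scale (h []) (back_shift [k] g)"
proof
  fix \<beta> :: "'a list"
  have "(\<Sum>i\<le>length \<beta>. g (take i (\<beta> @ [k])) * h (drop i (\<beta> @ [k])))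
      = (\<Sum>i\<le>length \<beta>. g (take i \<beta>) * h (drop i \<beta> @ [k]))"
    by (intro sum.cong) auto
  then show "back_shift [k] (ser_mult g h) \<beta> =
      (ser_mult g (back_shift [k] h) + series_scale (h []) (back_shift [k] g)) \<beta>"
    by (simp add: ser_mult_def back_shift_def series_scale_apply)
qed

lemma ser_mult_add_right: "ser_mult g (h + h') = ser_mult g h + ser_mult g h'"
  by (simp add: series_scale_apply fun_eq_iff ser_mult_def algebra_simps sum.distrib)

lemma ser_mult_scale_right: "ser_mult g (series_scale c h) = series_scale c (ser_mult g h)"
  by (simp add: series_scale_apply fun_eq_iff ser_mult_def sum_distrib_left algebra_simps)

text \<open>Finite rank of the Hankel matrix with entries \<open>s (\<beta> @ \<alpha>)\<close>: these are the series of noncommutative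
  rational functions that are regular at \<open>0\<close> (Kleene, Schuetzenberger, Fliess).\<close>

definition recognizable :: "'d nc_series \<Rightarrow> bool" where
  "recognizable s \<longleftrightarrow> (\<exists>B. finite B \<and> (\<forall>\<alpha>. back_shift \<alpha> s \<in> series_span B))"

lemma recognizableI_invariant:
  assumes "finite B" "s \<in> series_span B"
    and inv: "\<And>b k. b \<in> B \<Longrightarrow> back_shift [k] b \<in> series_span B"
  shows "recognizable s"
proof -
  have step: "back_shift [k] t \<in> series_span B" if "t \<in> series_span B" for k t
    using inv by (intro span_map[where T = "back_shift [k]", OF back_shift_add back_shift_scale _ _ that]) auto
  have "back_shift \<alpha> t \<in> series_span B" if "t \<in> series_span B" for \<alpha> t
    using that
  proof (induction \<alpha> arbitrary: t rule: rev_induct)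
    case (snoc k \<alpha>)
    then show ?case using step by (simp add: back_shift_append)
  qed simp
  then show ?thesis using assms unfolding recognizable_def by blast
qed

text \<open>Choosing the basis inside the orbit keeps it in the Fock space, and in every space that contains the
  orbit.\<close>

lemma recognizable_orbit_basis:
  assumes "recognizable s"
  obtains B where "finite B" "B \<subseteq> range (\<lambda>\<alpha>. back_shift \<alpha> s)" "\<And>\<alpha>. back_shift \<alpha> s \<in> series_span B"
proof -
  obtain B0 where B0: "finite B0" "\<And>\<alpha>. back_shift \<alpha> s \<in> series_span B0"
    using assms unfolding recognizable_def by blast
  obtain B where B: "B \<subseteq> range (\<lambda>\<alpha>. back_shift \<alpha> s)" "\<not> ser.dependent B"
    "range (\<lambda>\<alpha>. back_shift \<alpha> s) \<subseteq> series_span B"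
    using ser.maximal_independent_subset by blast
  have "finite B" using ser.independent_span_bound[OF B0(1) B(2)] B0 B(1) by blast
  then show ?thesis using that B by blast
qed

lemma recognizable_invariant_basis:
  assumes "recognizable s"
  obtains B where "finite B" "s \<in> series_span B" "\<And>b k. b \<in> B \<Longrightarrow> back_shift [k] b \<in> series_span B"
proof -
  obtain B where B: "finite B" "B \<subseteq> range (\<lambda>\<alpha>. back_shift \<alpha> s)" "\<And>\<alpha>. back_shift \<alpha> s \<in> series_span B"
    using recognizable_orbit_basis[OF assms] by blast
  show ?thesis
  proof
    show "s \<in> series_span B" using B(3)[of "[]"] by simp
    fix b k assume "b \<in> B"
    then obtain \<alpha> where "b = back_shift \<alpha> s" using B by blast
    then show "back_shift [k] b \<in> series_span B" using B(3)[of "[k] @ \<alpha>"] by (simp only: back_shift_append)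
  qed (rule B)
qed

lemma recognizable_add:
  assumes "recognizable s" "recognizable t"
  shows "recognizable (s + t)"
proof -
  obtain B C where "finite B" "\<And>\<alpha>. back_shift \<alpha> s \<in> series_span B"
    "finite C" "\<And>\<alpha>. back_shift \<alpha> t \<in> series_span C"
    using assms unfolding recognizable_def by blast
  then have "finite (B \<union> C)" "\<And>\<alpha>. back_shift \<alpha> (s + t) \<in> series_span (B \<union> C)"
    using ser.span_mono[of B "B \<union> C"] ser.span_mono[of C "B \<union> C"]
    by (auto simp: back_shift_add intro!: ser.span_add)
  then show ?thesis unfolding recognizable_def by blast
qed

lemma recognizable_scale:
  assumes "recognizable s"
  shows "recognizable (series_scale c s)"
  using assms unfolding recognizable_def by (metis back_shift_scale ser.span_scale)

lemma recognizable_diff: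
  assumes "recognizable s" "recognizable t"
  shows "recognizable (s - t)"
proof -
  have "s - t = s + series_scale (-1) t" by (rule ext) (simp add: series_scale_apply)
  then show ?thesis using recognizable_add[OF assms(1) recognizable_scale[OF assms(2)]] by metis
qed

lemma recognizable_one: "recognizable (unit_series [])"
  by (rule recognizableI_invariant[of "{unit_series []}"])
     (auto simp: back_shift_unit_Nil ser.span_base ser.span_zero)

lemma recognizable_letter: "recognizable (unit_series [k])"
proof (rule recognizableI_invariant[of "{unit_series [k], unit_series []}"])
  fix b :: "'a nc_series" and l assume "b \<in> {unit_series [k], unit_series []}"
  moreover have "back_shift [l] (unit_series [k]) = (if l = k then unit_series [] else 0)"
    by (auto simp: back_shift_def unit_series_def series_scale_apply fun_eq_iff)
  ultimately show "back_shift [l] b \<in> series_span {unit_series [k], unit_series []}"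
    by (auto simp: back_shift_unit_Nil ser.span_base ser.span_zero)
qed (auto simp: ser.span_base)

text \<open>The twisted Leibniz rule \<open>back_shift_ser_mult\<close> shows that the products of \<open>s\<close> with the invariant space of
  \<open>t\<close>, together with the invariant space of \<open>s\<close>, span an invariant space.\<close>

lemma recognizable_mult:
  assumes "recognizable s" "recognizable t"
  shows "recognizable (ser_mult s t)"
proof -
  obtain B where B: "finite B" "s \<in> series_span B" "\<And>b k. b \<in> B \<Longrightarrow> back_shift [k] b \<in> series_span B"
    using recognizable_invariant_basis[OF assms(1)] by blast
  obtain C where C: "finite C" "t \<in> series_span C" "\<And>b k. b \<in> C \<Longrightarrow> back_shift [k] b \<in> series_span C"
    using recognizable_invariant_basis[OF assms(2)] by blast
  let ?D = "B \<union> ser_mult s ` C"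
  have mult: "ser_mult s c \<in> series_span ?D" if "c \<in> series_span C" for c
    by (rule span_map[where T = "ser_mult s", OF ser_mult_add_right ser_mult_scale_right _ _ that])
       (auto intro: ser.span_base)
  have Bsub: "series_span B \<subseteq> series_span ?D" by (rule ser.span_mono) auto
  have sB: "back_shift [k] s \<in> series_span B" for k
    using B by (intro span_map[where T = "back_shift [k]", OF back_shift_add back_shift_scale _ _ B(2)]) auto
  show ?thesis
  proof (rule recognizableI_invariant[of ?D])
    fix b k assume "b \<in> ?D"
    then show "back_shift [k] b \<in> series_span ?D"
    proof
      assume "b \<in> ser_mult s ` C"
      then obtain c where c: "c \<in> C" "b = ser_mult s c" by blast
      show ?thesis unfolding c(2) back_shift_ser_mult
        using mult[OF C(3)[OF c(1)]] sB Bsub by (intro ser.span_add ser.span_scale) auto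
    qed (use B Bsub in auto)
  qed (use B C mult in auto)
qed

text \<open>Applying the adjoint shift to \<open>f = g * h\<close> and solving for the shift of \<open>g\<close> shows that \<open>g\<close> together
  with the invariant spaces of \<open>f\<close> and \<open>h\<close> spans an invariant space.\<close>

lemma recognizable_divide:
  assumes "recognizable f" "recognizable h" and f: "f = ser_mult g h" and h0: "h [] \<noteq> 0"
  shows "recognizable g"
proof -
  obtain B where B: "finite B" "f \<in> series_span B" "\<And>b k. b \<in> B \<Longrightarrow> back_shift [k] b \<in> series_span B"
    using recognizable_invariant_basis[OF assms(1)] by blast
  obtain C where C: "finite C" "h \<in> series_span C" "\<And>b k. b \<in> C \<Longrightarrow> back_shift [k] b \<in> series_span C"
    using recognizable_invariant_basis[OF assms(2)] by blast
  let ?D = "insert g (B \<union> ser_mult g ` C)"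
  have mult: "ser_mult g c \<in> series_span ?D" if "c \<in> series_span C" for c
    by (rule span_map[where T = "ser_mult g", OF ser_mult_add_right ser_mult_scale_right _ _ that])
       (auto intro: ser.span_base)
  have Bsub: "series_span B \<subseteq> series_span ?D" by (rule ser.span_mono) auto
  have fB: "back_shift [k] f \<in> series_span B" for k
    using B by (intro span_map[where T = "back_shift [k]", OF back_shift_add back_shift_scale _ _ B(2)]) auto
  have hC: "back_shift [k] h \<in> series_span C" for k
    using C by (intro span_map[where T = "back_shift [k]", OF back_shift_add back_shift_scale _ _ C(2)]) auto
  have g: "back_shift [k] g \<in> series_span ?D" for k
  proof -
    have "series_scale (h []) (back_shift [k] g) = back_shift [k] f - ser_mult g (back_shift [k] h)"
      by (simp add: f back_shift_ser_mult)
    also have "\<dots> \<in> series_span ?D" using mult[OF hC] fB Bsub by (intro ser.span_diff) auto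
    finally have "series_scale (1 / h []) (series_scale (h []) (back_shift [k] g)) \<in> series_span ?D"
      by (rule ser.span_scale)
    then show ?thesis using h0 by simp
  qed
  show ?thesis
  proof (rule recognizableI_invariant[of ?D])
    fix b k assume "b \<in> ?D"
    then consider "b = g" | "b \<in> B" | "b \<in> ser_mult g ` C" by blast
    then show "back_shift [k] b \<in> series_span ?D"
    proof cases
      case 3
      then obtain c where c: "c \<in> C" "b = ser_mult g c" by blast
      show ?thesis unfolding c(2) back_shift_ser_mult
        by (intro ser.span_add ser.span_scale mult[OF C(3)[OF c(1)]] g)
    qed (use B Bsub g in auto)
  qed (use B C in \<open>auto intro: ser.span_base\<close>)
qed

text \<open>The recursion for the coefficients of a left inverse descends in the length of the word; the first
  argument bounds the depth of the recursion.\<close>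

primrec left_inverse_upto :: "nat \<Rightarrow> 'd nc_series \<Rightarrow> 'd nc_series" where
  "left_inverse_upto 0 s = (\<lambda>\<beta>. 0)"
| "left_inverse_upto (Suc n) s = (\<lambda>\<beta>. ((if \<beta> = [] then 1 else 0)
     - (\<Sum>i<length \<beta>. left_inverse_upto n s (take i \<beta>) * s (drop i \<beta>))) / s [])"

definition left_inverse :: "'d nc_series \<Rightarrow> 'd nc_series" where
  "left_inverse s \<beta> = left_inverse_upto (Suc (length \<beta>)) s \<beta>"

lemma left_inverse_upto_stable:
  "length \<beta> < n \<Longrightarrow> length \<beta> < m \<Longrightarrow> left_inverse_upto n s \<beta> = left_inverse_upto m s \<beta>"
proof (induction n arbitrary: m \<beta>)
  case (Suc n)
  then obtain m' where m: "m = Suc m'" by (cases m) auto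
  have "left_inverse_upto n s (take i \<beta>) = left_inverse_upto m' s (take i \<beta>)" if "i < length \<beta>" for i
    using that Suc.prems m by (intro Suc.IH) auto
  then show ?case unfolding m by (simp cong: sum.cong_simp)
qed simp

lemma left_inverse:
  assumes "s [] \<noteq> 0"
  shows "ser_mult (left_inverse s) s = unit_series []"
proof
  fix \<beta> :: "'a list"
  have eq: "left_inverse_upto (length \<beta>) s (take i \<beta>) = left_inverse s (take i \<beta>)"
    if "i < length \<beta>" for i
    unfolding left_inverse_def using that by (intro left_inverse_upto_stable) auto
  have "left_inverse s \<beta> * s [] = unit_series [] \<beta>
      - (\<Sum>i<length \<beta>. left_inverse_upto (length \<beta>) s (take i \<beta>) * s (drop i \<beta>))"
    using assms unfolding left_inverse_def by (simp add: unit_series_def)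
  also have "\<dots> = unit_series [] \<beta> - (\<Sum>i<length \<beta>. left_inverse s (take i \<beta>) * s (drop i \<beta>))"
    using eq by (simp cong: sum.cong_simp)
  finally show "ser_mult (left_inverse s) s \<beta> = unit_series [] \<beta>"
    by (simp add: ser_mult_def lessThan_Suc_atMost[symmetric])
qed

lemma recognizable_left_inverse:
  assumes "recognizable s" "s [] \<noteq> 0"
  shows "recognizable (left_inverse s)"
  by (rule recognizable_divide[OF recognizable_one assms(1) left_inverse[of s, OF assms(2), symmetric] assms(2)])

text \<open>The map \<open>\<phi> \<mapsto> (\<lambda>\<alpha>. fip \<phi> (mult_word g \<alpha>))\<close> commutes with the adjoint shifts. It is linear only on the
  Fock space, because elsewhere the infinite sums may diverge.\<close>

lemma recognizable_correlation:
  assumes f: "f \<in> fock_space" "recognizable f" and g: "g \<in> fock_space"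
  shows "recognizable (\<lambda>\<alpha>. fip f (mult_word g \<alpha>))"
proof -
  define T where "T \<phi> = (\<lambda>\<alpha>. fip \<phi> (mult_word g \<alpha>))" for \<phi>
  obtain B where B: "finite B" "B \<subseteq> range (\<lambda>\<alpha>. back_shift \<alpha> f)" "\<And>\<alpha>. back_shift \<alpha> f \<in> series_span B"
    using recognizable_orbit_basis[OF f(2)] by blast
  have sub: "ser.subspace {\<phi> \<in> fock_space. T \<phi> \<in> series_span (T ` B)}"
  proof -
    have "T (\<phi> + \<psi>) = T \<phi> + T \<psi>" if "\<phi> \<in> fock_space" "\<psi> \<in> fock_space" for \<phi> \<psi>
      using that fock_mult_word[OF g] by (simp add: T_def series_scale_apply fun_eq_iff fip_add_left)
    moreover have "T (series_scale c \<phi>) = series_scale c (T \<phi>)" for c \<phi>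
      by (simp add: T_def series_scale_apply fun_eq_iff fip_scale_left)
    moreover have "T 0 = 0" by (simp add: T_def series_scale_apply fun_eq_iff fip_def)
    ultimately show ?thesis
      by (auto simp: ser.subspace_def fock_0 fock_add fock_scale ser.span_zero ser.span_add ser.span_scale)
  qed
  have "series_span B \<subseteq> {\<phi> \<in> fock_space. T \<phi> \<in> series_span (T ` B)}"
    by (rule ser.span_minimal[OF _ sub]) (use B(2) f fock_back_shift in \<open>auto intro: ser.span_base\<close>)
  moreover have "back_shift \<gamma> (T f) = T (back_shift \<gamma> f)" for \<gamma>
    by (simp add: T_def back_shift_def[of \<gamma> "\<lambda>\<alpha>. fip f (mult_word g \<alpha>)"] fip_mult_word[of f \<gamma>])
  ultimately have "back_shift \<gamma> (T f) \<in> series_span (T ` B)" for \<gamma> using B(3)[of \<gamma>] by auto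
  then have "recognizable (T f)" unfolding recognizable_def using B(1) by blast
  then show ?thesis by (simp add: T_def)
qed

section \<open>Factorization through the projection of \<open>1\<close>\<close>

text \<open>Subtracting the multiple of \<open>f\<close> that cancels the constant coefficient and stripping the final letter
  maps the shift of \<open>f\<close> by a word to \<open>0\<close> or to the shift by a shorter word. The map is
  bounded because \<open>f [] \<noteq> 0\<close>.\<close>

lemma fock_closure_deflate:
  fixes f m :: "'d nc_series"
  assumes f: "f \<in> fock_space" and f0: "f [] \<noteq> 0" and m: "m \<in> right_closure f"
  shows "back_shift [k] (m - series_scale (m [] / f []) f) \<in> right_closure f"
proof (rule fock_closure_map[where T = "\<lambda>m. back_shift [k] (m - series_scale (m [] / f []) f)"
      and C = "1 + fock_norm f / cmod (f [])", OF _ _ _ _ _ m])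
  show "right_span f \<subseteq> fock_space" by (rule right_span_subset_fock[OF f])
  fix h :: "'d nc_series" assume h: "h \<in> fock_space"
  let ?e = "h - series_scale (h [] / f []) f"
  have e: "?e \<in> fock_space" by (intro fock_diff fock_scale h f)
  show "back_shift [k] ?e \<in> fock_space" by (rule fock_back_shift[OF e])
  have "?e = h + series_scale (- (h [] / f [])) f" by (rule ext) (simp add: series_scale_apply)
  then have "fock_norm ?e \<le> fock_norm h + fock_norm (series_scale (- (h [] / f [])) f)"
    using fock_norm_triangle[OF h fock_scale[OF f]] by metis
  also have "\<dots> = fock_norm h + cmod (h []) * (fock_norm f / cmod (f []))"
    by (simp only: fock_norm_scale norm_minus_cancel norm_divide) simp
  also have "\<dots> \<le> fock_norm h + fock_norm h * (fock_norm f / cmod (f []))"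
    by (intro add_left_mono mult_right_mono coeff_le_fock_norm h divide_nonneg_nonneg) (simp_all add: fock_norm_nonneg)
  finally show "fock_norm (back_shift [k] ?e) \<le> (1 + fock_norm f / cmod (f [])) * fock_norm h"
    using fock_back_shift(2)[OF e, of "[k]"] by (simp add: algebra_simps)
next
  fix h h' :: "'d nc_series"
  show "back_shift [k] (h - h' - series_scale ((h - h') [] / f []) f)
      = back_shift [k] (h - series_scale (h [] / f []) f) - back_shift [k] (h' - series_scale (h' [] / f []) f)"
    by (simp add: series_scale_apply fun_eq_iff back_shift_def algebra_simps diff_divide_distrib)
next
  fix s assume s: "s \<in> right_span f"
  show "back_shift [k] (s - series_scale (s [] / f []) f) \<in> right_span f"
  proof (rule span_map[where T = "\<lambda>m. back_shift [k] (m - series_scale (m [] / f []) f)",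
        OF _ _ _ subspace_right_span s[unfolded right_span_def]])
    fix b assume "b \<in> range (mult_word f)"
    then obtain \<alpha> where b: "b = mult_word f \<alpha>" by blast
    show "back_shift [k] (b - series_scale (b [] / f []) f) \<in> right_span f"
    proof (cases \<alpha> rule: rev_cases)
      case Nil
      then show ?thesis using f0 ser.subspace_0[OF subspace_right_span, of f] by (simp add: b back_shift_0)
    next
      case (snoc \<alpha>' l)
      then show ?thesis using right_span_generator[of \<alpha>' f] ser.subspace_0[OF subspace_right_span, of f]
        by (simp add: b back_right_shift)
    qed
  qed (simp_all add: series_scale_apply fun_eq_iff back_shift_def algebra_simps add_divide_distrib)
qed

text \<open>The hypotheses say that \<open>g\<close> is the projection of \<open>1\<close> to the closed right invariant subspace generated
  by \<open>f\<close>. Then \<open>g\<close> is orthogonal to its shifts by nonempty words, and the deflation \<open>m \<mapsto> back_shift [k] (m - c g)\<close> with vanishing constant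
  coefficient stays in the subspace. Stripping letters one at a time, the coefficients of every
  \<open>m\<close> in the subspace are those of \<open>g\<close> times its series of correlations with the shifts of \<open>g\<close>.\<close>

lemma projection_factorization:
  assumes f: "f \<in> fock_space" and f0: "f [] \<noteq> 0" and g: "g \<in> right_closure f"
    and proj: "\<And>m. m \<in> right_closure f \<Longrightarrow> fip m g = m []"
  shows "g [] \<noteq> 0" and "f = ser_mult g (\<lambda>\<alpha>. fip f (mult_word g \<alpha>) / g [])"
proof -
  have gf: "g \<in> fock_space" using g fock_closure_subset by blast
  have sub: "ser.subspace (right_closure f)"
    by (intro subspace_fock_closure subspace_right_span right_span_subset_fock f)
  have fM: "f \<in> right_closure f" using right_closure_generator[OF f, of "[]"] by simp
  have "g \<noteq> 0" using proj[OF fM] f0 by (auto simp: fip_def)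
  moreover have "g [] = complex_of_real ((fock_norm g)\<^sup>2)"
    using proj[OF g] by (simp add: fip_self)
  ultimately show g0: "g [] \<noteq> 0" using fock_norm_zero_iff[OF gf] by simp
  have gg: "fip g (mult_word g (\<alpha> @ [k])) = 0" for \<alpha> k
  proof -
    have "fip (mult_word g (\<alpha> @ [k])) g = mult_word g (\<alpha> @ [k]) []"
      by (rule proj[OF right_closure_mult_word[OF f g]])
    then show ?thesis using fip_cnj[of "mult_word g (\<alpha> @ [k])" g] by simp
  qed
  have "\<forall>m\<in>right_closure f. m \<beta> = ser_mult g (\<lambda>\<alpha>. fip m (mult_word g \<alpha>) / g []) \<beta>" for \<beta>
  proof (induction \<beta> rule: rev_induct)
    case Nil
    show ?case using proj g0 by (simp add: ser_mult_Nil)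
  next
    case (snoc k \<beta>)
    show ?case
    proof
      fix m assume m: "m \<in> right_closure f"
      let ?h = "\<lambda>m \<alpha>. fip m (mult_word g \<alpha>) / g []"
      let ?D = "\<lambda>m. back_shift [k] (m - series_scale (m [] / f []) f)"
      define c where "c = m [] / g []"
      define m' where "m' = back_shift [k] (m - series_scale c g)"
      have mf: "m \<in> fock_space" using m fock_closure_subset by blast
      have "m' = ?D m - series_scale c (?D g)"
        using g0 f0 by (simp add: m'_def c_def series_scale_apply fun_eq_iff back_shift_def field_simps)
      also have "\<dots> \<in> right_closure f"
        by (intro ser.subspace_diff[OF sub] ser.subspace_scale[OF sub] fock_closure_deflate f f0 m g)
      finally have m': "m' \<in> right_closure f" .
      have h': "?h m' = back_shift [k] (?h m)"
      proof
        fix \<alpha>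
        have "fip m' (mult_word g \<alpha>) = fip (m - series_scale c g) (mult_word g (\<alpha> @ [k]))"
          by (simp add: m'_def fip_right_shift)
        also have "\<dots> = fip m (mult_word g (\<alpha> @ [k])) - c * fip g (mult_word g (\<alpha> @ [k]))"
          by (simp only: fip_diff_left[OF mf fock_scale[OF gf] fock_mult_word[OF gf]] fip_scale_left)
        finally show "?h m' \<alpha> = back_shift [k] (?h m) \<alpha>"
          unfolding gg by (simp add: back_shift_def)
      qed
      have "m (\<beta> @ [k]) = m' \<beta> + c * g (\<beta> @ [k])"
        by (simp add: m'_def back_shift_def series_scale_apply)
      also have "m' \<beta> = ser_mult g (back_shift [k] (?h m)) \<beta>"
        using bspec[OF snoc m'] unfolding h' .
      also have "c = ?h m []" using proj[OF m] by (simp add: c_def)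
      also have "ser_mult g (back_shift [k] (?h m)) \<beta> + ?h m [] * g (\<beta> @ [k])
          = back_shift [k] (ser_mult g (?h m)) \<beta>"
        unfolding back_shift_ser_mult by (simp add: back_shift_def series_scale_apply)
      finally show "m (\<beta> @ [k]) = ser_mult g (?h m) (\<beta> @ [k])" by (simp add: back_shift_def)
    qed
  qed
  then show "f = ser_mult g (\<lambda>\<alpha>. fip f (mult_word g \<alpha>) / g [])" using fM by blast
qed

text \<open>If the constant coefficient of \<open>f\<close> vanishes, \<open>1\<close> is such an element. Otherwise it is \<open>1 - g\<close> for the
  projection \<open>g\<close> of \<open>1\<close>, which is recognizable as the quotient of \<open>f\<close> by its correlations with the
  shifts of \<open>g\<close>.\<close>

lemma not_outer_recognizable_annihilator:
  fixes f :: "('d::finite) nc_series"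
  assumes f: "f \<in> fock_space" "recognizable f" and "\<not> outer f"
  shows "\<exists>u\<in>fock_space. u \<noteq> 0 \<and> recognizable u \<and> (\<forall>\<alpha>. fip (mult_word f \<alpha>) u = 0)"
proof (cases "f [] = 0")
  case True
  have "mult_word f \<alpha> [] = 0" for \<alpha> using True by (cases \<alpha> rule: rev_cases) auto
  moreover have "unit_series [] \<noteq> (0 :: 'd nc_series)" by (auto simp: unit_series_def series_scale_apply fun_eq_iff)
  ultimately show ?thesis
    by (intro bexI[of _ "unit_series []"]) (auto simp: fip_unit fock_unit recognizable_one)
next
  case False
  note S = subspace_right_span[of f] right_span_subset_fock[OF f(1)]
  let ?one = "unit_series [] :: 'd nc_series"
  obtain g where g: "g \<in> right_closure f" "\<And>s. s \<in> right_span f \<Longrightarrow> fip s (?one - g) = 0"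
    using fock_projection[OF S fock_unit] by blast
  have gf: "g \<in> fock_space" using g fock_closure_subset by blast
  let ?u = "?one - g"
  have uf: "?u \<in> fock_space" by (intro fock_diff fock_unit gf)
  have proj: "fip m g = m []" if m: "m \<in> right_closure f" for m
  proof -
    have mf: "m \<in> fock_space" using m fock_closure_subset by blast
    have "fip m ?u = 0" by (rule fock_closure_orthogonal[OF S(2) uf g(2) m])
    then show ?thesis by (simp add: fip_diff_right[OF fock_unit gf mf] fip_unit)
  qed
  note factors = projection_factorization[OF f(1) False g(1) proj]
  have "recognizable g"
  proof (rule recognizable_divide[OF f(2) _ factors(2)])
    have "(\<lambda>\<alpha>. fip f (mult_word g \<alpha>) / g []) = series_scale (1 / g []) (\<lambda>\<alpha>. fip f (mult_word g \<alpha>))"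
      by (simp add: series_scale_apply fun_eq_iff)
    then show "recognizable (\<lambda>\<alpha>. fip f (mult_word g \<alpha>) / g [])"
      using recognizable_scale[OF recognizable_correlation[OF f gf]] by metis
    show "fip f (mult_word g []) / g [] \<noteq> 0"
      using proj[of f] right_closure_generator[OF f(1), of "[]"] False factors(1) by simp
  qed
  then have "recognizable ?u" by (rule recognizable_diff[OF recognizable_one])
  moreover have "?u \<noteq> 0"
  proof
    assume "?u = 0"
    then have "?one \<in> right_closure f" using g by simp
    then show False using right_closure_eq_fock[OF f(1)] \<open>\<not> outer f\<close> f by (simp add: outer_iff)
  qed
  ultimately show ?thesis using uf g(2)[OF right_span_generator] by blast
qed

section \<open>The row ball\<close>

text \<open>Row vectors are functions of which only the entries below \<open>n\<close> matter.\<close>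

definition sq_norm :: "nat \<Rightarrow> (nat \<Rightarrow> complex) \<Rightarrow> real" where
  "sq_norm n y = (\<Sum>i<n. (cmod (y i))\<^sup>2)"

definition row_times :: "nat \<Rightarrow> (nat \<Rightarrow> complex) \<Rightarrow> complex mat \<Rightarrow> nat \<Rightarrow> complex" where
  "row_times n y A j = (\<Sum>i<n. y i * A $$ (i, j))"

lemma sq_norm_nonneg: "sq_norm n y \<ge> 0"
  by (simp add: sq_norm_def sum_nonneg)

lemma euclid_norm_sq: "(euclid_norm v)\<^sup>2 = sq_norm (dim_vec v) (\<lambda>i. v $ i)"
  by (simp add: euclid_norm_def L2_set_def sq_norm_def sum_nonneg)

lemma euclid_norm_nonneg: "euclid_norm v \<ge> 0"
  by (simp add: euclid_norm_def L2_set_nonneg)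

lemma sum_Cauchy_Schwarz:
  fixes a b :: "'b \<Rightarrow> complex"
  shows "cmod (\<Sum>p\<in>I. a p * cnj (b p)) \<le> sqrt (\<Sum>p\<in>I. (cmod (a p))\<^sup>2) * sqrt (\<Sum>p\<in>I. (cmod (b p))\<^sup>2)"
proof -
  have "cmod (\<Sum>p\<in>I. a p * cnj (b p)) \<le> (\<Sum>p\<in>I. cmod (a p) * cmod (b p))"
    by (rule order_trans[OF norm_sum]) (simp add: norm_mult)
  also have "\<dots> \<le> L2_set (\<lambda>p. cmod (a p)) I * L2_set (\<lambda>p. cmod (b p)) I"
    using L2_set_mult_ineq[of "\<lambda>p. cmod (a p)" "\<lambda>p. cmod (b p)" I] by simp
  finally show ?thesis by (simp add: L2_set_def)
qed

definition row_gram :: "nat \<Rightarrow> ('d::finite) mat_tuple \<Rightarrow> complex mat" where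
  "row_gram n X = mat n n (\<lambda>ij. \<Sum>j\<in>UNIV. (X j * mat_adjoint (X j)) $$ ij)"

lemma row_norm_eq: "row_norm n X = sqrt (op_norm (row_gram n X))"
  by (simp add: row_norm_def row_gram_def)

lemma index_mat_adjoint:
  fixes A :: "complex mat"
  assumes "A \<in> carrier_mat n n" "i < n" "j < n"
  shows "mat_adjoint A $$ (i, j) = cnj (A $$ (j, i))"
  using assms by (simp add: mat_adjoint_def mat_of_rows_def)

lemma row_gram_vec:
  fixes X :: "('d::finite) mat_tuple"
  assumes X: "X \<in> mat_tuples n" and v: "v \<in> carrier_vec n" and i: "i < n"
  shows "(row_gram n X *\<^sub>v v) $ i =
    (\<Sum>k\<in>UNIV. \<Sum>j<n. X k $$ (i, j) * cnj (row_times n (\<lambda>l. cnj (v $ l)) (X k) j))"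
proof -
  have XC: "X k \<in> carrier_mat n n" for k using X by (simp add: mat_tuples_def)
  have e: "(X k * mat_adjoint (X k)) $$ (i, l) = (\<Sum>j<n. X k $$ (i, j) * cnj (X k $$ (l, j)))"
    if "l < n" for k l
  proof -
    have "mat_adjoint (X k) \<in> carrier_mat n n" using XC[of k] by (auto simp: mat_adjoint_def)
    then have "(X k * mat_adjoint (X k)) $$ (i, l) = (\<Sum>j = 0..<n. X k $$ (i, j) * mat_adjoint (X k) $$ (j, l))"
      using XC[of k] i that by (simp add: scalar_prod_def)
    then show ?thesis
      using that by (simp add: index_mat_adjoint[OF XC] atLeast0LessThan)
  qed
  have "(row_gram n X *\<^sub>v v) $ i = (\<Sum>l<n. (\<Sum>k\<in>UNIV. (X k * mat_adjoint (X k)) $$ (i, l)) * v $ l)"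
    using v i by (simp add: row_gram_def scalar_prod_def atLeast0LessThan)
  also have "\<dots> = (\<Sum>l<n. \<Sum>k\<in>UNIV. \<Sum>j<n. X k $$ (i, j) * cnj (X k $$ (l, j)) * v $ l)"
    by (intro sum.cong) (auto simp: e sum_distrib_right)
  also have "\<dots> = (\<Sum>k\<in>UNIV. \<Sum>l<n. \<Sum>j<n. X k $$ (i, j) * cnj (X k $$ (l, j)) * v $ l)"
    by (rule sum.swap)
  also have "\<dots> = (\<Sum>k\<in>UNIV. \<Sum>j<n. \<Sum>l<n. X k $$ (i, j) * cnj (X k $$ (l, j)) * v $ l)"
    by (intro sum.cong refl sum.swap)
  also have "\<dots> = (\<Sum>k\<in>UNIV. \<Sum>j<n. X k $$ (i, j) * cnj (row_times n (\<lambda>l. cnj (v $ l)) (X k) j))"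
    by (simp add: row_times_def sum_distrib_left mult.assoc mult.commute mult.left_commute)
  finally show ?thesis .
qed

lemma row_gram_form:
  fixes X :: "('d::finite) mat_tuple"
  assumes X: "X \<in> mat_tuples n" and v: "v \<in> carrier_vec n"
  shows "(\<Sum>i<n. y i * (row_gram n X *\<^sub>v v) $ i) =
    (\<Sum>p\<in>UNIV \<times> {..<n}. row_times n y (X (fst p)) (snd p) *
       cnj (row_times n (\<lambda>l. cnj (v $ l)) (X (fst p)) (snd p)))"
proof -
  let ?r = "\<lambda>k j. cnj (row_times n (\<lambda>l. cnj (v $ l)) (X k) j)"
  have "(\<Sum>i<n. y i * (row_gram n X *\<^sub>v v) $ i) = (\<Sum>i<n. \<Sum>k\<in>UNIV. \<Sum>j<n. y i * X k $$ (i, j) * ?r k j)"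
    by (intro sum.cong) (auto simp: row_gram_vec[OF X v] sum_distrib_left mult.assoc)
  also have "\<dots> = (\<Sum>k\<in>UNIV. \<Sum>i<n. \<Sum>j<n. y i * X k $$ (i, j) * ?r k j)" by (rule sum.swap)
  also have "\<dots> = (\<Sum>k\<in>UNIV. \<Sum>j<n. \<Sum>i<n. y i * X k $$ (i, j) * ?r k j)"
    by (intro sum.cong refl sum.swap)
  also have "\<dots> = (\<Sum>k\<in>UNIV. \<Sum>j<n. row_times n y (X k) j * ?r k j)"
    by (simp only: row_times_def[of n y] sum_distrib_right)
  also have "\<dots> = (\<Sum>p\<in>UNIV \<times> {..<n}. row_times n y (X (fst p)) (snd p) * ?r (fst p) (snd p))"
    by (subst sum.cartesian_product) (simp add: case_prod_beta)
  finally show ?thesis .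
qed

lemma sum_sq_norm_row_times:
  "(\<Sum>p\<in>UNIV \<times> {..<n}. (cmod (row_times n y (X (fst p)) (snd p)))\<^sup>2)
    = (\<Sum>k\<in>UNIV. sq_norm n (row_times n y (X k)))"
  unfolding sq_norm_def by (subst sum.cartesian_product) (simp add: case_prod_beta)

text \<open>The Cauchy-Schwarz inequality for the positive semidefinite form of the Gram matrix, applied to \<open>v\<close> and
  its image.\<close>

lemma row_gram_bound:
  fixes X :: "('d::finite) mat_tuple"
  assumes X: "X \<in> mat_tuples n" and v: "v \<in> carrier_vec n" and "\<rho> \<ge> 0"
    and bd: "\<And>y. (\<Sum>k\<in>UNIV. sq_norm n (row_times n y (X k))) \<le> \<rho> * sq_norm n y"
  shows "euclid_norm (row_gram n X *\<^sub>v v) \<le> \<rho> * euclid_norm v"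
proof -
  let ?w = "row_gram n X *\<^sub>v v"
  have w: "dim_vec ?w = n" by (simp add: row_gram_def)
  have "complex_of_real ((euclid_norm ?w)\<^sup>2) = (\<Sum>i<n. cnj (?w $ i) * ?w $ i)"
    unfolding euclid_norm_sq sq_norm_def w of_real_sum complex_norm_square by (simp only: mult.commute)
  also have "cmod \<dots> \<le> sqrt (\<Sum>k\<in>UNIV. sq_norm n (row_times n (\<lambda>i. cnj (?w $ i)) (X k)))
      * sqrt (\<Sum>k\<in>UNIV. sq_norm n (row_times n (\<lambda>l. cnj (v $ l)) (X k)))"
    unfolding row_gram_form[OF X v] sum_sq_norm_row_times[symmetric] by (rule sum_Cauchy_Schwarz)
  also have "\<dots> \<le> sqrt (\<rho> * sq_norm n (\<lambda>i. cnj (?w $ i))) * sqrt (\<rho> * sq_norm n (\<lambda>l. cnj (v $ l)))"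
    by (intro mult_mono real_sqrt_le_mono bd) (auto simp: sum_nonneg sq_norm_nonneg \<open>\<rho> \<ge> 0\<close>)
  also have "sq_norm n (\<lambda>i. cnj (?w $ i)) = (euclid_norm ?w)\<^sup>2"
    unfolding euclid_norm_sq w by (simp add: sq_norm_def)
  also have "sq_norm n (\<lambda>i. cnj (v $ i)) = (euclid_norm v)\<^sup>2"
    using v unfolding euclid_norm_sq by (simp add: sq_norm_def)
  also have "sqrt (\<rho> * (euclid_norm ?w)\<^sup>2) * sqrt (\<rho> * (euclid_norm v)\<^sup>2) = euclid_norm ?w * (\<rho> * euclid_norm v)"
    using \<open>\<rho> \<ge> 0\<close> by (simp add: real_sqrt_mult euclid_norm_nonneg)
  finally have *: "euclid_norm ?w * euclid_norm ?w \<le> euclid_norm ?w * (\<rho> * euclid_norm v)"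
    by (simp add: norm_power euclid_norm_nonneg power2_eq_square norm_mult)
  show ?thesis
  proof (cases "euclid_norm ?w = 0")
    case True
    then show ?thesis using \<open>\<rho> \<ge> 0\<close> euclid_norm_nonneg[of v] by simp
  next
    case False
    then have "euclid_norm ?w > 0" using euclid_norm_nonneg[of ?w] by linarith
    then show ?thesis using * by (simp only: mult_le_cancel_left_pos)
  qed
qed

lemma row_gram_carrier: "row_gram n X \<in> carrier_mat n n"
  by (simp add: row_gram_def)

text \<open>Together with \<open>row_ball_strict\<close> this replaces the operator norm of \<open>\<Sum>\<^sub>k X\<^sub>k X\<^sub>k\<^sup>*\<close> by an inequality
  between quadratic forms in a row vector \<open>y\<close>: \<open>\<Sum>\<^sub>k |y X\<^sub>k|\<^sup>2 \<le> \<rho> |y|\<^sup>2\<close>.\<close>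

lemma row_norm_le:
  fixes X :: "('d::finite) mat_tuple"
  assumes X: "X \<in> mat_tuples n" and "\<rho> \<ge> 0"
    and bd: "\<And>y. (\<Sum>k\<in>UNIV. sq_norm n (row_times n y (X k))) \<le> \<rho> * sq_norm n y"
  shows "row_norm n X \<le> sqrt \<rho>"
proof -
  have "op_norm (row_gram n X) \<le> \<rho>"
    unfolding op_norm_def
  proof (rule cSUP_least)
    have "0\<^sub>v n \<in> {v \<in> carrier_vec n. euclid_norm v \<le> 1}" by (simp add: euclid_norm_def L2_set_def)
    then show "{v \<in> carrier_vec (dim_col (row_gram n X)). euclid_norm v \<le> 1} \<noteq> {}"
      using row_gram_carrier[of n X] by (auto intro!: exI[of _ "0\<^sub>v n"])
    fix v assume "v \<in> {v \<in> carrier_vec (dim_col (row_gram n X)). euclid_norm v \<le> 1}"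
    then have v: "v \<in> carrier_vec n" "euclid_norm v \<le> 1" using row_gram_carrier[of n X] by auto
    have "\<rho> * euclid_norm v \<le> \<rho>" using v(2) \<open>\<rho> \<ge> 0\<close> by (simp add: mult_left_le)
    then show "euclid_norm (row_gram n X *\<^sub>v v) \<le> \<rho>"
      using row_gram_bound[OF X v(1) \<open>\<rho> \<ge> 0\<close> bd] by linarith
  qed
  then show ?thesis by (simp add: row_norm_eq)
qed

lemma row_times_crude_bound:
  fixes X :: "('d::finite) mat_tuple"
  shows "(\<Sum>k\<in>UNIV. sq_norm n (row_times n y (X k))) \<le> (\<Sum>k\<in>UNIV. \<Sum>j<n. \<Sum>i<n. (cmod (X k $$ (i, j)))\<^sup>2) * sq_norm n y"
proof -
  have "(cmod (row_times n y (X k) j))\<^sup>2 \<le> (\<Sum>i<n. (cmod (X k $$ (i, j)))\<^sup>2) * sq_norm n y" for k j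
  proof -
    have "cmod (row_times n y (X k) j) \<le> sqrt (sq_norm n y) * sqrt (\<Sum>i<n. (cmod (X k $$ (i, j)))\<^sup>2)"
      using sum_Cauchy_Schwarz[of y "\<lambda>i. cnj (X k $$ (i, j))" "{..<n}"]
      by (simp add: row_times_def sq_norm_def)
    then have "(cmod (row_times n y (X k) j))\<^sup>2 \<le> (sqrt (sq_norm n y) * sqrt (\<Sum>i<n. (cmod (X k $$ (i, j)))\<^sup>2))\<^sup>2"
      by (intro power_mono) auto
    then show ?thesis by (simp add: power_mult_distrib sq_norm_nonneg sum_nonneg mult.commute)
  qed
  then show ?thesis unfolding sq_norm_def[of n "row_times _ _ _"] sum_distrib_right by (intro sum_mono) (simp add: sum_distrib_right)
qed

lemma row_ball_strict:
  fixes X :: "('d::finite) mat_tuple"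
  assumes "X \<in> row_ball n"
  obtains \<rho> where "0 \<le> \<rho>" "\<rho> < 1"
    "\<And>y. (\<Sum>k\<in>UNIV. sq_norm n (row_times n y (X k))) \<le> \<rho> * sq_norm n y"
proof
  have X: "X \<in> mat_tuples n" and lt: "row_norm n X < 1" using assms by (auto simp: row_ball_def)
  let ?G = "row_gram n X" and ?\<rho> = "op_norm (row_gram n X)"
  let ?C = "\<Sum>k\<in>UNIV. \<Sum>j<n. \<Sum>i<n. (cmod (X k $$ (i, j)))\<^sup>2"
  let ?V = "{v \<in> carrier_vec (dim_col ?G). euclid_norm v \<le> 1}"
  have C: "?C \<ge> 0" by (intro sum_nonneg) auto
  have V: "?V = {v \<in> carrier_vec n. euclid_norm v \<le> 1}" using row_gram_carrier[of n X] by auto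
  have bdd: "bdd_above ((\<lambda>v. euclid_norm (?G *\<^sub>v v)) ` ?V)"
  proof (rule bdd_aboveI2)
    fix v assume "v \<in> ?V"
    then have v: "v \<in> carrier_vec n" "euclid_norm v \<le> 1" unfolding V by auto
    have "?C * euclid_norm v \<le> ?C" using v(2) C by (simp add: mult_left_le)
    then show "euclid_norm (?G *\<^sub>v v) \<le> ?C"
      using row_gram_bound[OF X v(1) C row_times_crude_bound] by linarith
  qed
  have le: "euclid_norm (?G *\<^sub>v v) \<le> ?\<rho>" if "v \<in> carrier_vec n" "euclid_norm v \<le> 1" for v
    unfolding op_norm_def by (rule cSUP_upper[OF _ bdd]) (use that V in auto)
  have "0\<^sub>v n \<in> carrier_vec n" "euclid_norm (0\<^sub>v n) \<le> 1" by (auto simp: euclid_norm_def L2_set_def)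
  from le[OF this] show nn: "0 \<le> ?\<rho>" using euclid_norm_nonneg order_trans by blast
  show "?\<rho> < 1" using lt by (simp add: row_norm_eq)
  fix y
  define v where "v = vec n (\<lambda>i. cnj (y i))"
  have v: "v \<in> carrier_vec n" by (simp add: v_def)
  have yv: "row_times n (\<lambda>l. cnj (v $ l)) A = row_times n y A" for A
    by (rule ext) (simp add: row_times_def v_def)
  have nv: "(euclid_norm v)\<^sup>2 = sq_norm n y" by (simp add: euclid_norm_sq v_def sq_norm_def)
  show "(\<Sum>k\<in>UNIV. sq_norm n (row_times n y (X k))) \<le> ?\<rho> * sq_norm n y"
  proof (cases "euclid_norm v = 0")
    case True
    then have "sq_norm n y = 0" using nv by simp
    then show ?thesis using row_times_crude_bound[of n y X] by simp
  next
    case False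
    then have pos: "euclid_norm v > 0" using euclid_norm_nonneg[of v] by linarith
    let ?c = "complex_of_real (1 / euclid_norm v)"
    have en: "euclid_norm (?c \<cdot>\<^sub>v u) = euclid_norm u / euclid_norm v" if "u \<in> carrier_vec n" for u
    proof -
      have "(euclid_norm (?c \<cdot>\<^sub>v u))\<^sup>2 = (euclid_norm u / euclid_norm v)\<^sup>2"
        using that pos by (simp add: euclid_norm_sq sq_norm_def norm_divide power_divide sum_divide_distrib)
      then show ?thesis using euclid_norm_nonneg pos by (simp add: power2_eq_iff_nonneg)
    qed
    have w: "?G *\<^sub>v v \<in> carrier_vec n" by (rule mult_mat_vec_carrier[OF row_gram_carrier v])
    have "euclid_norm (?G *\<^sub>v (?c \<cdot>\<^sub>v v)) \<le> ?\<rho>"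
      by (rule le) (use v pos in \<open>auto simp: en simp del: of_real_divide\<close>)
    also have "?G *\<^sub>v (?c \<cdot>\<^sub>v v) = ?c \<cdot>\<^sub>v (?G *\<^sub>v v)"
      by (rule mult_mat_vec[OF row_gram_carrier v])
    finally have gv: "euclid_norm (?G *\<^sub>v v) \<le> ?\<rho> * euclid_norm v"
      using pos w by (simp add: en pos_divide_le_eq del: of_real_divide)
    have "complex_of_real (\<Sum>k\<in>UNIV. sq_norm n (row_times n y (X k))) = (\<Sum>i<n. y i * (?G *\<^sub>v v) $ i)"
      unfolding row_gram_form[OF X v] yv sum_sq_norm_row_times[symmetric] of_real_sum complex_norm_square ..
    also have "cmod \<dots> \<le> sqrt (\<Sum>i<n. (cmod (y i))\<^sup>2) * sqrt (\<Sum>i<n. (cmod (cnj ((?G *\<^sub>v v) $ i)))\<^sup>2)"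
      using sum_Cauchy_Schwarz[of y "\<lambda>i. cnj ((?G *\<^sub>v v) $ i)" "{..<n}"] by simp
    also have "\<dots> = euclid_norm v * euclid_norm (?G *\<^sub>v v)"
      unfolding euclid_norm_def L2_set_def carrier_vecD[OF v] carrier_vecD[OF w]
      by (simp add: v_def)
    also have "\<dots> \<le> euclid_norm v * (?\<rho> * euclid_norm v)"
      by (intro mult_left_mono gv euclid_norm_nonneg)
    also have "\<dots> = ?\<rho> * sq_norm n y" by (simp add: nv[symmetric] power2_eq_square)
    finally show ?thesis using sum_nonneg[of UNIV "\<lambda>k. sq_norm n (row_times n y (X k))"]
      by (simp add: sq_norm_nonneg del: of_real_sum)
  qed
qed

lemma row_times_mult:
  assumes "A \<in> carrier_mat n n" "B \<in> carrier_mat n n" "j < n"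
  shows "row_times n y (A * B) j = row_times n (row_times n y A) B j"
proof -
  have "row_times n y (A * B) j = (\<Sum>i<n. \<Sum>l<n. y i * A $$ (i, l) * B $$ (l, j))"
    unfolding row_times_def
    by (intro sum.cong) (use assms in \<open>auto simp: scalar_prod_def atLeast0LessThan sum_distrib_left mult.assoc\<close>)
  also have "\<dots> = (\<Sum>l<n. \<Sum>i<n. y i * A $$ (i, l) * B $$ (l, j))" by (rule sum.swap)
  finally show ?thesis by (simp add: row_times_def sum_distrib_right)
qed

lemma row_times_cong: "(\<And>i. i < n \<Longrightarrow> y i = z i) \<Longrightarrow> row_times n y A j = row_times n z A j"
  by (simp add: row_times_def)

lemma word_eval_Nil: "word_eval n X [] = 1\<^sub>m n"
  by (simp add: word_eval_def)

lemma word_eval_Cons: "word_eval n X (k # \<beta>) = X k * word_eval n X \<beta>"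
  by (simp add: word_eval_def)

lemma word_eval_carrier: "X \<in> mat_tuples n \<Longrightarrow> word_eval n X \<beta> \<in> carrier_mat n n"
  by (induction \<beta>) (auto simp: word_eval_Nil word_eval_Cons mat_tuples_def intro: mult_carrier_mat)

lemma word_eval_append:
  assumes "X \<in> mat_tuples n"
  shows "word_eval n X (\<alpha> @ \<beta>) = word_eval n X \<alpha> * word_eval n X \<beta>"
proof (induction \<alpha>)
  case Nil
  show ?case using word_eval_carrier[OF assms, of \<beta>] by (simp add: word_eval_Nil)
next
  case (Cons k \<alpha>)
  have "X k \<in> carrier_mat n n" using assms by (simp add: mat_tuples_def)
  then show ?case using Cons word_eval_carrier[OF assms]
    by (simp add: word_eval_Cons assoc_mult_mat[of "X k" n n _ n _ n])
qed

section \<open>Evaluation at chain matrices\<close>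

text \<open>The path along the letters of \<open>w\<close>, as a tuple of strictly upper triangular matrices: products of
  its components are nonzero only along factors of \<open>w\<close>.\<close>

definition chain_tuple :: "'d list \<Rightarrow> complex \<Rightarrow> 'd mat_tuple" where
  "chain_tuple w t k =
     mat (Suc (length w)) (Suc (length w)) (\<lambda>(i, j). if j = Suc i \<and> w ! i = k then t else 0)"

text \<open>The value of the series \<open>s\<close> at the chain tuple of \<open>w\<close>; the sum is finite because the tuple is nilpotent.\<close>

definition chain_mat :: "'d list \<Rightarrow> complex \<Rightarrow> 'd nc_series \<Rightarrow> complex mat" where
  "chain_mat w t s = mat (Suc (length w)) (Suc (length w))
     (\<lambda>(i, j). if i \<le> j then s (take (j - i) (drop i w)) * t ^ (j - i) else 0)"

lemma chain_mat_carrier: "chain_mat w t s \<in> carrier_mat (Suc (length w)) (Suc (length w))"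
  by (simp add: chain_mat_def)

lemma chain_tuple_mem: "chain_tuple w t \<in> mat_tuples (Suc (length w))"
  by (simp add: mat_tuples_def chain_tuple_def)

lemma chain_tuple_Nil: "chain_tuple [] t = (\<lambda>_. 0\<^sub>m 1 1)"
  by (auto simp: chain_tuple_def fun_eq_iff intro!: eq_matI)

lemma chain_tuple_eq: "chain_tuple w t k = chain_mat w t (unit_series [k])"
proof (rule eq_matI)
  fix i j assume "i < dim_row (chain_mat w t (unit_series [k]))" "j < dim_col (chain_mat w t (unit_series [k]))"
  then have ij: "i \<le> length w" "j \<le> length w" by (auto simp: chain_mat_def)
  have "take (j - i) (drop i w) = [k] \<longleftrightarrow> j = Suc i \<and> w ! i = k" if "i \<le> j"
  proof
    assume e: "take (j - i) (drop i w) = [k]"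
    then have "length (take (j - i) (drop i w)) = 1" by simp
    then have j: "j = Suc i" using ij that by simp
    then have "take (Suc 0) (drop i w) = [w ! i]" using ij by (simp add: take_Suc_conv_app_nth)
    then show "j = Suc i \<and> w ! i = k" using e j by simp
  next
    assume "j = Suc i \<and> w ! i = k"
    then show "take (j - i) (drop i w) = [k]" using ij by (auto simp: take_Suc_conv_app_nth)
  qed
  then show "chain_tuple w t k $$ (i, j) = chain_mat w t (unit_series [k]) $$ (i, j)"
    using ij by (auto simp: chain_tuple_def chain_mat_def unit_series_def)
qed (auto simp: chain_tuple_def chain_mat_def)

lemma chain_mat_one: "chain_mat w t (unit_series []) = 1\<^sub>m (Suc (length w))"
  by (rule eq_matI) (auto simp: chain_mat_def unit_series_def)

lemma chain_mat_add: "chain_mat w t (s + s') = chain_mat w t s + chain_mat w t s'"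
  by (rule eq_matI) (auto simp: chain_mat_def algebra_simps)

lemma chain_mat_scale: "chain_mat w t (series_scale c s) = c \<cdot>\<^sub>m chain_mat w t s"
  by (rule eq_matI) (auto simp: chain_mat_def series_scale_apply)

text \<open>The product of matrices sums over the position \<open>l\<close> between \<open>i\<close> and \<open>j\<close>, which cuts the factor of \<open>w\<close> from
  \<open>i\<close> to \<open>j\<close> in two, as does the Cauchy product.\<close>

lemma chain_mat_mult: "chain_mat w t (ser_mult s s') = chain_mat w t s * chain_mat w t s'"
proof (rule eq_matI)
  fix i j assume "i < dim_row (chain_mat w t s * chain_mat w t s')" "j < dim_col (chain_mat w t s * chain_mat w t s')"
  then have ij: "i \<le> length w" "j \<le> length w" by (auto simp: chain_mat_def)
  let ?a = "\<lambda>l. if i \<le> l then s (take (l - i) (drop i w)) * t ^ (l - i) else 0"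
  let ?b = "\<lambda>l. if l \<le> j then s' (take (j - l) (drop l w)) * t ^ (j - l) else 0"
  have prod: "(chain_mat w t s * chain_mat w t s') $$ (i, j) = (\<Sum>l = 0..<Suc (length w). ?a l * ?b l)"
    using ij by (auto simp: chain_mat_def scalar_prod_def)
  show "chain_mat w t (ser_mult s s') $$ (i, j) = (chain_mat w t s * chain_mat w t s') $$ (i, j)"
  proof (cases "i \<le> j")
    case True
    define v where "v = take (j - i) (drop i w)"
    have lv: "length v = j - i" using ij True by (simp add: v_def)
    have "(\<Sum>l = 0..<Suc (length w). ?a l * ?b l) = (\<Sum>l\<in>{i..j}. ?a l * ?b l)"
      using ij by (intro sum.mono_neutral_right) auto
    also have "\<dots> = (\<Sum>p\<le>j - i. ?a (i + p) * ?b (i + p))"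
      using True by (intro sum.reindex_bij_witness[of _ "\<lambda>p. i + p" "\<lambda>l. l - i"]) auto
    also have "\<dots> = (\<Sum>p\<le>j - i. s (take p v) * s' (drop p v) * t ^ (j - i))"
    proof (rule sum.cong)
      fix p assume "p \<in> {..j - i}"
      then have p: "p \<le> j - i" by simp
      have "t ^ p * t ^ (j - (i + p)) = t ^ (j - i)"
        using p True by (simp flip: power_add)
      moreover have "take p v = take p (drop i w)" using p by (simp add: v_def min_def)
      moreover have "drop p v = take (j - (i + p)) (drop (i + p) w)"
        by (simp add: v_def drop_take add.commute)
      ultimately show "?a (i + p) * ?b (i + p) = s (take p v) * s' (drop p v) * t ^ (j - i)"
        using p True by (simp add: mult.assoc mult.left_commute)
    qed simp
    also have "\<dots> = ser_mult s s' v * t ^ (j - i)"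
      by (simp add: ser_mult_def lv sum_distrib_right)
    finally show ?thesis using prod ij True by (simp add: chain_mat_def v_def)
  next
    case False
    then have "(\<Sum>l = 0..<Suc (length w). ?a l * ?b l) = 0" by (intro sum.neutral) auto
    then show ?thesis using prod ij False by (simp add: chain_mat_def)
  qed
qed (auto simp: chain_mat_def)

lemma word_eval_chain: "word_eval (Suc (length w)) (chain_tuple w t) \<beta> = chain_mat w t (unit_series \<beta>)"
proof (induction \<beta>)
  case Nil
  show ?case by (simp add: word_eval_Nil chain_mat_one)
next
  case (Cons k \<beta>)
  have "ser_mult (unit_series [k]) (unit_series \<beta>) = unit_series (k # \<beta>)"
  proof
    fix \<gamma> :: "'a list"
    have "(\<Sum>i\<le>length \<gamma>. unit_series [k] (take i \<gamma>) * unit_series \<beta> (drop i \<gamma>))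
        = (\<Sum>i\<in>(if \<gamma> = k # \<beta> then {1::nat} else {}). 1)"
    proof (rule sum.mono_neutral_cong_right)
      show "\<forall>i\<in>{..length \<gamma>} - (if \<gamma> = k # \<beta> then {1::nat} else {}).
          unit_series [k] (take i \<gamma>) * unit_series \<beta> (drop i \<gamma>) = 0"
      proof
        fix i assume i: "i \<in> {..length \<gamma>} - (if \<gamma> = k # \<beta> then {1::nat} else {})"
        show "unit_series [k] (take i \<gamma>) * unit_series \<beta> (drop i \<gamma>) = 0"
        proof (rule ccontr)
          assume "\<not> ?thesis"
          then have e: "take i \<gamma> = [k]" "drop i \<gamma> = \<beta>" by (auto simp: unit_series_def split: if_splits)
          then have "\<gamma> = k # \<beta>" using append_take_drop_id[of i \<gamma>] by simp
          moreover have "i = 1" using arg_cong[OF e(1), of length] i by auto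
          ultimately show False using i by simp
        qed
      qed
      show "(if \<gamma> = k # \<beta> then {1::nat} else {}) \<subseteq> {..length \<gamma>}" by simp
      fix i assume "i \<in> (if \<gamma> = k # \<beta> then {1::nat} else {})"
      then have "\<gamma> = k # \<beta>" "i = 1" by (simp_all split: if_splits)
      then show "unit_series [k] (take i \<gamma>) * unit_series \<beta> (drop i \<gamma>) = 1"
        by (simp add: unit_series_def)
    qed simp
    then show "ser_mult (unit_series [k]) (unit_series \<beta>) \<gamma> = unit_series (k # \<beta>) \<gamma>"
      by (simp add: ser_mult_def unit_series_def)
  qed
  then show ?case
    using Cons chain_mat_mult[of w t "unit_series [k]" "unit_series \<beta>"]
    by (simp add: word_eval_Cons chain_tuple_eq)
qed

text \<open>An inverse is evaluable at the zero tuple only if the constant coefficient of the series of its argument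
  is nonzero. Then the left inverse series exists and is recognizable.\<close>

lemma nc_eval_chain:
  assumes "nc_eval 1 (\<lambda>_. 0\<^sub>m 1 1) e = Some A"
  shows "\<exists>s. recognizable s \<and> (\<forall>w t. nc_eval (Suc (length w)) (chain_tuple w t) e = Some (chain_mat w t s))"
  using assms
proof (induction e arbitrary: A)
  case (Var k)
  show ?case by (rule exI[of _ "unit_series [k]"]) (simp add: recognizable_letter chain_tuple_eq)
next
  case (Const c)
  show ?case
    by (rule exI[of _ "series_scale c (unit_series [])"])
       (simp add: recognizable_scale recognizable_one chain_mat_scale chain_mat_one)
next
  case (Add a b)
  from Add.prems obtain A1 A2 where "nc_eval 1 (\<lambda>_. 0\<^sub>m 1 1) a = Some A1" "nc_eval 1 (\<lambda>_. 0\<^sub>m 1 1) b = Some A2"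
    by (auto simp: bind_eq_Some_conv)
  from Add.IH(1)[OF this(1)] Add.IH(2)[OF this(2)] obtain s1 s2 where
    "recognizable s1" "\<And>w t. nc_eval (Suc (length w)) (chain_tuple w t) a = Some (chain_mat w t s1)"
    "recognizable s2" "\<And>w t. nc_eval (Suc (length w)) (chain_tuple w t) b = Some (chain_mat w t s2)" by metis
  then show ?case by (intro exI[of _ "s1 + s2"]) (simp add: recognizable_add chain_mat_add del: plus_fun_apply)
next
  case (Mul a b)
  from Mul.prems obtain A1 A2 where "nc_eval 1 (\<lambda>_. 0\<^sub>m 1 1) a = Some A1" "nc_eval 1 (\<lambda>_. 0\<^sub>m 1 1) b = Some A2"
    by (auto simp: bind_eq_Some_conv)
  from Mul.IH(1)[OF this(1)] Mul.IH(2)[OF this(2)] obtain s1 s2 where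
    "recognizable s1" "\<And>w t. nc_eval (Suc (length w)) (chain_tuple w t) a = Some (chain_mat w t s1)"
    "recognizable s2" "\<And>w t. nc_eval (Suc (length w)) (chain_tuple w t) b = Some (chain_mat w t s2)" by metis
  then show ?case by (intro exI[of _ "ser_mult s1 s2"]) (simp add: recognizable_mult chain_mat_mult)
next
  case (Inv a)
  from Inv.prems obtain A1 where A1: "nc_eval 1 (\<lambda>_. 0\<^sub>m 1 1) a = Some A1" "mat_inverse A1 = Some A"
    by (auto simp: bind_eq_Some_conv)
  from Inv.IH[OF A1(1)] obtain s where s: "recognizable s"
    "\<And>w t. nc_eval (Suc (length w)) (chain_tuple w t) a = Some (chain_mat w t s)" by metis
  have "A1 = chain_mat [] 1 s" using s(2)[of "[]" 1] A1(1) by (simp add: chain_tuple_Nil)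
  then have A1c: "A1 \<in> carrier_mat 1 1" "A1 $$ (0, 0) = s []"
    using chain_mat_carrier[of "[]" 1 s] by (auto simp: chain_mat_def)
  have s0: "s [] \<noteq> 0"
  proof
    assume "s [] = 0"
    have A: "A \<in> carrier_mat 1 1" "A1 * A = 1\<^sub>m 1"
      using A1(2) mat_inverse_eq_Some_iff[OF A1c(1), of A] by auto
    have "(A1 * A) $$ (0, 0) = A1 $$ (0, 0) * A $$ (0, 0)"
      using A1c(1) A(1) by (simp add: scalar_prod_def)
    then show False using A(2) A1c(2) \<open>s [] = 0\<close> by simp
  qed
  have "mat_inverse (chain_mat w t s) = Some (chain_mat w t (left_inverse s))" for w t
  proof -
    have "chain_mat w t (left_inverse s) * chain_mat w t s = 1\<^sub>m (Suc (length w))"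
      unfolding chain_mat_mult[symmetric] left_inverse[of s, OF s0] chain_mat_one ..
    with mat_mult_left_right_inverse[OF chain_mat_carrier chain_mat_carrier this] show ?thesis
      by (subst mat_inverse_eq_Some_iff[OF chain_mat_carrier]) (simp add: chain_mat_carrier)
  qed
  then show ?case using s recognizable_left_inverse[OF s(1) s0]
    by (intro exI[of _ "left_inverse s"]) simp
qed

section \<open>Equivalent expressions agree where both are defined\<close>

lemma nc_eval_carrier:
  assumes X: "X \<in> mat_tuples n"
  shows "nc_eval n X e = Some A \<Longrightarrow> A \<in> carrier_mat n n"
proof (induction e arbitrary: A)
  case (Var k)
  then show ?case using X by (simp add: mat_tuples_def) blast
next
  case (Const c)
  then show ?case by auto
next
  case (Add a b)
  then obtain B C where "nc_eval n X a = Some B" "nc_eval n X b = Some C" "A = B + C"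
    by (auto simp: bind_eq_Some_conv)
  then show ?case using Add.IH by simp
next
  case (Mul a b)
  then obtain B C where "nc_eval n X a = Some B" "nc_eval n X b = Some C" "A = B * C"
    by (auto simp: bind_eq_Some_conv)
  then show ?case using Mul.IH by (simp add: mult_carrier_mat[of B n n C n])
next
  case (Inv a)
  from Inv.prems obtain B where "nc_eval n X a = Some B" "mat_inverse B = Some A"
    by (auto simp: bind_eq_Some_conv)
  then show ?case using Inv.IH mat_inverse_eq_Some_iff by blast
qed

text \<open>Repeating a point along the diagonal moves it to a multiple of its size, where the domains of other
  expressions can be met.\<close>

primrec diag_copies :: "nat \<Rightarrow> nat \<Rightarrow> complex mat \<Rightarrow> complex mat" where
  "diag_copies n 0 A = 0\<^sub>m 0 0"
| "diag_copies n (Suc m) A = four_block_mat A (0\<^sub>m n (m * n)) (0\<^sub>m (m * n) n) (diag_copies n m A)"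

lemma diag_copies_carrier: "A \<in> carrier_mat n n \<Longrightarrow> diag_copies n m A \<in> carrier_mat (m * n) (m * n)"
  by (induction m) auto

lemma diag_copies_mult:
  assumes "A \<in> carrier_mat n n" "B \<in> carrier_mat n n"
  shows "diag_copies n m (A * B) = diag_copies n m A * diag_copies n m B"
proof (induction m)
  case (Suc m)
  note c = diag_copies_carrier[OF assms(1), of m] diag_copies_carrier[OF assms(2), of m]
  show ?case using assms c Suc
    by (simp add: mult_four_block_mat[of A n n "0\<^sub>m n (m * n)" "m * n" "0\<^sub>m (m * n) n" "m * n" "diag_copies n m A"
          B n "0\<^sub>m n (m * n)" "m * n" "0\<^sub>m (m * n) n" "diag_copies n m B"])
qed simp

lemma diag_copies_add:
  assumes "A \<in> carrier_mat n n" "B \<in> carrier_mat n n"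
  shows "diag_copies n m (A + B) = diag_copies n m A + diag_copies n m B"
proof (induction m)
  case (Suc m)
  note c = diag_copies_carrier[OF assms(1), of m] diag_copies_carrier[OF assms(2), of m]
  show ?case using assms c Suc
    by (simp add: add_four_block_mat[of A n n "0\<^sub>m n (m * n)" "m * n" "0\<^sub>m (m * n) n" "m * n" "diag_copies n m A"
          B "0\<^sub>m n (m * n)" "0\<^sub>m (m * n) n" "diag_copies n m B"])
qed simp

lemma diag_copies_scalar: "diag_copies n m (c \<cdot>\<^sub>m 1\<^sub>m n) = c \<cdot>\<^sub>m 1\<^sub>m (m * n)"
  by (induction m) (auto intro!: eq_matI)

lemma diag_copies_inj:
  assumes "A \<in> carrier_mat n n" "B \<in> carrier_mat n n" "diag_copies n (Suc m) A = diag_copies n (Suc m) B"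
  shows "A = B"
proof (rule eq_matI)
  fix i j assume ij: "i < dim_row B" "j < dim_col B"
  have "diag_copies n (Suc m) A $$ (i, j) = diag_copies n (Suc m) B $$ (i, j)" using assms(3) by (rule arg_cong)
  then show "A $$ (i, j) = B $$ (i, j)"
    using ij assms(1,2) diag_copies_carrier[OF assms(1), of m] diag_copies_carrier[OF assms(2), of m] by auto
qed (use assms in auto)

lemma nc_eval_diag_copies:
  assumes X: "X \<in> mat_tuples n"
  shows "nc_eval n X e = Some A \<Longrightarrow> nc_eval (m * n) (\<lambda>k. diag_copies n m (X k)) e = Some (diag_copies n m A)"
proof (induction e arbitrary: A)
  case (Add a b)
  then obtain A1 A2 where "nc_eval n X a = Some A1" "nc_eval n X b = Some A2" "A = A1 + A2"
    by (auto simp: bind_eq_Some_conv)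
  then show ?case using Add.IH nc_eval_carrier[OF X] by (simp add: diag_copies_add)
next
  case (Mul a b)
  then obtain A1 A2 where "nc_eval n X a = Some A1" "nc_eval n X b = Some A2" "A = A1 * A2"
    by (auto simp: bind_eq_Some_conv)
  then show ?case using Mul.IH nc_eval_carrier[OF X] by (simp add: diag_copies_mult)
next
  case (Inv a)
  then obtain B where B: "nc_eval n X a = Some B" "mat_inverse B = Some A"
    by (auto simp: bind_eq_Some_conv)
  have Bc: "B \<in> carrier_mat n n" by (rule nc_eval_carrier[OF X B(1)])
  have A: "A \<in> carrier_mat n n" "B * A = 1\<^sub>m n" "A * B = 1\<^sub>m n"
    using B(2) mat_inverse_eq_Some_iff[OF Bc] by auto
  have one: "diag_copies n m (1\<^sub>m n) = 1\<^sub>m (m * n)"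
  proof -
    have "1 \<cdot>\<^sub>m B = B" for B :: "complex mat" by (rule eq_matI) auto
    then show ?thesis using diag_copies_scalar[of n m 1] by metis
  qed
  have "mat_inverse (diag_copies n m B) = Some (diag_copies n m A)"
    by (subst mat_inverse_eq_Some_iff[OF diag_copies_carrier[OF Bc]])
       (simp add: diag_copies_carrier[OF A(1)] diag_copies_mult[symmetric] A Bc one)
  then show ?case using Inv.IH[OF B(1)] by simp
qed (auto simp: diag_copies_scalar)

abbreviation poly_mat_at :: "complex \<Rightarrow> complex poly mat \<Rightarrow> complex mat" where
  "poly_mat_at t \<equiv> map_mat (\<lambda>p. poly p t)"

lemma poly_eval_hom: "comm_ring_hom (\<lambda>p. poly p (t :: complex))"
  by unfold_locales auto

lemma poly_eval_semiring_hom: "semiring_hom (\<lambda>p. poly p (t :: complex))"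
  by unfold_locales auto

lemma poly_mat_at_mult:
  "A \<in> carrier_mat n n \<Longrightarrow> B \<in> carrier_mat n n \<Longrightarrow>
   poly_mat_at t (A * B) = poly_mat_at t A * poly_mat_at t B"
  using semiring_hom.mat_hom_mult[OF poly_eval_semiring_hom] by blast

lemma det_poly_mat_at: "det (poly_mat_at t A) = poly (det A) t"
  by (rule comm_ring_hom.hom_det[OF poly_eval_hom])

text \<open>Along a polynomial path of tuples, an expression that can be evaluated at one parameter \<open>u\<close> is a
  quotient of a polynomial matrix by a scalar polynomial that does not vanish at \<open>u\<close>. Inverses are
  handled by Cramer's rule.\<close>

lemma nc_eval_poly_path:
  fixes L :: "'d \<Rightarrow> complex poly mat"
  assumes L: "\<And>k. L k \<in> carrier_mat N N"
  shows "nc_eval N (\<lambda>k. poly_mat_at u (L k)) e \<noteq> None \<Longrightarrow>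
    \<exists>P q. P \<in> carrier_mat N N \<and> poly q u \<noteq> 0 \<and>
      (\<forall>t. poly q t \<noteq> 0 \<longrightarrow> nc_eval N (\<lambda>k. poly_mat_at t (L k)) e = Some ((1 / poly q t) \<cdot>\<^sub>m poly_mat_at t P))"
proof (induction e)
  case (Var k)
  show ?case by (rule exI[of _ "L k"], rule exI[of _ 1]) (use L in \<open>auto intro!: eq_matI\<close>)
next
  case (Const c)
  show ?case
    by (rule exI[of _ "[:c:] \<cdot>\<^sub>m 1\<^sub>m N"], rule exI[of _ 1]) (auto intro!: eq_matI)
next
  case (Add a b)
  then have "nc_eval N (\<lambda>k. poly_mat_at u (L k)) a \<noteq> None" "nc_eval N (\<lambda>k. poly_mat_at u (L k)) b \<noteq> None"
    by (auto simp: bind_eq_Some_conv)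
  with Add.IH obtain P1 q1 P2 q2 where
    1: "P1 \<in> carrier_mat N N" "poly q1 u \<noteq> 0"
       "\<And>t. poly q1 t \<noteq> 0 \<Longrightarrow> nc_eval N (\<lambda>k. poly_mat_at t (L k)) a = Some ((1 / poly q1 t) \<cdot>\<^sub>m poly_mat_at t P1)" and
    2: "P2 \<in> carrier_mat N N" "poly q2 u \<noteq> 0"
       "\<And>t. poly q2 t \<noteq> 0 \<Longrightarrow> nc_eval N (\<lambda>k. poly_mat_at t (L k)) b = Some ((1 / poly q2 t) \<cdot>\<^sub>m poly_mat_at t P2)"
    by blast
  show ?case
  proof (rule exI[of _ "q2 \<cdot>\<^sub>m P1 + q1 \<cdot>\<^sub>m P2"], rule exI[of _ "q1 * q2"], intro conjI allI impI)
    fix t assume "poly (q1 * q2) t \<noteq> 0"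
    then have q: "poly q1 t \<noteq> 0" "poly q2 t \<noteq> 0" by auto
    have "(1 / poly q1 t) \<cdot>\<^sub>m poly_mat_at t P1 + (1 / poly q2 t) \<cdot>\<^sub>m poly_mat_at t P2
        = (1 / poly (q1 * q2) t) \<cdot>\<^sub>m poly_mat_at t (q2 \<cdot>\<^sub>m P1 + q1 \<cdot>\<^sub>m P2)"
      by (rule eq_matI) (use 1(1) 2(1) q in \<open>auto simp: field_simps\<close>)
    then show "nc_eval N (\<lambda>k. poly_mat_at t (L k)) (Add a b)
        = Some ((1 / poly (q1 * q2) t) \<cdot>\<^sub>m poly_mat_at t (q2 \<cdot>\<^sub>m P1 + q1 \<cdot>\<^sub>m P2))"
      using 1(3)[OF q(1)] 2(3)[OF q(2)] by simp
  qed (use 1 2 in auto)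
next
  case (Mul a b)
  then have "nc_eval N (\<lambda>k. poly_mat_at u (L k)) a \<noteq> None" "nc_eval N (\<lambda>k. poly_mat_at u (L k)) b \<noteq> None"
    by (auto simp: bind_eq_Some_conv)
  with Mul.IH obtain P1 q1 P2 q2 where
    1: "P1 \<in> carrier_mat N N" "poly q1 u \<noteq> 0"
       "\<And>t. poly q1 t \<noteq> 0 \<Longrightarrow> nc_eval N (\<lambda>k. poly_mat_at t (L k)) a = Some ((1 / poly q1 t) \<cdot>\<^sub>m poly_mat_at t P1)" and
    2: "P2 \<in> carrier_mat N N" "poly q2 u \<noteq> 0"
       "\<And>t. poly q2 t \<noteq> 0 \<Longrightarrow> nc_eval N (\<lambda>k. poly_mat_at t (L k)) b = Some ((1 / poly q2 t) \<cdot>\<^sub>m poly_mat_at t P2)"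
    by blast
  show ?case
  proof (rule exI[of _ "P1 * P2"], rule exI[of _ "q1 * q2"], intro conjI allI impI)
    fix t assume "poly (q1 * q2) t \<noteq> 0"
    then have q: "poly q1 t \<noteq> 0" "poly q2 t \<noteq> 0" by auto
    have "((1 / poly q1 t) \<cdot>\<^sub>m poly_mat_at t P1) * ((1 / poly q2 t) \<cdot>\<^sub>m poly_mat_at t P2)
        = (1 / poly (q1 * q2) t) \<cdot>\<^sub>m (poly_mat_at t P1 * poly_mat_at t P2)"
      by (rule eq_matI) (use 1(1) 2(1) in \<open>auto\<close>)
    then show "nc_eval N (\<lambda>k. poly_mat_at t (L k)) (Mul a b)
        = Some ((1 / poly (q1 * q2) t) \<cdot>\<^sub>m poly_mat_at t (P1 * P2))"
      using 1(3)[OF q(1)] 2(3)[OF q(2)] by (simp add: poly_mat_at_mult[OF 1(1) 2(1)])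
  qed (use 1 2 in \<open>auto intro: mult_carrier_mat\<close>)
next
  case (Inv a)
  then have "nc_eval N (\<lambda>k. poly_mat_at u (L k)) a \<noteq> None" by (auto simp: bind_eq_Some_conv)
  with Inv.IH obtain P q where
    1: "P \<in> carrier_mat N N" "poly q u \<noteq> 0"
       "\<And>t. poly q t \<noteq> 0 \<Longrightarrow> nc_eval N (\<lambda>k. poly_mat_at t (L k)) a = Some ((1 / poly q t) \<cdot>\<^sub>m poly_mat_at t P)"
    by blast
  define d where "d = det P"
  have Pc: "poly_mat_at t P \<in> carrier_mat N N" for t using 1 by simp
  have adj: "adj_mat P \<in> carrier_mat N N" "P * adj_mat P = d \<cdot>\<^sub>m 1\<^sub>m N"
    using adj_mat[OF 1(1)] by (auto simp: d_def)
  have "poly d u \<noteq> 0"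
  proof
    assume d0: "poly d u = 0"
    let ?A = "(1 / poly q u) \<cdot>\<^sub>m poly_mat_at u P"
    have Ac: "?A \<in> carrier_mat N N" using Pc by simp
    have "mat_inverse ?A \<noteq> None" using Inv.prems 1(3)[OF 1(2)] by simp
    then obtain B where B: "B \<in> carrier_mat N N" "?A * B = 1\<^sub>m N"
      using mat_inverse_eq_Some_iff[OF Ac] by blast
    have "det ?A * det B = 1" using det_mult[OF Ac B(1)] B(2) by simp
    moreover have "det ?A = 0" using d0 by (simp add: det_smult det_poly_mat_at d_def)
    ultimately show False by (metis mult_zero_left zero_neq_one)
  qed
  show ?case
  proof (rule exI[of _ "(q * q) \<cdot>\<^sub>m adj_mat P"], rule exI[of _ "q * d"], intro conjI allI impI)
    show "poly (q * d) u \<noteq> 0" using \<open>poly d u \<noteq> 0\<close> 1(2) by simp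
    fix t assume "poly (q * d) t \<noteq> 0"
    then have q: "poly q t \<noteq> 0" "poly d t \<noteq> 0" by auto
    let ?A = "(1 / poly q t) \<cdot>\<^sub>m poly_mat_at t P" and
      ?B = "(1 / poly (q * d) t) \<cdot>\<^sub>m poly_mat_at t ((q * q) \<cdot>\<^sub>m adj_mat P)"
    have c: "?A \<in> carrier_mat N N" "?B \<in> carrier_mat N N" using Pc adj by auto
    have Bq: "?B = (poly q t / poly d t) \<cdot>\<^sub>m poly_mat_at t (adj_mat P)"
      by (rule eq_matI) (use q in auto)
    have adjc: "poly_mat_at t (adj_mat P) \<in> carrier_mat N N" using adj by simp
    have "?A * ?B = (1 / poly d t) \<cdot>\<^sub>m (poly_mat_at t P * poly_mat_at t (adj_mat P))"
      unfolding Bq by (rule eq_matI) (use Pc[of t] adjc q in auto)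
    also have "\<dots> = (1 / poly d t) \<cdot>\<^sub>m poly_mat_at t (d \<cdot>\<^sub>m 1\<^sub>m N)"
      by (simp only: poly_mat_at_mult[OF 1(1) adj(1), symmetric] adj(2))
    also have "\<dots> = 1\<^sub>m N" by (rule eq_matI) (use q in auto)
    finally have AB: "?A * ?B = 1\<^sub>m N" .
    have "mat_inverse ?A = Some ?B"
      using AB mat_mult_left_right_inverse[OF c AB] c by (subst mat_inverse_eq_Some_iff[OF c(1)]) blast
    then show "nc_eval N (\<lambda>k. poly_mat_at t (L k)) (Inv a) = Some ?B" using 1(3)[OF q(1)] by simp
  qed (use adj in auto)
qed

text \<open>Two expressions equivalent to \<open>x\<close> need not meet the domain of \<open>x\<close> at the size of a common point
  \<open>X\<close>. Enough copies of \<open>X\<close> bring it to a size at which \<open>x\<close> can be evaluated; on the line through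
  it and such a point all three expressions are defined for almost every parameter, and agree.\<close>

lemma nc_equiv_agree:
  assumes xe: "(x, e) \<in> nc_equiv" and xe': "(x, e') \<in> nc_equiv"
    and X: "(n, X) \<in> nc_dom e" "(n, X) \<in> nc_dom e'"
  shows "nc_eval n X e = nc_eval n X e'"
proof -
  obtain m Y where Y: "(m, Y) \<in> nc_dom x" using xe by (auto simp: nc_equiv_def valid_exprs_def)
  have n: "n \<ge> 1" "X \<in> mat_tuples n" and m: "m \<ge> 1" "Y \<in> mat_tuples m" using X Y by (auto simp: nc_dom_def)
  obtain A A' where A: "nc_eval n X e = Some A" and A': "nc_eval n X e' = Some A'"
    using X by (auto simp: nc_dom_def)
  obtain C where C: "nc_eval m Y x = Some C" using Y by (auto simp: nc_dom_def)
  define N where "N = m * n"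
  have N: "N \<ge> 1" using n m by (simp add: N_def)
  define X' where "X' k = diag_copies n m (X k)" for k
  define Y' where "Y' k = diag_copies m n (Y k)" for k
  have X'c: "X' k \<in> carrier_mat N N" for k
    using n(2) unfolding X'_def N_def by (intro diag_copies_carrier) (simp add: mat_tuples_def)
  have Y'c: "Y' k \<in> carrier_mat N N" for k
    using m(2) diag_copies_carrier[of "Y k" m n] unfolding Y'_def N_def by (simp add: mat_tuples_def mult.commute)
  define L where "L k = mat N N (\<lambda>ij. [:X' k $$ ij, Y' k $$ ij - X' k $$ ij:])" for k
  have Lc: "L k \<in> carrier_mat N N" for k by (simp add: L_def)
  have L0: "poly_mat_at 0 (L k) = X' k" for k
    by (rule eq_matI) (use X'c[of k] in \<open>auto simp: L_def\<close>)
  have L1: "poly_mat_at 1 (L k) = Y' k" for k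
    by (rule eq_matI) (use Y'c[of k] in \<open>auto simp: L_def\<close>)
  have e0: "nc_eval N (\<lambda>k. poly_mat_at 0 (L k)) e = Some (diag_copies n m A)"
    "nc_eval N (\<lambda>k. poly_mat_at 0 (L k)) e' = Some (diag_copies n m A')"
    unfolding L0 X'_def N_def using nc_eval_diag_copies[OF n(2)] A A' by auto
  have "nc_eval N (\<lambda>k. poly_mat_at 1 (L k)) x \<noteq> None"
    using nc_eval_diag_copies[OF m(2) C, of n] unfolding L1 Y'_def N_def by (simp add: mult.commute)
  from nc_eval_poly_path[OF Lc this] obtain P0 q0 where
    x: "poly q0 1 \<noteq> 0" "\<And>t. poly q0 t \<noteq> 0 \<Longrightarrow> nc_eval N (\<lambda>k. poly_mat_at t (L k)) x \<noteq> None" by auto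
  obtain P1 q1 where 1: "P1 \<in> carrier_mat N N" "poly q1 0 \<noteq> 0"
    "\<And>t. poly q1 t \<noteq> 0 \<Longrightarrow> nc_eval N (\<lambda>k. poly_mat_at t (L k)) e = Some ((1 / poly q1 t) \<cdot>\<^sub>m poly_mat_at t P1)"
    using nc_eval_poly_path[where L = L and u = 0 and e = e, OF Lc] e0 by auto
  obtain P2 q2 where 2: "P2 \<in> carrier_mat N N" "poly q2 0 \<noteq> 0"
    "\<And>t. poly q2 t \<noteq> 0 \<Longrightarrow> nc_eval N (\<lambda>k. poly_mat_at t (L k)) e' = Some ((1 / poly q2 t) \<cdot>\<^sub>m poly_mat_at t P2)"
    using nc_eval_poly_path[where L = L and u = 0 and e = e', OF Lc] e0 by auto
  have agree: "(1 / poly q1 t) \<cdot>\<^sub>m poly_mat_at t P1 = (1 / poly q2 t) \<cdot>\<^sub>m poly_mat_at t P2"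
    if q: "poly q0 t \<noteq> 0" "poly q1 t \<noteq> 0" "poly q2 t \<noteq> 0" for t
  proof -
    let ?Z = "\<lambda>k. poly_mat_at t (L k)"
    have Z: "?Z \<in> mat_tuples N" using Lc by (simp add: mat_tuples_def)
    have dom: "(N, ?Z) \<in> nc_dom x" "(N, ?Z) \<in> nc_dom e" "(N, ?Z) \<in> nc_dom e'"
      using x(2)[OF q(1)] 1(3)[OF q(2)] 2(3)[OF q(3)] Z N by (auto simp: nc_dom_def)
    have "nc_eval N ?Z x = nc_eval N ?Z e" "nc_eval N ?Z x = nc_eval N ?Z e'"
      using xe xe' dom by (auto simp: nc_equiv_def)
    then show ?thesis using 1(3)[OF q(2)] 2(3)[OF q(3)] by simp
  qed
  have entry: "P1 $$ (i, j) * q2 = P2 $$ (i, j) * q1" if ij: "i < N" "j < N" for i j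
  proof -
    let ?D = "P1 $$ (i, j) * q2 - P2 $$ (i, j) * q1"
    have "poly (?D * (q0 * q1 * q2)) t = 0" for t
    proof (cases "poly q0 t \<noteq> 0 \<and> poly q1 t \<noteq> 0 \<and> poly q2 t \<noteq> 0")
      case True
      then have "((1 / poly q1 t) \<cdot>\<^sub>m poly_mat_at t P1) $$ (i, j) = ((1 / poly q2 t) \<cdot>\<^sub>m poly_mat_at t P2) $$ (i, j)"
        using agree by simp
      then have "poly (P1 $$ (i, j)) t / poly q1 t = poly (P2 $$ (i, j)) t / poly q2 t"
        using ij 1(1) 2(1) by simp
      then show ?thesis using True by (simp add: field_simps)
    qed auto
    then have "?D * (q0 * q1 * q2) = 0" using poly_all_0_iff_0 by blast
    moreover have "q0 \<noteq> 0" "q1 \<noteq> 0" "q2 \<noteq> 0" using x(1) 1(2) 2(2) by auto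
    ultimately show ?thesis by simp
  qed
  have "diag_copies n m A = diag_copies n m A'"
  proof -
    have "diag_copies n m A = (1 / poly q1 0) \<cdot>\<^sub>m poly_mat_at 0 P1" using e0(1) 1(3)[OF 1(2)] by simp
    also have "\<dots> = (1 / poly q2 0) \<cdot>\<^sub>m poly_mat_at 0 P2"
    proof (rule eq_matI)
      fix i j assume "i < dim_row ((1 / poly q2 0) \<cdot>\<^sub>m poly_mat_at 0 P2)" "j < dim_col ((1 / poly q2 0) \<cdot>\<^sub>m poly_mat_at 0 P2)"
      then have ij: "i < N" "j < N" using 2(1) by auto
      have "poly (P1 $$ (i, j) * q2) 0 = poly (P2 $$ (i, j) * q1) 0" by (simp only: entry[OF ij])
      then show "((1 / poly q1 0) \<cdot>\<^sub>m poly_mat_at 0 P1) $$ (i, j) = ((1 / poly q2 0) \<cdot>\<^sub>m poly_mat_at 0 P2) $$ (i, j)"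
        using ij 1(1,2) 2(1,2) by (simp add: field_simps)
    qed (use 1(1) 2(1) in auto)
    also have "\<dots> = diag_copies n m A'" using e0(2) 2(3)[OF 2(2)] by simp
    finally show ?thesis .
  qed
  moreover obtain m' where "m = Suc m'" using m(1) by (cases m) auto
  ultimately have "A = A'"
    using diag_copies_inj[of A n A' m'] nc_eval_carrier[OF n(2) A] nc_eval_carrier[OF n(2) A'] by simp
  then show ?thesis using A A' by simp
qed

section \<open>The power series of a rational function is recognizable\<close>

text \<open>The components map a row vector to pieces of its shift with disjoint supports, scaled by \<open>t\<close>. The bound
  brings chain tuples into any neighbourhood of \<open>0\<close>.\<close>

lemma row_norm_chain_tuple:
  fixes w :: "('d::finite) list"
  shows "row_norm (Suc (length w)) (chain_tuple w t) \<le> cmod t"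
proof -
  let ?n = "Suc (length w)"
  have "row_norm ?n (chain_tuple w t) \<le> sqrt ((cmod t)\<^sup>2)"
  proof (rule row_norm_le[OF chain_tuple_mem])
    fix y
    have ent: "row_times ?n y (chain_tuple w t k) j = (if j \<noteq> 0 \<and> w ! (j - 1) = k then y (j - 1) * t else 0)"
      if "j < ?n" for k j
    proof -
      have "row_times ?n y (chain_tuple w t k) j
          = (\<Sum>i<?n. if i = j - 1 then (if j \<noteq> 0 \<and> w ! (j - 1) = k then y (j - 1) * t else 0) else 0)"
        unfolding row_times_def using that by (intro sum.cong) (auto simp: chain_tuple_def)
      then show ?thesis using that by (simp add: less_imp_diff_less del: sum.lessThan_Suc)
    qed
    have "(\<Sum>k\<in>UNIV. sq_norm ?n (row_times ?n y (chain_tuple w t k)))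
        = (\<Sum>k\<in>UNIV. \<Sum>j<?n. if w ! (j - 1) = k then (if j \<noteq> 0 then (cmod (y (j - 1) * t))\<^sup>2 else 0) else 0)"
      unfolding sq_norm_def by (intro sum.cong) (auto simp: ent)
    also have "\<dots> = (\<Sum>j<?n. \<Sum>k\<in>UNIV. if w ! (j - 1) = k then (if j \<noteq> 0 then (cmod (y (j - 1) * t))\<^sup>2 else 0) else 0)"
      by (rule sum.swap)
    also have "\<dots> = (\<Sum>j<?n. if j \<noteq> 0 then (cmod (y (j - 1) * t))\<^sup>2 else 0)" by simp
    also have "\<dots> = (\<Sum>j<length w. (cmod (y j * t))\<^sup>2)"
      by (subst sum.lessThan_Suc_shift) simp
    also have "\<dots> \<le> (\<Sum>j<?n. (cmod (y j * t))\<^sup>2)" by simp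
    also have "\<dots> = (cmod t)\<^sup>2 * sq_norm ?n y"
      by (simp only: sq_norm_def norm_mult power_mult_distrib sum_distrib_left mult.commute)
    finally show "(\<Sum>k\<in>UNIV. sq_norm ?n (row_times ?n y (chain_tuple w t k))) \<le> (cmod t)\<^sup>2 * sq_norm ?n y" .
  qed simp
  then show ?thesis by simp
qed

lemma homog_entry_chain:
  fixes f :: "('d::finite) nc_series"
  shows "homog_entry f (Suc (length w)) (chain_tuple w t) (0, length w) k
    = (if k = length w then f w * t ^ length w else 0)"
proof -
  have fin: "finite {\<alpha> :: 'd list. length \<alpha> = k}"
    using finite_lists_length_eq[of "UNIV :: 'd set" k] by simp
  have "homog_entry f (Suc (length w)) (chain_tuple w t) (0, length w) k
      = (\<Sum>\<alpha> | length \<alpha> = k. if \<alpha> = w then f w * t ^ length w else 0)"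
    unfolding homog_entry_def word_eval_chain
    by (intro sum.cong) (auto simp: chain_mat_def unit_series_def)
  then show ?thesis using fin by simp
qed

text \<open>At a small chain tuple of \<open>w\<close>, the corner entry of the value is the coefficient at \<open>w\<close> times a nonzero
  power of \<open>t\<close>, both for \<open>f\<close> and for the recognizable series of an expression that is regular at \<open>0\<close>.\<close>

lemma power_series_recognizable:
  fixes f :: "('d::finite) nc_series"
  assumes r: "r \<in> nc_rational_functions" and r0: "regular_at_0 r" and ps: "power_series_at_0 r f"
  shows "recognizable f"
proof -
  obtain x where x: "r = nc_equiv `` {x}" using r by (auto simp: nc_rational_functions_def elim: quotientE)
  obtain e where e: "e \<in> r" "(1, \<lambda>_. 0\<^sub>m 1 1) \<in> nc_dom e" using r0 by (auto simp: regular_at_0_def rat_Dom_def)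
  then obtain A0 where "nc_eval 1 (\<lambda>_. 0\<^sub>m 1 1) e = Some A0" by (auto simp: nc_dom_def)
  from nc_eval_chain[OF this] obtain s where s: "recognizable s"
    "\<And>w t. nc_eval (Suc (length w)) (chain_tuple w t) e = Some (chain_mat w t s)" by blast
  have "f w = s w" for w
  proof -
    let ?n = "Suc (length w)"
    obtain \<delta> where \<delta>: "\<delta> > 0" "\<And>X. X \<in> mat_tuples ?n \<Longrightarrow> row_norm ?n X < \<delta> \<Longrightarrow>
        (\<forall>i<?n. \<forall>j<?n. homog_entry f ?n X (i, j) sums (rat_eval r ?n X $$ (i, j)))"
      using ps unfolding power_series_at_0_def by (metis One_nat_def Suc_le_mono le0)
    define t where "t = complex_of_real (\<delta> / 2)"
    have t: "t \<noteq> 0" "cmod t < \<delta>" using \<delta>(1) by (auto simp: t_def)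
    let ?X = "chain_tuple w t"
    have dom: "(?n, ?X) \<in> nc_dom e" using s(2) chain_tuple_mem by (auto simp: nc_dom_def)
    have val: "rat_eval r ?n ?X = chain_mat w t s"
      unfolding rat_eval_def
    proof (rule the_equality)
      show "\<exists>e\<in>r. (?n, ?X) \<in> nc_dom e \<and> nc_eval ?n ?X e = Some (chain_mat w t s)"
        using e(1) dom s(2) by blast
      fix B assume "\<exists>e\<in>r. (?n, ?X) \<in> nc_dom e \<and> nc_eval ?n ?X e = Some B"
      then obtain e' where e': "e' \<in> r" "(?n, ?X) \<in> nc_dom e'" "nc_eval ?n ?X e' = Some B" by blast
      have "nc_eval ?n ?X e = nc_eval ?n ?X e'"
        using e(1) e'(1) x by (intro nc_equiv_agree[OF _ _ dom e'(2), of x]) auto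
      then show "B = chain_mat w t s" using e'(3) s(2)[of w t] by simp
    qed
    have "row_norm ?n ?X < \<delta>" using row_norm_chain_tuple[of w t] t(2) by linarith
    then have "homog_entry f ?n ?X (0, length w) sums (chain_mat w t s $$ (0, length w))"
      using \<delta>(2)[OF chain_tuple_mem] val by (metis lessI zero_less_Suc)
    moreover have "homog_entry f ?n ?X (0, length w) sums (f w * t ^ length w)"
      using sums_single[of "length w" "\<lambda>_. f w * t ^ length w"] unfolding homog_entry_chain[abs_def] .
    ultimately have "f w * t ^ length w = chain_mat w t s $$ (0, length w)" by (rule sums_unique2[rotated])
    then show ?thesis using t(1) by (simp add: chain_mat_def)
  qed
  then have "f = s" by auto
  then show ?thesis using s(1) by simp
qed

section \<open>Evaluation as an inner product\<close>

lemma fip_linear_combination: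
  fixes n :: nat
  assumes z: "\<And>i. i < n \<Longrightarrow> z i \<in> fock_space" and h: "h \<in> fock_space"
  shows "(\<lambda>\<beta>. \<Sum>i<n. c i * z i \<beta>) \<in> fock_space"
    and "fip (\<lambda>\<beta>. \<Sum>i<n. c i * z i \<beta>) h = (\<Sum>i<n. c i * fip (z i) h)"
proof -
  have "(\<lambda>\<beta>. \<Sum>i<m. c i * z i \<beta>) \<in> fock_space \<and>
      fip (\<lambda>\<beta>. \<Sum>i<m. c i * z i \<beta>) h = (\<Sum>i<m. c i * fip (z i) h)" if "m \<le> n" for m
    using that
  proof (induction m)
    case 0
    show ?case using fock_0 by (simp add: zero_fun_def fip_def)
  next
    case (Suc m)
    have e: "(\<lambda>\<beta>. \<Sum>i<Suc m. c i * z i \<beta>) = (\<lambda>\<beta>. \<Sum>i<m. c i * z i \<beta>) + series_scale (c m) (z m)"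
      by (simp add: fun_eq_iff series_scale_apply)
    have "z m \<in> fock_space" using z Suc.prems by simp
    then show ?case
      using Suc h unfolding e by (auto simp: fock_scale fip_add_left fip_scale_left intro: fock_add)
  qed
  then show "(\<lambda>\<beta>. \<Sum>i<n. c i * z i \<beta>) \<in> fock_space"
    "fip (\<lambda>\<beta>. \<Sum>i<n. c i * z i \<beta>) h = (\<Sum>i<n. c i * fip (z i) h)" by auto
qed

lemma fip_linear_combination_right:
  fixes n :: nat
  assumes "\<And>i. i < n \<Longrightarrow> z i \<in> fock_space" and "h \<in> fock_space"
  shows "fip h (\<lambda>\<beta>. \<Sum>i<n. c i * z i \<beta>) = (\<Sum>i<n. cnj (c i) * fip h (z i))"
proof -
  have "fip h (\<lambda>\<beta>. \<Sum>i<n. c i * z i \<beta>) = cnj (\<Sum>i<n. c i * fip (z i) h)"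
    by (simp only: fip_linear_combination(2)[where n = n and z = z and h = h and c = c, OF assms, symmetric] fip_cnj)
  then show ?thesis by (simp add: fip_cnj)
qed

lemma fock_cnj: "z \<in> fock_space \<Longrightarrow> (\<lambda>\<beta>. cnj (z \<beta>)) \<in> fock_space"
  by (simp add: mem_fock_iff)

lemma finite_words_of_length: "finite {\<alpha> :: ('d::finite) list. length \<alpha> = k}"
  using finite_lists_length_eq[of "UNIV :: 'd set" k] by simp

lemma sum_words_Suc:
  fixes g :: "('d::finite) list \<Rightarrow> 'c::comm_monoid_add"
  shows "(\<Sum>\<alpha> | length \<alpha> = Suc k. g \<alpha>) = (\<Sum>a\<in>UNIV. \<Sum>\<alpha> | length \<alpha> = k. g (a # \<alpha>))"
proof -
  have "(\<Sum>a\<in>UNIV. \<Sum>\<alpha> | length \<alpha> = k. g (a # \<alpha>)) = (\<Sum>p\<in>UNIV \<times> {\<alpha>. length \<alpha> = k}. g (fst p # snd p))"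
    by (subst sum.cartesian_product) (simp add: case_prod_beta)
  also have "\<dots> = (\<Sum>\<alpha> | length \<alpha> = Suc k. g \<alpha>)"
    by (rule sum.reindex_bij_witness[of _ "\<lambda>\<alpha>. (hd \<alpha>, tl \<alpha>)" "\<lambda>p. fst p # snd p"])
       (auto simp: length_Suc_conv)
  finally show ?thesis by simp
qed

lemma sums_by_length:
  fixes g :: "('d::finite) list \<Rightarrow> complex"
  assumes "g summable_on UNIV"
  shows "(\<lambda>k. \<Sum>\<alpha> | length \<alpha> = k. g \<alpha>) sums (\<Sum>\<^sub>\<infinity>\<alpha>. g \<alpha>)"
proof -
  let ?S = "Sigma (UNIV :: nat set) (\<lambda>k. {\<alpha> :: 'd list. length \<alpha> = k})"
  have img: "snd ` ?S = UNIV" by force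
  have inj: "inj_on snd ?S" by (auto simp: inj_on_def)
  have "(g has_sum (\<Sum>\<^sub>\<infinity>\<alpha>. g \<alpha>)) (snd ` ?S)" using assms img by simp
  then have *: "((g \<circ> snd) has_sum (\<Sum>\<^sub>\<infinity>\<alpha>. g \<alpha>)) ?S" using has_sum_reindex[OF inj] by blast
  have **: "((\<lambda>\<alpha>. (g \<circ> snd) (k, \<alpha>)) has_sum (\<Sum>\<alpha> | length \<alpha> = k. g \<alpha>)) {\<alpha>. length \<alpha> = k}" for k
    by (rule has_sum_finiteI) (auto simp: finite_words_of_length)
  have "((\<lambda>k. \<Sum>\<alpha> | length \<alpha> = k. g \<alpha>) has_sum (\<Sum>\<^sub>\<infinity>\<alpha>. g \<alpha>)) UNIV"
    by (rule has_sum_Sigma[OF isUCont_plus * **])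
  then show ?thesis by (rule has_sum_imp_sums)
qed

text \<open>The words of length \<open>k + 1\<close> are handled by splitting off the first letter, which changes \<open>y\<close> to the
  vectors \<open>y Z\<^sub>a\<close>.\<close>

lemma row_orbit_length_bound:
  fixes Z :: "('d::finite) mat_tuple"
  assumes Z: "Z \<in> mat_tuples n" and "\<rho> \<ge> 0"
    and bd: "\<And>y. (\<Sum>k\<in>UNIV. sq_norm n (row_times n y (Z k))) \<le> \<rho> * sq_norm n y"
  shows "(\<Sum>\<alpha> | length \<alpha> = k. sq_norm n (row_times n y (word_eval n Z \<alpha>))) \<le> \<rho> ^ k * sq_norm n y"
proof (induction k arbitrary: y)
  case 0
  have "sq_norm n (row_times n y (1\<^sub>m n)) = sq_norm n y"
    unfolding sq_norm_def by (intro sum.cong) (auto simp: row_times_def if_distrib cong: if_cong)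
  then show ?case by (simp add: word_eval_Nil)
next
  case (Suc k)
  have ZC: "Z a \<in> carrier_mat n n" for a using Z by (simp add: mat_tuples_def)
  have e: "sq_norm n (row_times n y (word_eval n Z (a # \<alpha>)))
      = sq_norm n (row_times n (row_times n y (Z a)) (word_eval n Z \<alpha>))" for a \<alpha>
    unfolding sq_norm_def word_eval_Cons
    by (intro sum.cong) (simp_all add: row_times_mult[OF ZC word_eval_carrier[OF Z]])
  have "(\<Sum>\<alpha> | length \<alpha> = Suc k. sq_norm n (row_times n y (word_eval n Z \<alpha>)))
      \<le> (\<Sum>a\<in>UNIV. \<rho> ^ k * sq_norm n (row_times n y (Z a)))"
    unfolding sum_words_Suc e by (intro sum_mono Suc)
  also have "\<dots> \<le> \<rho> ^ k * (\<rho> * sq_norm n y)"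
    unfolding sum_distrib_left[symmetric] using \<open>\<rho> \<ge> 0\<close> by (intro mult_left_mono bd) auto
  finally show ?case by (simp add: mult.assoc mult.left_commute)
qed

text \<open>The vector that represents the functional \<open>h \<mapsto> (y h(Z))\<^sub>j\<close> on the Fock space, see
  \<open>row_times_series_eval\<close>.\<close>

definition eval_kernel :: "nat \<Rightarrow> 'd mat_tuple \<Rightarrow> (nat \<Rightarrow> complex) \<Rightarrow> nat \<Rightarrow> 'd nc_series" where
  "eval_kernel n Z y j = (\<lambda>\<alpha>. cnj (row_times n y (word_eval n Z \<alpha>) j))"

lemma eval_kernel_fock:
  fixes Z :: "('d::finite) mat_tuple"
  assumes Z: "Z \<in> row_ball n" and j: "j < n"
  shows "eval_kernel n Z y j \<in> fock_space"
proof -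
  obtain \<rho> where \<rho>: "0 \<le> \<rho>" "\<rho> < 1" "\<And>y. (\<Sum>k\<in>UNIV. sq_norm n (row_times n y (Z k))) \<le> \<rho> * sq_norm n y"
    using row_ball_strict[OF Z] by blast
  have Zm: "Z \<in> mat_tuples n" using Z by (simp add: row_ball_def)
  let ?N = "\<lambda>\<alpha>. sq_norm n (row_times n y (word_eval n Z \<alpha>))"
  show ?thesis
  proof (rule fock_norm_le_finite(1))
    fix F :: "'d list set" assume F: "finite F"
    define m where "m = Suc (Max (insert 0 (length ` F)))"
    have len: "length \<alpha> < m" if "\<alpha> \<in> F" for \<alpha> using F that by (simp add: m_def le_imp_less_Suc)
    have "(\<Sum>\<alpha>\<in>F. (cmod (eval_kernel n Z y j \<alpha>))\<^sup>2) \<le> (\<Sum>\<alpha>\<in>F. ?N \<alpha>)"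
      unfolding sq_norm_def eval_kernel_def complex_mod_cnj
      by (intro sum_mono member_le_sum) (use j in auto)
    also have "\<dots> \<le> (\<Sum>\<alpha>\<in>(\<Union>k<m. {\<alpha>. length \<alpha> = k}). ?N \<alpha>)"
      by (intro sum_mono2) (use len in \<open>auto simp: sq_norm_nonneg finite_words_of_length\<close>)
    also have "\<dots> = (\<Sum>k<m. \<Sum>\<alpha> | length \<alpha> = k. ?N \<alpha>)"
      by (intro sum.UNION_disjoint) (auto simp: finite_words_of_length)
    also have "\<dots> \<le> (\<Sum>k<m. \<rho> ^ k * sq_norm n y)"
      by (intro sum_mono row_orbit_length_bound[OF Zm \<rho>(1) \<rho>(3)])
    also have "\<dots> = (\<Sum>k<m. \<rho> ^ k) * sq_norm n y" by (simp add: sum_distrib_right)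
    also have "(\<Sum>k<m. \<rho> ^ k) \<le> 1 / (1 - \<rho>)"
      using \<rho> sum_le_suminf[of "\<lambda>k. \<rho> ^ k" "{..<m}"] by (simp add: summable_geometric suminf_geometric)
    finally show "(\<Sum>\<alpha>\<in>F. (cmod (eval_kernel n Z y j \<alpha>))\<^sup>2) \<le> (sqrt (1 / (1 - \<rho>) * sq_norm n y))\<^sup>2"
      using \<rho> by (simp add: sq_norm_nonneg mult_right_mono divide_right_mono)
  qed (use \<rho> in \<open>simp add: sq_norm_nonneg\<close>)
qed

text \<open>The evaluation of a series groups the words by length; square summability makes the sum over all
  words absolutely convergent, so that it may be read as an inner product.\<close>

lemma row_times_series_eval:
  fixes Z :: "('d::finite) mat_tuple"
  assumes Z: "Z \<in> row_ball n" and j: "j < n" and f: "f \<in> fock_space"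
  shows "row_times n y (series_eval f n Z) j = fip f (eval_kernel n Z y j)"
proof -
  define e where "e i = (\<lambda>l. if l = i then (1::complex) else 0)" for i :: nat
  have ent: "row_times n (e i) A l = A $$ (i, l)" if "i < n" for i l A
  proof -
    have "row_times n (e i) A l = (\<Sum>l'<n. if l' = i then A $$ (l', l) else 0)"
      unfolding row_times_def e_def by (intro sum.cong) auto
    then show ?thesis using that by simp
  qed
  have eval: "series_eval f n Z $$ (i, j) = fip f (eval_kernel n Z (e i) j)" if i: "i < n" for i
  proof -
    let ?g = "\<lambda>\<alpha>. f \<alpha> * word_eval n Z \<alpha> $$ (i, j)"
    have fe: "fip f (eval_kernel n Z (e i) j) = (\<Sum>\<^sub>\<infinity>\<alpha>. ?g \<alpha>)"
      by (simp add: fip_def eval_kernel_def ent[OF i])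
    have "?g summable_on UNIV"
      using fip_summable[OF f eval_kernel_fock[OF Z j, of "e i"]] by (simp add: eval_kernel_def ent[OF i])
    from sums_by_length[OF this] have "homog_entry f n Z (i, j) sums (\<Sum>\<^sub>\<infinity>\<alpha>. ?g \<alpha>)"
      by (simp add: homog_entry_def[abs_def])
    then show ?thesis using i j fe by (simp add: series_eval_def sums_iff)
  qed
  have "eval_kernel n Z y j = (\<lambda>\<beta>. \<Sum>i<n. cnj (y i) * eval_kernel n Z (e i) j \<beta>)"
    by (rule ext) (simp add: eval_kernel_def ent, simp add: row_times_def)
  then have "fip f (eval_kernel n Z y j) = (\<Sum>i<n. y i * fip f (eval_kernel n Z (e i) j))"
    using fip_linear_combination_right[where n = n and z = "\<lambda>i. eval_kernel n Z (e i) j" and h = f and c = "\<lambda>i. cnj (y i)"]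
      eval_kernel_fock[OF Z j] f by simp
  then show ?thesis by (simp add: row_times_def[of n y] eval)
qed

lemma det_0_iff_row_kernel:
  fixes A :: "complex mat"
  assumes A: "A \<in> carrier_mat n n"
  shows "det A = 0 \<longleftrightarrow> (\<exists>y. (\<exists>i<n. y i \<noteq> 0) \<and> (\<forall>j<n. row_times n y A j = 0))"
proof -
  have At: "transpose_mat A \<in> carrier_mat n n" using A by simp
  have ent: "(transpose_mat A *\<^sub>v v) $ j = row_times n (\<lambda>i. v $ i) A j" if "v \<in> carrier_vec n" "j < n" for v j
    using that A by (simp add: row_times_def scalar_prod_def atLeast0LessThan mult.commute)
  have "det A = 0 \<longleftrightarrow> (\<exists>v. v \<in> carrier_vec n \<and> v \<noteq> 0\<^sub>v n \<and> transpose_mat A *\<^sub>v v = 0\<^sub>v n)"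
    using det_0_iff_vec_prod_zero_field[OF At] det_transpose[OF A] by simp
  also have "\<dots> \<longleftrightarrow> (\<exists>y. (\<exists>i<n. y i \<noteq> 0) \<and> (\<forall>j<n. row_times n y A j = 0))"
  proof
    assume "\<exists>v. v \<in> carrier_vec n \<and> v \<noteq> 0\<^sub>v n \<and> transpose_mat A *\<^sub>v v = 0\<^sub>v n"
    then obtain v where v: "v \<in> carrier_vec n" "v \<noteq> 0\<^sub>v n" "transpose_mat A *\<^sub>v v = 0\<^sub>v n" by blast
    have "\<exists>i<n. v $ i \<noteq> 0"
    proof (rule ccontr)
      assume "\<not> ?thesis"
      then have "v = 0\<^sub>v n" using v(1) by (intro eq_vecI) auto
      then show False using v(2) by simp
    qed
    moreover have "row_times n (\<lambda>i. v $ i) A j = 0" if "j < n" for j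
      using ent[OF v(1) that] v(3) that by simp
    ultimately show "\<exists>y. (\<exists>i<n. y i \<noteq> 0) \<and> (\<forall>j<n. row_times n y A j = 0)" by blast
  next
    assume "\<exists>y. (\<exists>i<n. y i \<noteq> 0) \<and> (\<forall>j<n. row_times n y A j = 0)"
    then obtain y where y: "\<exists>i<n. y i \<noteq> 0" "\<And>j. j < n \<Longrightarrow> row_times n y A j = 0" by blast
    let ?v = "vec n y"
    have vc: "?v \<in> carrier_vec n" by simp
    have "?v \<noteq> 0\<^sub>v n"
    proof
      assume e: "?v = 0\<^sub>v n"
      have "y i = 0" if "i < n" for i using arg_cong[OF e, of "\<lambda>v. v $ i"] that by simp
      then show False using y(1) by blast
    qed
    moreover have "transpose_mat A *\<^sub>v ?v = 0\<^sub>v n"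
    proof (rule eq_vecI)
      fix j assume "j < dim_vec (0\<^sub>v n :: complex vec)"
      then have j: "j < n" by simp
      have "(transpose_mat A *\<^sub>v ?v) $ j = row_times n y A j"
        unfolding ent[OF vc j] by (rule row_times_cong) simp
      then show "(transpose_mat A *\<^sub>v ?v) $ j = 0\<^sub>v n $ j" using y(2) j by simp
    qed (use A in simp)
    ultimately show "\<exists>v. v \<in> carrier_vec n \<and> v \<noteq> 0\<^sub>v n \<and> transpose_mat A *\<^sub>v v = 0\<^sub>v n" using vc by blast
  qed
  finally show ?thesis .
qed

lemma series_eval_carrier: "series_eval f n Z \<in> carrier_mat n n"
  by (simp add: series_eval_def)

text \<open>If \<open>y f(Z) = 0\<close>, then \<open>y h(Z) = 0\<close> for every \<open>h\<close> in the closed right invariant subspace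
  generated by \<open>f\<close>; this rules out \<open>h = 1\<close>.\<close>

lemma outer_imp_det_nonzero:
  fixes f :: "('d::finite) nc_series"
  assumes "outer f" and Z: "Z \<in> row_ball n"
  shows "det (series_eval f n Z) \<noteq> 0"
proof
  assume "det (series_eval f n Z) = 0"
  then obtain y i where y: "i < n" "y i \<noteq> 0" "\<And>j. j < n \<Longrightarrow> row_times n y (series_eval f n Z) j = 0"
    using det_0_iff_row_kernel[OF series_eval_carrier] by blast
  have f: "f \<in> fock_space" and cl: "right_closure f = fock_space" using assms(1) by (auto simp: outer_iff)
  have Zm: "Z \<in> mat_tuples n" using Z by (simp add: row_ball_def)
  let ?K = "eval_kernel n Z y"
  note K = eval_kernel_fock[OF Z, of _ y]
  have fK: "fip (?K j) f = 0" if "j < n" for j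
    using row_times_series_eval[OF Z that f, of y] y(3)[OF that] fip_cnj[of f "?K j"] by simp
  have gen: "fip (mult_word f \<gamma>) (?K i) = 0" for \<gamma>
  proof -
    have "back_shift \<gamma> (?K i) = (\<lambda>\<alpha>. \<Sum>l<n. cnj (word_eval n Z \<gamma> $$ (l, i)) * ?K l \<alpha>)"
    proof
      fix \<alpha>
      have "row_times n y (word_eval n Z (\<alpha> @ \<gamma>)) i
          = row_times n (row_times n y (word_eval n Z \<alpha>)) (word_eval n Z \<gamma>) i"
        unfolding word_eval_append[OF Zm]
        by (rule row_times_mult[OF word_eval_carrier[OF Zm] word_eval_carrier[OF Zm] y(1)])
      then show "back_shift \<gamma> (?K i) \<alpha> = (\<Sum>l<n. cnj (word_eval n Z \<gamma> $$ (l, i)) * ?K l \<alpha>)"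
        by (simp add: back_shift_def eval_kernel_def row_times_def[of n "row_times _ _ _"] mult.commute)
    qed
    then have "fip (back_shift \<gamma> (?K i)) f = (\<Sum>l<n. cnj (word_eval n Z \<gamma> $$ (l, i)) * fip (?K l) f)"
      using fip_linear_combination(2)[where n = n and z = ?K and h = f and c = "\<lambda>l. cnj (word_eval n Z \<gamma> $$ (l, i))"] K f by simp
    also have "\<dots> = 0" by (intro sum.neutral) (simp add: fK)
    finally show ?thesis using fip_mult_word[of "?K i" \<gamma> f] fip_cnj[of "?K i" "mult_word f \<gamma>"] by simp
  qed
  have sub: "ser.subspace {s \<in> fock_space. fip s (?K i) = 0}"
    using K[OF y(1)] by (auto simp: ser.subspace_def fock_0 fock_add fock_scale fip_add_left fip_scale_left)
       (simp add: fip_def)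
  have "right_span f \<subseteq> {s \<in> fock_space. fip s (?K i) = 0}"
    unfolding right_span_def by (rule ser.span_minimal[OF _ sub]) (use gen f in \<open>auto simp: fock_mult_word\<close>)
  then have "fip (unit_series []) (?K i) = 0"
    using fock_closure_orthogonal[OF right_span_subset_fock[OF f] K[OF y(1)]] cl fock_unit by blast
  then have "?K i [] = 0" using fip_unit[of "?K i" "[]"] fip_cnj[of "unit_series []" "?K i"] by simp
  moreover have "row_times n y (1\<^sub>m n) i = y i"
  proof -
    have "row_times n y (1\<^sub>m n) i = (\<Sum>l<n. if l = i then y l else 0)"
      unfolding row_times_def using y(1) by (intro sum.cong) auto
    then show ?thesis using y(1) by simp
  qed
  ultimately show False using y(2) by (simp add: eval_kernel_def word_eval_Nil)
qed

section \<open>Finite-dimensional spaces of series in evaluation coordinates\<close>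

text \<open>Evaluations at finitely many words serve as coordinates on a finite-dimensional space of series, with a
  dual basis. In these coordinates the adjoint shifts have the explicit matrix entries
  \<open>b j (p i @ [k])\<close>. The words are found by Gaussian elimination: a new vector outside the old
  span differs from its interpolation at the old words in some further word.\<close>

lemma evaluation_dual_basis:
  assumes "finite B"
  shows "\<exists>(n::nat) p b. (\<forall>i<n. b i \<in> series_span B) \<and> (\<forall>i<n. \<forall>j<n. b j (p i) = (if i = j then 1 else 0))
    \<and> (\<forall>h\<in>series_span B. \<forall>\<beta>. h \<beta> = (\<Sum>i<n. h (p i) * b i \<beta>))"
  using assms
proof (induction B rule: finite_induct)
  case empty
  show ?case by (rule exI[of _ 0]) simp
next
  case (insert v B)
  from insert.IH obtain n :: nat and p b where b: "\<forall>i<n. b i \<in> series_span B"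
    "\<forall>i<n. \<forall>j<n. b j (p i) = (if i = j then 1 else 0)"
    "\<forall>h\<in>series_span B. \<forall>\<beta>. h \<beta> = (\<Sum>i<n. h (p i) * b i \<beta>)" by blast
  note b = b(1)[rule_format] b(2)[rule_format] b(3)[rule_format]
  define r where "r = (\<Sum>i<n. series_scale (v (p i)) (b i))"
  have sum_apply: "(\<Sum>i<m. series_scale (c i) (b i)) \<beta> = (\<Sum>i<m. c i * b i \<beta>)" for m c \<beta>
    by (induction m) (auto simp: series_scale_apply)
  have r: "r \<in> series_span B" unfolding r_def using b(1) by (intro ser.span_sum ser.span_scale) auto
  have r_apply: "r \<beta> = (\<Sum>i<n. v (p i) * b i \<beta>)" for \<beta> by (simp only: r_def sum_apply)
  have mono: "series_span B \<subseteq> series_span (insert v B)" by (rule ser.span_mono) auto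
  have v: "v \<in> series_span (insert v B)" by (rule ser.span_base) simp
  show ?case
  proof (cases "v = r")
    case True
    then have "series_span (insert v B) = series_span B" using r by (simp add: ser.span_redundant)
    then show ?thesis using insert.IH by simp
  next
    case False
    then obtain x where x: "v x \<noteq> r x" by (auto simp: fun_eq_iff)
    define e where "e = series_scale (1 / (v x - r x)) (v - r)"
    have e_x: "e x = 1" using x by (simp add: e_def series_scale_apply)
    have rp: "r (p i) = v (p i)" if "i < n" for i
    proof -
      have "r (p i) = (\<Sum>j<n. if j = i then v (p j) else 0)"
        unfolding r_apply using b(2) that by (intro sum.cong) auto
      then show ?thesis using that by simp
    qed
    have e_p: "e (p i) = 0" if "i < n" for i using rp[OF that] by (simp add: e_def series_scale_apply)
    have e_span: "e \<in> series_span (insert v B)"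
      unfolding e_def using v r mono by (intro ser.span_scale ser.span_diff) auto
    define b' where "b' j = (if j < n then b j - series_scale (b j x) e else e)" for j
    define p' where "p' i = (if i < n then p i else x)" for i
    have "h \<beta> = (\<Sum>i<Suc n. h (p' i) * b' i \<beta>)" if h: "h \<in> series_span (insert v B)" for h \<beta>
    proof -
      obtain k where k: "h - series_scale k v \<in> series_span B"
        using h ser.span_breakdown_eq by blast
      define g where "g = h - series_scale k (v - r)"
      have "g = (h - series_scale k v) + series_scale k r"
        by (simp add: g_def fun_eq_iff series_scale_apply algebra_simps)
      then have g: "g \<in> series_span B" using k r by (simp add: ser.span_add ser.span_scale)
      have hg: "h \<gamma> = g \<gamma> + k * (v x - r x) * e \<gamma>" for \<gamma>
        using x by (simp add: g_def e_def series_scale_apply)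
      have "(\<Sum>i<Suc n. h (p' i) * b' i \<beta>) = (\<Sum>i<n. g (p i) * (b i \<beta> - b i x * e \<beta>)) + h x * e \<beta>"
        by (simp add: p'_def b'_def series_scale_apply hg e_p)
      also have "\<dots> = (\<Sum>i<n. g (p i) * b i \<beta>) - (\<Sum>i<n. g (p i) * b i x) * e \<beta> + h x * e \<beta>"
        by (simp add: right_diff_distrib sum_subtractf sum_distrib_right mult.assoc)
      also have "\<dots> = g \<beta> - g x * e \<beta> + h x * e \<beta>"
        by (simp only: b(3)[OF g, symmetric])
      also have "\<dots> = h \<beta>" by (simp add: hg[of \<beta>] hg[of x] e_x algebra_simps)
      finally show ?thesis by simp
    qed
    moreover have "b' i \<in> series_span (insert v B)" if "i < Suc n" for i
      using b(1) mono e_span unfolding b'_def by (auto intro!: ser.span_diff ser.span_scale)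
    moreover have "b' j (p' i) = (if i = j then 1 else 0)" if "i < Suc n" "j < Suc n" for i j
      using that b(2) e_p e_x by (auto simp: b'_def p'_def series_scale_apply less_Suc_eq)
    ultimately show ?thesis by (intro exI[of _ "Suc n"] exI[of _ p'] exI[of _ b']) auto
  qed
qed

section \<open>Positive definite forms\<close>

definition herm_form :: "nat \<Rightarrow> (nat \<Rightarrow> nat \<Rightarrow> complex) \<Rightarrow> (nat \<Rightarrow> complex) \<Rightarrow> complex" where
  "herm_form n P y = (\<Sum>i<n. \<Sum>j<n. y i * P i j * cnj (y j))"

text \<open>A form splits into the rank one part of its first column and the Schur complement on the other
  coordinates.\<close>

lemma herm_form_Suc_Schur:
  assumes P: "\<And>i j. i < Suc n \<Longrightarrow> j < Suc n \<Longrightarrow> P i j = s i * cnj (s j) +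
     (case i of 0 \<Rightarrow> 0 | Suc i' \<Rightarrow> case j of 0 \<Rightarrow> 0 | Suc j' \<Rightarrow> P' i' j')"
  shows "herm_form (Suc n) P y =
    (\<Sum>i<Suc n. y i * s i) * cnj (\<Sum>i<Suc n. y i * s i) + herm_form n P' (\<lambda>i. y (Suc i))"
proof -
  let ?Q = "\<lambda>i j. case i of 0 \<Rightarrow> 0 | Suc i' \<Rightarrow> case j of 0 \<Rightarrow> 0 | Suc j' \<Rightarrow> P' i' j'"
  have "herm_form (Suc n) P y = (\<Sum>i<Suc n. \<Sum>j<Suc n. y i * s i * cnj (y j * s j) + y i * ?Q i j * cnj (y j))"
    unfolding herm_form_def by (intro sum.cong refl) (auto simp: P algebra_simps)
  also have "\<dots> = (\<Sum>i<Suc n. \<Sum>j<Suc n. y i * s i * cnj (y j * s j))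
      + (\<Sum>i<Suc n. \<Sum>j<Suc n. y i * ?Q i j * cnj (y j))"
    by (simp only: sum.distrib)
  also have "(\<Sum>i<Suc n. \<Sum>j<Suc n. y i * s i * cnj (y j * s j))
      = (\<Sum>i<Suc n. y i * s i) * cnj (\<Sum>i<Suc n. y i * s i)"
    unfolding cnj_sum sum_product ..
  also have "(\<Sum>i<Suc n. \<Sum>j<Suc n. y i * ?Q i j * cnj (y j)) = herm_form n P' (\<lambda>i. y (Suc i))"
    by (simp add: herm_form_def sum.lessThan_Suc_shift del: sum.lessThan_Suc)
  finally show ?thesis .
qed

text \<open>Cholesky factorization, by induction on the size via the Schur complement of the first entry.\<close>

lemma cholesky:
  assumes "\<And>i j. i < n \<Longrightarrow> j < n \<Longrightarrow> P j i = cnj (P i j)"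
    and "\<And>y. \<exists>i<n. y i \<noteq> 0 \<Longrightarrow> Re (herm_form n P y) > 0"
  shows "\<exists>S. \<forall>i<n. \<forall>j<n. P i j = (\<Sum>l<n. S i l * cnj (S j l))"
  using assms
proof (induction n arbitrary: P)
  case (Suc n)
  note herm = Suc.prems(1) and pos = Suc.prems(2)
  define a where "a = Re (P 0 0)"
  have P00: "P 0 0 = complex_of_real a" using herm[of 0 0] by (simp add: a_def complex_eq_iff)
  have "herm_form (Suc n) P (\<lambda>i. if i = 0 then 1 else 0) = P 0 0"
    by (simp add: herm_form_def sum.lessThan_Suc_shift del: sum.lessThan_Suc)
  then have a: "a > 0" using pos[of "\<lambda>i. if i = 0 then 1 else 0"] by (auto simp: a_def)
  define s where "s i = P i 0 / complex_of_real (sqrt a)" for i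
  have ss: "complex_of_real (sqrt a) * complex_of_real (sqrt a) = complex_of_real a"
    using a by (simp flip: of_real_mult)
  have sa: "complex_of_real (sqrt a) \<noteq> 0" using a by simp
  have s0: "s 0 = complex_of_real (sqrt a)" using sa ss by (simp add: s_def P00 field_simps)
  define P' where "P' i j = P (Suc i) (Suc j) - s (Suc i) * cnj (s (Suc j))" for i j
  have dec: "P i j = s i * cnj (s j) + (case i of 0 \<Rightarrow> 0 | Suc i' \<Rightarrow> case j of 0 \<Rightarrow> 0 | Suc j' \<Rightarrow> P' i' j')"
    if "i < Suc n" "j < Suc n" for i j
  proof (cases i)
    case 0
    have "s 0 * cnj (s j) = cnj (P j 0)" using sa by (simp add: s0) (simp add: s_def)
    then show ?thesis using 0 herm[of j 0] that by simp
  next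
    case (Suc i')
    show ?thesis
    proof (cases j)
      case 0
      have "s i * cnj (s 0) = P i 0" using sa by (simp add: s0) (simp add: s_def)
      then show ?thesis using 0 Suc by simp
    qed (simp add: Suc P'_def)
  qed
  have "\<exists>S. \<forall>i<n. \<forall>j<n. P' i j = (\<Sum>l<n. S i l * cnj (S j l))"
  proof (rule Suc.IH)
    show "P' j i = cnj (P' i j)" if "i < n" "j < n" for i j
      using herm[of "Suc i" "Suc j"] that by (simp add: P'_def mult.commute)
    fix y :: "nat \<Rightarrow> complex" assume y: "\<exists>i<n. y i \<noteq> 0"
    \<comment> \<open>the first coordinate is chosen to kill the rank one part\<close>
    define z where "z = (\<lambda>i. case i of 0 \<Rightarrow> - (\<Sum>i<n. y i * s (Suc i)) / s 0 | Suc i' \<Rightarrow> y i')"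
    have "(\<Sum>i<Suc n. z i * s i) = 0"
      using sa by (simp add: z_def sum.lessThan_Suc_shift s0 del: sum.lessThan_Suc)
    moreover have "(\<lambda>i. z (Suc i)) = y" by (simp add: z_def)
    ultimately have "herm_form (Suc n) P z = herm_form n P' y"
      using herm_form_Suc_Schur[of n P s P' z, OF dec] by (simp only: mult_zero_left add_0_left)
    moreover have "\<exists>i<Suc n. z i \<noteq> 0" 
    proof -
      obtain i where "i < n" "y i \<noteq> 0" using y by blast
      then have "Suc i < Suc n" "z (Suc i) \<noteq> 0" by (simp_all add: z_def)
      then show ?thesis by blast
    qed
    ultimately show "Re (herm_form n P' y) > 0" using pos[of z] by simp
  qed
  then obtain S where S: "\<And>i j. i < n \<Longrightarrow> j < n \<Longrightarrow> P' i j = (\<Sum>l<n. S i l * cnj (S j l))" by blast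
  define S' where "S' i l = (case l of 0 \<Rightarrow> s i | Suc l' \<Rightarrow> case i of 0 \<Rightarrow> 0 | Suc i' \<Rightarrow> S i' l')" for i l
  have "P i j = (\<Sum>l<Suc n. S' i l * cnj (S' j l))" if "i < Suc n" "j < Suc n" for i j
  proof -
    have "(\<Sum>l<Suc n. S' i l * cnj (S' j l)) = s i * cnj (s j) + (\<Sum>l<n. S' i (Suc l) * cnj (S' j (Suc l)))"
      by (simp add: sum.lessThan_Suc_shift S'_def del: sum.lessThan_Suc)
    also have "(\<Sum>l<n. S' i (Suc l) * cnj (S' j (Suc l)))
        = (case i of 0 \<Rightarrow> 0 | Suc i' \<Rightarrow> case j of 0 \<Rightarrow> 0 | Suc j' \<Rightarrow> P' i' j')"
      using that by (auto simp: S'_def S split: nat.split)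
    finally show ?thesis using dec[OF that] by simp
  qed
  then show ?case by blast
qed simp

lemma herm_form_gram:
  assumes P: "\<And>i j. i < n \<Longrightarrow> j < n \<Longrightarrow> P i j = (\<Sum>l<n. S $$ (i, l) * cnj (S $$ (j, l)))"
  shows "herm_form n P y = complex_of_real (sq_norm n (row_times n y S))"
proof -
  have "herm_form n P y = (\<Sum>i<n. \<Sum>j<n. \<Sum>l<n. (y i * S $$ (i, l)) * cnj (y j * S $$ (j, l)))"
    unfolding herm_form_def
    by (intro sum.cong refl) (simp add: P sum_distrib_left sum_distrib_right algebra_simps)
  also have "\<dots> = (\<Sum>i<n. \<Sum>l<n. \<Sum>j<n. (y i * S $$ (i, l)) * cnj (y j * S $$ (j, l)))"
    by (intro sum.cong refl sum.swap)
  also have "\<dots> = (\<Sum>l<n. \<Sum>i<n. \<Sum>j<n. (y i * S $$ (i, l)) * cnj (y j * S $$ (j, l)))"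
    by (rule sum.swap)
  also have "\<dots> = (\<Sum>l<n. row_times n y S l * cnj (row_times n y S l))"
    by (simp only: row_times_def cnj_sum sum_product)
  finally show ?thesis by (simp only: sq_norm_def of_real_sum complex_norm_square)
qed

section \<open>Square summable tuples are similar to points of the row ball\<close>

lemma fock_norm_sq_Cons:
  fixes z :: "('d::finite) nc_series"
  assumes z: "z \<in> fock_space"
  shows "(fock_norm z)\<^sup>2 = (cmod (z []))\<^sup>2 + (\<Sum>k\<in>UNIV. (fock_norm (\<lambda>\<beta>. z (k # \<beta>)))\<^sup>2)"
proof -
  let ?g = "\<lambda>\<alpha>. (cmod (z \<alpha>))\<^sup>2" and ?c = "\<lambda>p :: 'd \<times> 'd list. fst p # snd p"
  have sm: "?g summable_on A" for A
    using z summable_on_subset_banach[of ?g UNIV A] by (simp add: mem_fock_iff)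
  have U: "UNIV = {[]} \<union> range ?c"
  proof -
    have "\<alpha> \<in> {[]} \<union> range ?c" for \<alpha> :: "'d list"
      by (cases \<alpha>) (auto intro!: image_eqI[of _ _ "(hd \<alpha>, tl \<alpha>)"])
    then show ?thesis by blast
  qed
  have inj: "inj ?c" by (auto simp: inj_on_def)
  have "(fock_norm z)\<^sup>2 = infsum ?g ({[]} \<union> range ?c)" using U by (simp add: fock_norm_sq)
  also have "\<dots> = ?g [] + infsum ?g (range ?c)"
    by (subst infsum_Un_disjoint) (use sm in auto)
  also have "infsum ?g (range ?c) = infsum (?g \<circ> ?c) (UNIV \<times> UNIV)"
    by (subst infsum_reindex[OF inj]) simp
  also have "\<dots> = (\<Sum>\<^sub>\<infinity>k. \<Sum>\<^sub>\<infinity>\<beta>. (?g \<circ> ?c) (k, \<beta>))"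
    using summable_on_reindex[OF inj, of ?g] sm[of "range ?c"] by (intro infsum_Sigma_banach[symmetric]) simp
  also have "\<dots> = (\<Sum>k\<in>UNIV. (fock_norm (\<lambda>\<beta>. z (k # \<beta>)))\<^sup>2)" by (simp add: fock_norm_sq)
  finally show ?thesis .
qed

text \<open>The form \<open>q y = \<Sum>\<^sub>\<beta> |y Z\<^sup>\<beta>|\<^sup>2\<close> satisfies \<open>\<Sum>\<^sub>k q (y Z\<^sub>k) = q y - |y|\<^sup>2\<close>. As \<open>q\<close> is bounded by a
  multiple of \<open>|y|\<^sup>2\<close>, the tuple is a strict row contraction in the norm \<open>sqrt q\<close>, and a Cholesky
  factor of \<open>q\<close> is a similarity to the Euclidean norm.\<close>

lemma square_summable_similar_row_ball:
  fixes Z :: "('d::finite) mat_tuple"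
  assumes Z: "Z \<in> mat_tuples n"
    and sq: "\<And>i r. i < n \<Longrightarrow> r < n \<Longrightarrow> (\<lambda>\<beta>. word_eval n Z \<beta> $$ (i, r)) \<in> fock_space"
  shows "\<exists>S G. S \<in> carrier_mat n n \<and> G \<in> carrier_mat n n \<and> S * G = 1\<^sub>m n \<and> G * S = 1\<^sub>m n \<and>
    (\<lambda>k. G * Z k * S) \<in> row_ball n"
proof -
  have ZC: "Z k \<in> carrier_mat n n" for k using Z by (simp add: mat_tuples_def)
  define \<zeta> where "\<zeta> y r = (\<lambda>\<beta>. row_times n y (word_eval n Z \<beta>) r)" for y r
  define q where "q y = (\<Sum>r<n. (fock_norm (\<zeta> y r))\<^sup>2)" for y
  define P where "P i j = (\<Sum>r<n. fip (\<lambda>\<beta>. word_eval n Z \<beta> $$ (i, r)) (\<lambda>\<beta>. word_eval n Z \<beta> $$ (j, r)))" for i j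
  have \<zeta>f: "\<zeta> y r \<in> fock_space" if "r < n" for y r
    unfolding \<zeta>_def row_times_def
    using fip_linear_combination(1)[where n = n and c = y and z = "\<lambda>i \<beta>. word_eval n Z \<beta> $$ (i, r)" and h = 0]
      sq that fock_0 by auto
  have q_step: "q y = sq_norm n y + (\<Sum>k\<in>UNIV. q (row_times n y (Z k)))" for y
  proof -
    have one: "\<zeta> y r [] = y r" if "r < n" for r
    proof -
      have "\<zeta> y r [] = (\<Sum>i<n. if i = r then y i else 0)"
        unfolding \<zeta>_def row_times_def word_eval_Nil using that by (intro sum.cong) auto
      then show ?thesis using that by simp
    qed
    have Cons: "(\<lambda>\<beta>. \<zeta> y r (k # \<beta>)) = \<zeta> (row_times n y (Z k)) r" if "r < n" for r k
      using that by (simp add: \<zeta>_def fun_eq_iff word_eval_Cons row_times_mult[OF ZC word_eval_carrier[OF Z]])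
    have "q y = (\<Sum>r<n. (cmod (y r))\<^sup>2 + (\<Sum>k\<in>UNIV. (fock_norm (\<zeta> (row_times n y (Z k)) r))\<^sup>2))"
      unfolding q_def by (intro sum.cong refl) (simp add: fock_norm_sq_Cons[OF \<zeta>f] one Cons)
    also have "\<dots> = sq_norm n y + (\<Sum>r<n. \<Sum>k\<in>UNIV. (fock_norm (\<zeta> (row_times n y (Z k)) r))\<^sup>2)"
      by (simp add: sum.distrib sq_norm_def)
    also have "(\<Sum>r<n. \<Sum>k\<in>UNIV. (fock_norm (\<zeta> (row_times n y (Z k)) r))\<^sup>2) = (\<Sum>k\<in>UNIV. q (row_times n y (Z k)))"
      unfolding q_def by (rule sum.swap)
    finally show ?thesis .
  qed
  have q_ge: "sq_norm n y \<le> q y" for y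
    unfolding q_step[of y] by (simp add: sum_nonneg q_def)
  have herm_q: "herm_form n P y = complex_of_real (q y)" for y
  proof -
    let ?z = "\<lambda>r i \<beta>. word_eval n Z \<beta> $$ (i, r)"
    have "fip (\<zeta> y r) (\<zeta> y r) = (\<Sum>i<n. \<Sum>j<n. y i * fip (?z r i) (?z r j) * cnj (y j))" if r: "r < n" for r
    proof -
      have z: "\<zeta> y r = (\<lambda>\<beta>. \<Sum>i<n. y i * ?z r i \<beta>)" by (simp add: \<zeta>_def row_times_def)
      have "fip (\<zeta> y r) (\<zeta> y r) = (\<Sum>i<n. y i * fip (?z r i) (\<zeta> y r))"
        using fip_linear_combination(2)[where n = n and c = y and z = "?z r" and h = "\<zeta> y r"] sq r \<zeta>f[OF r]
        unfolding z[symmetric] by blast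
      also have "\<dots> = (\<Sum>i<n. y i * (\<Sum>j<n. cnj (y j) * fip (?z r i) (?z r j)))"
      proof (intro sum.cong refl arg_cong2[where f = "(*)"])
        fix i assume "i \<in> {..<n}"
        then show "fip (?z r i) (\<zeta> y r) = (\<Sum>j<n. cnj (y j) * fip (?z r i) (?z r j))"
          using fip_linear_combination_right[where n = n and c = y and z = "?z r" and h = "?z r i"] sq r
          unfolding z[symmetric] by blast
      qed
      finally show ?thesis by (simp add: sum_distrib_left mult.assoc mult.commute mult.left_commute)
    qed
    then have "complex_of_real (q y) = (\<Sum>r<n. \<Sum>i<n. \<Sum>j<n. y i * fip (?z r i) (?z r j) * cnj (y j))"
      unfolding q_def of_real_sum by (intro sum.cong refl) (simp only: fip_self[symmetric] lessThan_iff)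
    also have "\<dots> = (\<Sum>i<n. \<Sum>r<n. \<Sum>j<n. y i * fip (?z r i) (?z r j) * cnj (y j))" by (rule sum.swap)
    also have "\<dots> = (\<Sum>i<n. \<Sum>j<n. \<Sum>r<n. y i * fip (?z r i) (?z r j) * cnj (y j))"
      by (intro sum.cong refl sum.swap)
    also have "\<dots> = herm_form n P y"
      by (simp add: herm_form_def P_def sum_distrib_left sum_distrib_right)
    finally show ?thesis by simp
  qed
  have pos: "sq_norm n y > 0" if "\<exists>i<n. y i \<noteq> 0" for y
  proof -
    from that obtain i where i: "i < n" "y i \<noteq> 0" by blast
    have "(cmod (y i))\<^sup>2 \<le> sq_norm n y" unfolding sq_norm_def by (rule member_le_sum) (use i in auto)
    then show ?thesis using i by (meson less_le_trans zero_less_norm_iff zero_less_power)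
  qed
  have "\<exists>S. \<forall>i<n. \<forall>j<n. P i j = (\<Sum>l<n. S i l * cnj (S j l))"
  proof (rule cholesky)
    show "P j i = cnj (P i j)" for i j by (simp add: P_def fip_cnj)
    show "Re (herm_form n P y) > 0" if "\<exists>i<n. y i \<noteq> 0" for y
      using pos[OF that] q_ge[of y] by (simp add: herm_q)
  qed
  then obtain S0 where S0: "\<And>i j. i < n \<Longrightarrow> j < n \<Longrightarrow> P i j = (\<Sum>l<n. S0 i l * cnj (S0 j l))" by blast
  define S where "S = mat n n (\<lambda>(i, l). S0 i l)"
  have S: "S \<in> carrier_mat n n" by (simp add: S_def)
  have qS: "q y = sq_norm n (row_times n y S)" for y
  proof -
    have "herm_form n P y = complex_of_real (sq_norm n (row_times n y S))"
      by (rule herm_form_gram) (simp add: S0 S_def)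
    then show ?thesis unfolding herm_q by (simp only: of_real_eq_iff)
  qed
  have "det S \<noteq> 0"
  proof
    assume "det S = 0"
    then obtain y where y: "\<exists>i<n. y i \<noteq> 0" "\<forall>j<n. row_times n y S j = 0"
      using det_0_iff_row_kernel[OF S] by blast
    then have "q y = 0" unfolding qS by (simp add: sq_norm_def)
    then show False using pos[OF y(1)] q_ge[of y] by simp
  qed
  then have "S \<in> Units (ring_mat TYPE(complex) n ())" by (rule det_non_zero_imp_unit[OF S])
  then obtain G where G: "G \<in> carrier_mat n n" "S * G = 1\<^sub>m n" "G * S = 1\<^sub>m n"
    by (auto simp: Units_def ring_mat_def)
  define C where "C = 1 + (\<Sum>j<n. \<Sum>i<n. (cmod (S $$ (i, j)))\<^sup>2)"
  have C1: "C \<ge> 1" by (simp add: C_def sum_nonneg)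
  have q_le: "q y \<le> C * sq_norm n y" for y
  proof -
    have "sq_norm n (row_times n y S) \<le> (C - 1) * sq_norm n y"
      using row_times_crude_bound[of n y "\<lambda>_ :: unit. S"] by (simp add: C_def UNIV_unit)
    also have "\<dots> \<le> C * sq_norm n y" by (intro mult_right_mono) (auto simp: sq_norm_nonneg)
    finally show ?thesis by (simp add: qS)
  qed
  let ?W = "\<lambda>k. G * Z k * S"
  have WC: "?W k \<in> carrier_mat n n" for k using G S ZC by (meson mult_carrier_mat)
  have W: "?W \<in> mat_tuples n" using WC by (simp add: mat_tuples_def)
  have "row_norm n ?W \<le> sqrt (1 - 1 / C)"
  proof (rule row_norm_le[OF W])
    show "0 \<le> 1 - 1 / C" using C1 by simp
    fix y
    define x where "x = row_times n y G"
    have xS: "sq_norm n (row_times n x S) = sq_norm n y"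
    proof -
      have "row_times n x S r = y r" if r: "r < n" for r
      proof -
        have "row_times n x S r = row_times n y (1\<^sub>m n) r"
          unfolding x_def G(3)[symmetric] by (rule row_times_mult[OF G(1) S r, symmetric])
        also have "\<dots> = (\<Sum>i<n. if i = r then y i else 0)"
          unfolding row_times_def using r by (intro sum.cong) auto
        finally show ?thesis using r by simp
      qed
      then show ?thesis by (simp add: sq_norm_def)
    qed
    have yW: "sq_norm n (row_times n y (?W k)) = q (row_times n x (Z k))" for k
    proof -
      have "row_times n y (?W k) r = row_times n (row_times n x (Z k)) S r" if r: "r < n" for r
      proof -
        have "row_times n y (?W k) r = row_times n (row_times n y (G * Z k)) S r"
          by (rule row_times_mult[OF mult_carrier_mat[OF G(1) ZC] S r])
        also have "\<dots> = row_times n (row_times n x (Z k)) S r"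
          unfolding x_def by (rule row_times_cong) (rule row_times_mult[OF G(1) ZC])
        finally show ?thesis .
      qed
      then show ?thesis unfolding qS by (simp add: sq_norm_def)
    qed
    have "(\<Sum>k\<in>UNIV. sq_norm n (row_times n y (?W k))) = q x - sq_norm n x"
      unfolding yW using q_step[of x] by simp
    also have "\<dots> \<le> q x - q x / C"
      using q_le[of x] C1 by (simp add: pos_divide_le_eq mult.commute)
    also have "\<dots> = (1 - 1 / C) * sq_norm n y" using xS by (simp add: qS algebra_simps)
    finally show "(\<Sum>k\<in>UNIV. sq_norm n (row_times n y (?W k))) \<le> (1 - 1 / C) * sq_norm n y" .
  qed
  also have "\<dots> < 1" using C1 by simp
  finally have "?W \<in> row_ball n" using W by (simp add: row_ball_def)
  then show ?thesis using S G by blast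
qed

lemma word_eval_similar:
  assumes Z: "Z \<in> mat_tuples n" and S: "S \<in> carrier_mat n n" and G: "G \<in> carrier_mat n n"
    and SG: "S * G = 1\<^sub>m n" "G * S = 1\<^sub>m n"
  shows "word_eval n (\<lambda>k. G * Z k * S) \<beta> = G * word_eval n Z \<beta> * S"
proof (induction \<beta>)
  case Nil
  show ?case using G SG by (simp add: word_eval_Nil)
next
  case (Cons k \<beta>)
  have ZC: "Z k \<in> carrier_mat n n" using Z by (simp add: mat_tuples_def)
  note E = word_eval_carrier[OF Z, of \<beta>]
  have "G * Z k * S * (G * word_eval n Z \<beta> * S) = G * Z k * (S * (G * (word_eval n Z \<beta> * S)))"
    using G ZC S E by (simp add: assoc_mult_mat[of _ n n _ n _ n])
  also have "S * (G * (word_eval n Z \<beta> * S)) = (S * G) * (word_eval n Z \<beta> * S)"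
    using G S E by (simp add: assoc_mult_mat[of S n n G n _ n])
  also have "\<dots> = word_eval n Z \<beta> * S" unfolding SG using E S by (intro left_mult_one_mat) auto
  also have "G * Z k * (word_eval n Z \<beta> * S) = G * (Z k * word_eval n Z \<beta>) * S"
    using G ZC S E by (simp add: assoc_mult_mat[of _ n n _ n _ n])
  finally show ?case unfolding word_eval_Cons Cons .
qed

section \<open>Finite-dimensional annihilators give singular points\<close>

text \<open>On the span of the adjoint shift orbit of \<open>u\<close>, the words of the matrices of the adjoint shifts have
  entries \<open>b j (p i @ \<beta>)\<close>, which are square summable in \<open>\<beta>\<close>. Hence the tuple is similar to one in
  the row ball. The row vector \<open>b i []\<close> sends the word \<open>\<beta>\<close> to the row \<open>b j \<beta>\<close>, and the sum of these against
  \<open>f\<close> is the inner product with \<open>b j\<close>, which is zero. The conjugations are there because the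
  inner product is conjugate linear in its second argument.\<close>

lemma annihilator_singular_point:
  fixes f :: "('d::finite) nc_series"
  assumes f: "f \<in> fock_space" and u: "u \<in> fock_space" "u \<noteq> 0" "recognizable u"
    and ann: "\<And>\<alpha>. fip (mult_word f \<alpha>) u = 0"
  shows "\<exists>n\<ge>1. \<exists>Z\<in>row_ball n. det (series_eval f n Z) = 0"
proof -
  obtain B where B: "finite B" "B \<subseteq> range (\<lambda>\<alpha>. back_shift \<alpha> u)" "\<And>\<alpha>. back_shift \<alpha> u \<in> series_span B"
    using recognizable_orbit_basis[OF u(3)] by blast
  let ?V = "series_span B"
  have inv: "back_shift \<alpha> h \<in> ?V" if "h \<in> ?V" for h \<alpha>
  proof (rule span_map[where T = "back_shift \<alpha>", OF back_shift_add back_shift_scale _ ser.subspace_span that])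
    fix b assume "b \<in> B"
    then obtain \<gamma> where "b = back_shift \<gamma> u" using B(2) by blast
    then show "back_shift \<alpha> b \<in> ?V" using B(3)[of "\<alpha> @ \<gamma>"] by (simp add: back_shift_append)
  qed
  have orth: "h \<in> fock_space \<and> fip f h = 0" if "h \<in> ?V" for h
  proof -
    have sub: "ser.subspace {h \<in> fock_space. fip f h = 0}"
      using f by (auto simp: ser.subspace_def fock_0 fock_add fock_scale fip_add_right fip_scale_right)
        (simp add: fip_def)
    have "B \<subseteq> {h \<in> fock_space. fip f h = 0}"
    proof
      fix b assume "b \<in> B"
      then obtain \<gamma> where b: "b = back_shift \<gamma> u" using B(2) by blast
      have "fip b f = fip u (mult_word f \<gamma>)" by (simp only: b fip_mult_word)
      also have "\<dots> = 0" using ann[of \<gamma>] fip_cnj[of "mult_word f \<gamma>" u] by simp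
      finally have "fip f b = 0" using fip_cnj[of b f] by simp
      then show "b \<in> {h \<in> fock_space. fip f h = 0}" using fock_back_shift(1)[OF u(1)] b by blast
    qed
    from ser.span_minimal[OF this sub] show ?thesis using that by blast
  qed
  from evaluation_dual_basis[OF B(1)] obtain n :: nat and p b where b: "\<forall>i<n. b i \<in> ?V"
    "\<forall>i<n. \<forall>j<n. b j (p i) = (if i = j then 1 else 0)"
    "\<forall>h\<in>?V. \<forall>\<beta>. h \<beta> = (\<Sum>i<n. h (p i) * b i \<beta>)" by blast
  note b = b(1)[rule_format] b(2)[rule_format] b(3)[rule_format]
  have uV: "u \<in> ?V" using B(3)[of "[]"] by simp
  \<comment> \<open>the adjoint shifts on \<open>?V\<close> in the coordinates \<open>h (p i)\<close>, conjugated\<close>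
  define Z :: "'d mat_tuple" where "Z k = mat n n (\<lambda>(i, j). cnj (b j (p i @ [k])))" for k
  have Z: "Z \<in> mat_tuples n" by (simp add: mat_tuples_def Z_def)
  have Z_index: "Z k $$ (i, l) = cnj (b l (p i @ [k]))" if "i < n" "l < n" for k i l
    using that by (simp add: Z_def)
  have ev: "word_eval n Z \<beta> $$ (i, j) = cnj (b j (p i @ \<beta>))" if "i < n" "j < n" for i j \<beta>
    using that
  proof (induction \<beta> arbitrary: i)
    case Nil
    then show ?case using b(2) by (simp add: word_eval_Nil)
  next
    case (Cons k \<beta>)
    have "word_eval n Z (k # \<beta>) $$ (i, j) = (\<Sum>l<n. Z k $$ (i, l) * word_eval n Z \<beta> $$ (l, j))"
      using Cons.prems word_eval_carrier[OF Z, of \<beta>]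
      by (simp add: word_eval_Cons Z_def scalar_prod_def atLeast0LessThan)
    also have "\<dots> = (\<Sum>l<n. cnj (back_shift \<beta> (b j) (p l) * b l (p i @ [k])))"
      using Cons by (intro sum.cong) (auto simp: Z_index back_shift_def)
    also have "\<dots> = cnj (back_shift \<beta> (b j) (p i @ [k]))"
      unfolding cnj_sum[symmetric] b(3)[OF inv[OF b(1)[OF Cons.prems(2)]], symmetric] ..
    finally show ?case by (simp add: back_shift_def)
  qed
  have sq: "(\<lambda>\<beta>. word_eval n Z \<beta> $$ (i, r)) \<in> fock_space" if "i < n" "r < n" for i r
  proof -
    have bf: "b r \<in> fock_space" using orth b(1) that by blast
    have "(\<lambda>\<beta>. b r (p i @ \<beta>)) \<in> fock_space"
    proof (rule fock_norm_le_finite(1)[OF fock_norm_nonneg[of "b r"]])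
      fix F :: "'d list set" assume F: "finite F"
      have "(\<Sum>\<beta>\<in>F. (cmod (b r (p i @ \<beta>)))\<^sup>2) = (\<Sum>\<gamma>\<in>(@) (p i) ` F. (cmod (b r \<gamma>))\<^sup>2)"
        by (subst sum.reindex) (auto simp: inj_on_def)
      also have "\<dots> \<le> (fock_norm (b r))\<^sup>2" by (rule sum_le_fock_norm[OF bf]) (use F in simp)
      finally show "(\<Sum>\<beta>\<in>F. (cmod (b r (p i @ \<beta>)))\<^sup>2) \<le> (fock_norm (b r))\<^sup>2" .
    qed
    then show ?thesis using that fock_cnj by (simp add: ev)
  qed
  obtain S G where S: "S \<in> carrier_mat n n" and G: "G \<in> carrier_mat n n"
    and SG: "S * G = 1\<^sub>m n" "G * S = 1\<^sub>m n" and W: "(\<lambda>k. G * Z k * S) \<in> row_ball n"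
    using square_summable_similar_row_ball[OF Z sq] by blast
  let ?W = "\<lambda>k. G * Z k * S"
  \<comment> \<open>evaluation at the empty word in these coordinates\<close>
  define x where "x i = cnj (b i [])" for i
  have xZ: "row_times n x (word_eval n Z \<beta>) j = cnj (b j \<beta>)" if "j < n" for j \<beta>
  proof -
    have "row_times n x (word_eval n Z \<beta>) j = (\<Sum>i<n. cnj (back_shift \<beta> (b j) (p i) * b i []))"
      unfolding row_times_def using that by (intro sum.cong) (auto simp: ev x_def back_shift_def)
    also have "\<dots> = cnj (back_shift \<beta> (b j) [])"
      unfolding cnj_sum[symmetric] b(3)[OF inv[OF b(1)[OF that]], symmetric] ..
    finally show ?thesis by (simp add: back_shift_def)
  qed
  define y where "y = row_times n x S"
  have yG: "row_times n y G i = x i" if "i < n" for i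
  proof -
    have "row_times n y G i = row_times n x (1\<^sub>m n) i"
      unfolding y_def SG(1)[symmetric] by (rule row_times_mult[OF S G that, symmetric])
    also have "\<dots> = (\<Sum>l<n. if l = i then x l else 0)"
      unfolding row_times_def using that by (intro sum.cong) auto
    finally show ?thesis using that by simp
  qed
  have x0: "\<exists>i<n. x i \<noteq> 0"
  proof (rule ccontr)
    assume "\<not> ?thesis"
    then have "row_times n x A j = 0" for A j by (simp add: row_times_def)
    then have "b j \<beta> = 0" if "j < n" for j \<beta> using xZ[OF that, of \<beta>] by simp
    then have "u \<beta> = 0" for \<beta> unfolding b(3)[OF uV, of \<beta>] by simp
    then show False using u(2) by auto
  qed
  have y0: "\<exists>i<n. y i \<noteq> 0"
  proof (rule ccontr)
    assume "\<not> ?thesis"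
    then have "row_times n y G j = 0" for j by (simp add: row_times_def)
    then show False using x0 yG by auto
  qed
  have "row_times n y (series_eval f n ?W) j = 0" if j: "j < n" for j
  proof -
    have "eval_kernel n ?W y j = (\<lambda>\<beta>. \<Sum>q<n. cnj (S $$ (q, j)) * b q \<beta>)"
    proof
      fix \<beta>
      note E = word_eval_carrier[OF Z, of \<beta>]
      have "row_times n y (G * word_eval n Z \<beta> * S) j
          = row_times n (row_times n y (G * word_eval n Z \<beta>)) S j"
        by (rule row_times_mult[OF mult_carrier_mat[OF G E] S j])
      also have "\<dots> = row_times n (\<lambda>q. cnj (b q \<beta>)) S j"
      proof (rule row_times_cong)
        fix q assume q: "q < n"
        have "row_times n y (G * word_eval n Z \<beta>) q = row_times n (row_times n y G) (word_eval n Z \<beta>) q"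
          by (rule row_times_mult[OF G E q])
        also have "\<dots> = row_times n x (word_eval n Z \<beta>) q" by (rule row_times_cong) (rule yG)
        finally show "row_times n y (G * word_eval n Z \<beta>) q = cnj (b q \<beta>)" by (simp only: xZ[OF q])
      qed
      finally show "eval_kernel n ?W y j \<beta> = (\<Sum>q<n. cnj (S $$ (q, j)) * b q \<beta>)"
        unfolding eval_kernel_def word_eval_similar[OF Z S G SG]
        by (simp add: row_times_def[of n "\<lambda>q. cnj (b q \<beta>)"] mult.commute)
    qed
    then have "fip f (eval_kernel n ?W y j) = (\<Sum>q<n. cnj (cnj (S $$ (q, j))) * fip f (b q))"
      using fip_linear_combination_right[where n = n and z = b and h = f and c = "\<lambda>q. cnj (S $$ (q, j))"]
        orth b(1) f by simp
    also have "\<dots> = 0" using orth b(1) by (intro sum.neutral) auto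
    finally show ?thesis using row_times_series_eval[OF W j f] by simp
  qed
  then have "det (series_eval f n ?W) = 0" using det_0_iff_row_kernel[OF series_eval_carrier] y0 by blast
  moreover have "n \<ge> 1" using y0 by auto
  ultimately show ?thesis using W by blast
qed

theorem theoremC:
  fixes r :: "('d::finite) nc_expr set" and f :: "'d nc_series"
  assumes "r \<in> nc_rational_functions" and "regular_at_0 r"
    and "power_series_at_0 r f" and "f \<in> fock_space"
  shows "outer f \<longleftrightarrow> (\<forall>n\<ge>1. \<forall>Z\<in>row_ball n. det (series_eval f n Z) \<noteq> 0)"
proof
  assume "outer f"
  then show "\<forall>n\<ge>1. \<forall>Z\<in>row_ball n. det (series_eval f n Z) \<noteq> 0"
    using outer_imp_det_nonzero by blast
next
  assume nonsing: "\<forall>n\<ge>1. \<forall>Z\<in>row_ball n. det (series_eval f n Z) \<noteq> 0"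
  show "outer f"
  proof (rule ccontr)
    assume "\<not> outer f"
    have "recognizable f" by (rule power_series_recognizable[OF assms(1-3)])
    from not_outer_recognizable_annihilator[OF assms(4) this \<open>\<not> outer f\<close>]
    show False using annihilator_singular_point[OF assms(4)] nonsing by blast
  qed
qed

end
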